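(* Let $G$ be a Lie group of dimension $\geq 5$. Suppose $G$ admits a left invariant contact structure. Then there is no flat left invariant Riemannian metric on $G$. More precisely, a contact Lie group admits a flat left invariant Riemannian metric if and only if it is locally isomorphic to the group $E(2):=\mathbb R^2\rtimes O(2)$ of rigid motions of the Euclidean $2$-space.
   Context: Lie groups are real and finite dimensional. A left invariant contact structure on a Lie group $G$ of dimension $2n+1$ is given by a left invariant differential $1$-form $\eta^+$ on $G$ such that $(d\eta^+)^n\wedge\eta^+\neq 0$ at every point of $G$; a Lie group with such a form is called a contact Lie group. A Riemannian metric is flat if its sectional curvature vanishes identically. Two Lie groups are locally isomorphic if their Lie algebras are isomorphic. No compatibility between the metric and the contact form is assumed.
   Formalization: The "if and only if" is stated for contact Lie groups of dimension other than 1: the line ℝ with η = dt is a contact Lie group (n = 0) whose left invariant metrics are flat, yet it is not locally isomorphic to the 3-dimensional group E(2). *)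

theory Defs
  imports "HOL-Analysis.Analysis" "HOL-Algebra.Group"
begin

section \<open>Smooth maps on open subsets of normed spaces\<close>

primrec Ck_on :: "nat \<Rightarrow> 'a::real_normed_vector set \<Rightarrow> ('a \<Rightarrow> 'b::real_normed_vector) \<Rightarrow> bool" where
  "Ck_on 0 S f \<longleftrightarrow> continuous_on S f"
| "Ck_on (Suc k) S f \<longleftrightarrow>
     (\<forall>x\<in>S. f differentiable (at x)) \<and> (\<forall>v. Ck_on k S (\<lambda>x. frechet_derivative f (at x) v))"

text \<open>This is only used for open sets of finite-dimensional spaces.\<close>

definition smooth_on :: "'a::real_normed_vector set \<Rightarrow> ('a \<Rightarrow> 'b::real_normed_vector) \<Rightarrow> bool" where
  "smooth_on S f \<longleftrightarrow> (\<forall>k. Ck_on k S f)"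


section \<open>Lie groups\<close>

text \<open>
  A chart is a pair \<open>(U, \<phi>)\<close> of a domain and a coordinate map into the Euclidean space \<open>'e\<close>;
  the dimension of the group is \<open>DIM('e)\<close>.
\<close>

type_synonym ('a, 'e) chart = "'a set \<times> ('a \<Rightarrow> 'e)"

definition chart_inv :: "('a, 'e) chart \<Rightarrow> 'e \<Rightarrow> 'a" where
  "chart_inv c = inv_into (fst c) (snd c)"

definition chart_range :: "('a, 'e) chart \<Rightarrow> 'e set" where
  "chart_range c = snd c ` fst c"

record ('a, 'e) lie_struct = "'a monoid" +
  gtop :: "'a topology"
  atlas :: "('a, 'e) chart set"

definition smooth_manifold :: "'a topology \<Rightarrow> ('a, 'e::euclidean_space) chart set \<Rightarrow> bool" where
  "smooth_manifold T A \<longleftrightarrow>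
     Hausdorff_space T \<and> second_countable T \<and>
     topspace T = (\<Union>c\<in>A. fst c) \<and>
     (\<forall>c\<in>A. openin T (fst c) \<and> open (chart_range c) \<and>
        homeomorphic_map (subtopology T (fst c)) (top_of_set (chart_range c)) (snd c)) \<and>
     (\<forall>c\<in>A. \<forall>d\<in>A. smooth_on (snd c ` (fst c \<inter> fst d)) (snd d \<circ> chart_inv c))"

definition lie_group :: "('a, 'e::euclidean_space) lie_struct \<Rightarrow> bool" where
  "lie_group G \<longleftrightarrow>
     group G \<and> smooth_manifold (gtop G) (atlas G) \<and> topspace (gtop G) = carrier G \<and>
     continuous_map (prod_topology (gtop G) (gtop G)) (gtop G) (\<lambda>(g, h). g \<otimes>\<^bsub>G\<^esub> h) \<and>
     (\<forall>c\<in>atlas G. \<forall>d\<in>atlas G. \<forall>b\<in>atlas G.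
        smooth_on {(x, y) \<in> chart_range c \<times> chart_range d.
                     chart_inv c x \<otimes>\<^bsub>G\<^esub> chart_inv d y \<in> fst b}
          (\<lambda>(x, y). snd b (chart_inv c x \<otimes>\<^bsub>G\<^esub> chart_inv d y))) \<and>
     continuous_map (gtop G) (gtop G) (\<lambda>g. inv\<^bsub>G\<^esub> g) \<and>
     (\<forall>c\<in>atlas G. \<forall>b\<in>atlas G.
        smooth_on {x \<in> chart_range c. inv\<^bsub>G\<^esub> (chart_inv c x) \<in> fst b}
          (\<lambda>x. snd b (inv\<^bsub>G\<^esub> (chart_inv c x))))"


section \<open>Tangent spaces, vector fields and the Lie algebra\<close>

text \<open>
  For each point a chart around it is chosen, and the tangent space at that point is identified
  with \<open>'e\<close> through this chart.  Hence vector fields are functions \<open>'a \<Rightarrow> 'e\<close> and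
  covariant 2-tensor fields are functions \<open>'a \<Rightarrow> 'e \<Rightarrow> 'e \<Rightarrow> real\<close>.  As the chosen chart varies
  with the point in an arbitrary way, smoothness and derivatives of such a field are always
  expressed through its coordinate representation in one fixed chart.
\<close>

definition chart_at :: "('a, 'e) lie_struct \<Rightarrow> 'a \<Rightarrow> ('a, 'e) chart" where
  "chart_at G p = (SOME c. c \<in> atlas G \<and> p \<in> fst c)"

definition tangent_map ::
  "('a, 'e::euclidean_space) lie_struct \<Rightarrow> ('b, 'f::euclidean_space) lie_struct \<Rightarrow>
   ('a \<Rightarrow> 'b) \<Rightarrow> 'a \<Rightarrow> 'e \<Rightarrow> 'f" where
  "tangent_map G H f p =
     frechet_derivative (\<lambda>x. snd (chart_at H (f p)) (f (chart_inv (chart_at G p) x)))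
       (at (snd (chart_at G p) p))"

text \<open>
  The first map sends a tangent vector at \<open>p\<close> to its components in the chart \<open>c\<close>.  The second one
  goes the other way: components in the chart \<open>c\<close> at the coordinates \<open>x\<close> are sent to a
  tangent vector at the point of \<open>G\<close> with these coordinates.
\<close>

definition to_coords ::
  "('a, 'e::euclidean_space) lie_struct \<Rightarrow> ('a, 'e) chart \<Rightarrow> 'a \<Rightarrow> 'e \<Rightarrow> 'e" where
  "to_coords G c p =
     frechet_derivative (\<lambda>y. snd c (chart_inv (chart_at G p) y)) (at (snd (chart_at G p) p))"

definition from_coords ::
  "('a, 'e::euclidean_space) lie_struct \<Rightarrow> ('a, 'e) chart \<Rightarrow> 'e \<Rightarrow> 'e \<Rightarrow> 'e" where
  "from_coords G c x =
     frechet_derivative (\<lambda>y. snd (chart_at G (chart_inv c x)) (chart_inv c y)) (at x)"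

definition field_in_chart ::
  "('a, 'e::euclidean_space) lie_struct \<Rightarrow> ('a, 'e) chart \<Rightarrow> ('a \<Rightarrow> 'e) \<Rightarrow> 'e \<Rightarrow> 'e" where
  "field_in_chart G c X x = to_coords G c (chart_inv c x) (X (chart_inv c x))"

definition field_bracket ::
  "('a, 'e::euclidean_space) lie_struct \<Rightarrow> ('a \<Rightarrow> 'e) \<Rightarrow> ('a \<Rightarrow> 'e) \<Rightarrow> 'a \<Rightarrow> 'e" where
  "field_bracket G X Y p =
     (let c = chart_at G p; x = snd c p; X' = field_in_chart G c X; Y' = field_in_chart G c Y
      in frechet_derivative Y' (at x) (X' x) - frechet_derivative X' (at x) (Y' x))"

definition left_invariant_field ::
  "('a, 'e::euclidean_space) lie_struct \<Rightarrow> 'e \<Rightarrow> 'a \<Rightarrow> 'e" where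
  "left_invariant_field G u g = tangent_map G G (\<lambda>h. g \<otimes>\<^bsub>G\<^esub> h) \<one>\<^bsub>G\<^esub> u"

text \<open>The Lie algebra of \<open>G\<close> is the tangent space \<open>'e\<close> at the identity with this bracket.\<close>

definition lie_bracket :: "('a, 'e::euclidean_space) lie_struct \<Rightarrow> 'e \<Rightarrow> 'e \<Rightarrow> 'e" where
  "lie_bracket G u v =
     field_bracket G (left_invariant_field G u) (left_invariant_field G v) \<one>\<^bsub>G\<^esub>"

definition locally_isomorphic ::
  "('a, 'e::euclidean_space) lie_struct \<Rightarrow> ('b, 'f::euclidean_space) lie_struct \<Rightarrow> bool" where
  "locally_isomorphic G H \<longleftrightarrow>
     (\<exists>F :: 'e \<Rightarrow> 'f. linear F \<and> bij F \<and>
        (\<forall>u v. F (lie_bracket G u v) = lie_bracket H (F u) (F v)))"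


section \<open>Contact structures\<close>

text \<open>
  An alternating \<open>k\<close>-form on \<open>'e\<close> is represented by a function on sequences of vectors that
  only looks at the first \<open>k\<close> entries.
\<close>

type_synonym 'e form = "(nat \<Rightarrow> 'e) \<Rightarrow> real"

definition wedge :: "nat \<Rightarrow> nat \<Rightarrow> 'e form \<Rightarrow> 'e form \<Rightarrow> 'e form" where
  "wedge k l \<alpha> \<beta> v =
     (\<Sum>\<sigma> | \<sigma> permutes {..<k + l}.
        of_int (sign \<sigma>) * \<alpha> (\<lambda>i. v (\<sigma> i)) * \<beta> (\<lambda>i. v (\<sigma> (k + i)))) / (fact k * fact l)"

primrec wedge_power :: "nat \<Rightarrow> 'e form \<Rightarrow> 'e form" where \<comment> \<open>powers of a 2-form\<close>
  "wedge_power 0 \<omega> = (\<lambda>_. 1)"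
| "wedge_power (Suc n) \<omega> = wedge (2 * n) 2 (wedge_power n \<omega>) \<omega>"

definition one_form_in_chart ::
  "('a, 'e::euclidean_space) lie_struct \<Rightarrow> ('a, 'e) chart \<Rightarrow> ('a \<Rightarrow> 'e \<Rightarrow> real) \<Rightarrow> 'e \<Rightarrow> 'e \<Rightarrow> real"
  where "one_form_in_chart G c \<eta> x u = \<eta> (chart_inv c x) (from_coords G c x u)"

definition differential_one_form ::
  "('a, 'e::euclidean_space) lie_struct \<Rightarrow> ('a \<Rightarrow> 'e \<Rightarrow> real) \<Rightarrow> bool" where
  "differential_one_form G \<eta> \<longleftrightarrow>
     (\<forall>p\<in>carrier G. linear (\<eta> p)) \<and>
     (\<forall>c\<in>atlas G. \<forall>u. smooth_on (chart_range c) (\<lambda>x. one_form_in_chart G c \<eta> x u))"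

definition left_invariant_one_form ::
  "('a, 'e::euclidean_space) lie_struct \<Rightarrow> ('a \<Rightarrow> 'e \<Rightarrow> real) \<Rightarrow> bool" where
  "left_invariant_one_form G \<eta> \<longleftrightarrow>
     differential_one_form G \<eta> \<and>
     (\<forall>g\<in>carrier G. \<forall>p\<in>carrier G. \<forall>u.
        \<eta> (g \<otimes>\<^bsub>G\<^esub> p) (tangent_map G G (\<lambda>h. g \<otimes>\<^bsub>G\<^esub> h) p u) = \<eta> p u)"

definition ext_deriv ::
  "('a, 'e::euclidean_space) lie_struct \<Rightarrow> ('a \<Rightarrow> 'e \<Rightarrow> real) \<Rightarrow> 'a \<Rightarrow> 'e \<Rightarrow> 'e \<Rightarrow> real" where
  "ext_deriv G \<eta> p u v =
     (let c = chart_at G p; x = snd c p; \<eta>' = one_form_in_chart G c \<eta>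
      in frechet_derivative (\<lambda>y. \<eta>' y v) (at x) u - frechet_derivative (\<lambda>y. \<eta>' y u) (at x) v)"

definition left_invariant_contact ::
  "('a, 'e::euclidean_space) lie_struct \<Rightarrow> ('a \<Rightarrow> 'e \<Rightarrow> real) \<Rightarrow> bool" where
  "left_invariant_contact G \<eta> \<longleftrightarrow>
     left_invariant_one_form G \<eta> \<and>
     (\<exists>n. DIM('e) = 2 * n + 1 \<and>
        (\<forall>p\<in>carrier G.
           wedge (2 * n) 1 (wedge_power n (\<lambda>v. ext_deriv G \<eta> p (v 0) (v 1))) (\<lambda>v. \<eta> p (v 0))
             \<noteq> (\<lambda>_. 0)))"

definition contact_lie_group :: "('a, 'e::euclidean_space) lie_struct \<Rightarrow> bool" where
  "contact_lie_group G \<longleftrightarrow> lie_group G \<and> (\<exists>\<eta>. left_invariant_contact G \<eta>)"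


section \<open>Riemannian metrics and curvature\<close>

definition tensor_in_chart ::
  "('a, 'e::euclidean_space) lie_struct \<Rightarrow> ('a, 'e) chart \<Rightarrow> ('a \<Rightarrow> 'e \<Rightarrow> 'e \<Rightarrow> real) \<Rightarrow>
   'e \<Rightarrow> 'e \<Rightarrow> 'e \<Rightarrow> real"
  where "tensor_in_chart G c m x u v =
    m (chart_inv c x) (from_coords G c x u) (from_coords G c x v)"

definition riemannian_metric ::
  "('a, 'e::euclidean_space) lie_struct \<Rightarrow> ('a \<Rightarrow> 'e \<Rightarrow> 'e \<Rightarrow> real) \<Rightarrow> bool" where
  "riemannian_metric G m \<longleftrightarrow>
     (\<forall>p\<in>carrier G. bilinear (m p) \<and> (\<forall>u v. m p u v = m p v u) \<and> (\<forall>u. u \<noteq> 0 \<longrightarrow> m p u u > 0)) \<and>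
     (\<forall>c\<in>atlas G. \<forall>u v. smooth_on (chart_range c) (\<lambda>x. tensor_in_chart G c m x u v))"

definition left_invariant_metric ::
  "('a, 'e::euclidean_space) lie_struct \<Rightarrow> ('a \<Rightarrow> 'e \<Rightarrow> 'e \<Rightarrow> real) \<Rightarrow> bool" where
  "left_invariant_metric G m \<longleftrightarrow>
     riemannian_metric G m \<and>
     (\<forall>g\<in>carrier G. \<forall>p\<in>carrier G. \<forall>u v.
        m (g \<otimes>\<^bsub>G\<^esub> p) (tangent_map G G (\<lambda>h. g \<otimes>\<^bsub>G\<^esub> h) p u)
                  (tangent_map G G (\<lambda>h. g \<otimes>\<^bsub>G\<^esub> h) p v) = m p u v)"

text \<open>
  The Levi-Civita connection of a metric \<open>m\<close> on an open subset of \<open>'e\<close> is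
  \<open>\<nabla>\<^sub>X Y = D Y (X) + \<Gamma> (X, Y)\<close>, where \<open>\<Gamma>\<close> is the following Christoffel map, and the curvature
  tensor \<open>R (u, v) w = \<nabla>\<^sub>u \<nabla>\<^sub>v w - \<nabla>\<^sub>v \<nabla>\<^sub>u w\<close> is evaluated on constant fields, whose brackets vanish.
\<close>

definition christoffel ::
  "('e::euclidean_space \<Rightarrow> 'e \<Rightarrow> 'e \<Rightarrow> real) \<Rightarrow> 'e \<Rightarrow> 'e \<Rightarrow> 'e \<Rightarrow> 'e" where
  "christoffel m x u v =
     (THE w. \<forall>z. 2 * m x w z =
        frechet_derivative (\<lambda>y. m y v z) (at x) u + frechet_derivative (\<lambda>y. m y u z) (at x) v
        - frechet_derivative (\<lambda>y. m y u v) (at x) z)"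

definition curvature ::
  "('e::euclidean_space \<Rightarrow> 'e \<Rightarrow> 'e \<Rightarrow> real) \<Rightarrow> 'e \<Rightarrow> 'e \<Rightarrow> 'e \<Rightarrow> 'e \<Rightarrow> 'e" where
  "curvature m x u v w =
     frechet_derivative (\<lambda>y. christoffel m y v w) (at x) u
     - frechet_derivative (\<lambda>y. christoffel m y u w) (at x) v
     + christoffel m x u (christoffel m x v w) - christoffel m x v (christoffel m x u w)"

definition sectional_curvature ::
  "('a, 'e::euclidean_space) lie_struct \<Rightarrow> ('a \<Rightarrow> 'e \<Rightarrow> 'e \<Rightarrow> real) \<Rightarrow> 'a \<Rightarrow> 'e \<Rightarrow> 'e \<Rightarrow> real" where
  "sectional_curvature G m p u v =
     (let c = chart_at G p; x = snd c p
      in m p (curvature (tensor_in_chart G c m) x u v v) u /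
           (m p u u * m p v v - (m p u v)\<^sup>2))"

definition flat ::
  "('a, 'e::euclidean_space) lie_struct \<Rightarrow> ('a \<Rightarrow> 'e \<Rightarrow> 'e \<Rightarrow> real) \<Rightarrow> bool" where
  "flat G m \<longleftrightarrow>
     (\<forall>p\<in>carrier G. \<forall>u v. u \<noteq> v \<and> independent {u, v} \<longrightarrow> sectional_curvature G m p u v = 0)"

definition admits_flat_left_invariant_metric ::
  "('a, 'e::euclidean_space) lie_struct \<Rightarrow> bool" where
  "admits_flat_left_invariant_metric G \<longleftrightarrow> (\<exists>m. left_invariant_metric G m \<and> flat G m)"


section \<open>The group of rigid motions of the Euclidean plane\<close>

text \<open>
  The pair \<open>(a, A)\<close> stands for the motion \<open>x \<mapsto> A x + a\<close>.  Around \<open>(a, A)\<close> the coordinates of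
  \<open>(b, rot t A)\<close>, where \<open>-\<pi> < t < \<pi>\<close>, are \<open>(b, t)\<close>.
\<close>

definition rot :: "real \<Rightarrow> real^2^2" where
  "rot t = vector [vector [cos t, - sin t], vector [sin t, cos t]]"

definition E2_param :: "real^2^2 \<Rightarrow> (real^2) \<times> real \<Rightarrow> (real^2) \<times> (real^2^2)" where
  "E2_param A = (\<lambda>(b, t). (b, rot t ** A))"

definition E2_chart :: "real^2^2 \<Rightarrow> ((real^2) \<times> (real^2^2), (real^2) \<times> real) chart" where
  "E2_chart A =
     (E2_param A ` (UNIV \<times> {-pi<..<pi}), inv_into (UNIV \<times> {-pi<..<pi}) (E2_param A))"

definition E2 :: "((real^2) \<times> (real^2^2), (real^2) \<times> real) lie_struct" where
  "E2 = \<lparr> carrier = {(a, A). orthogonal_matrix A},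
          mult = (\<lambda>(a, A) (b, B). (a + A *v b, A ** B)),
          one = (0, mat 1),
          gtop = top_of_set {(a, A). orthogonal_matrix A},
          atlas = {E2_chart A | A. orthogonal_matrix A} \<rparr>"

end

theory Submission
  imports Defs
begin

text \<open>
  In a chart, the Maurer--Cartan form \<open>Y\<close> turns a left invariant metric into \<open>\<langle>Y a, Y b\<rangle>\<close>, and the
  structure equation \<open>dY(a, b) = - [Y a, Y b]\<close> makes the Levi-Civita connection gauge equivalent to
  the algebraic one, \<open>\<nabla> : \<gg> \<rightarrow> so(\<gg>)\<close> with \<open>\<nabla>\<^sub>u v - \<nabla>\<^sub>v u = [u, v]\<close>.  Flatness says that \<open>\<nabla>\<close> is a
  representation; a Casimir argument then gives Milnor's splitting of \<open>\<gg>\<close> into the abelian ideal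
  \<open>ker \<nabla>\<close> and its orthogonal complement, where \<open>\<nabla>\<^sub>x y = 0\<close> and \<open>\<nabla>\<^sub>x \<nabla>\<^sub>y = \<nabla>\<^sub>y \<nabla>\<^sub>x\<close> for \<open>x, y\<close> in the latter.

  Let \<open>\<xi> \<in> ker \<nabla>\<close> represent the contact form on \<open>ker \<nabla>\<close>.  Nondegeneracy forces \<open>ker \<nabla>\<close> to be spanned by
  \<open>\<xi>\<close> and the \<open>\<nabla>\<^sub>x \<xi>\<close>, and \<open>x \<mapsto> \<nabla>\<^sub>x \<xi>\<close> to be injective on the complement.  The form
  \<open>\<langle>\<nabla>\<^sub>x \<nabla>\<^sub>y \<xi>, \<nabla>\<^sub>z \<xi>\<rangle>\<close> is symmetric in \<open>x, y\<close> and antisymmetric in \<open>y, z\<close>, so it is zero and all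
  \<open>\<nabla>\<^sub>x \<nabla>\<^sub>y \<xi>\<close> are multiples of \<open>\<xi>\<close>; this leaves room for a complement of dimension one only, and
  the Lie algebra is that of \<open>E(2)\<close>.
\<close>

section \<open>Calculus of smooth maps\<close>

text \<open>A line with a nonzero left invariant form is a contact Lie group: for n = 0 the contact
  condition asks for no more. Such a line is flat and has the wrong dimension for E(2), so the
  equivalence is claimed away from dimension one. Since E(2) has dimension 3, the equivalence
  contains the claim on dimension at least 5. The Casimir argument has its origin in skewness: minus
  the trace of \<open>nabla x\<close> composed with \<open>nabla y\<close> is a sum of squares for
  \<open>x = y\<close>, hence an invariant form that is positive definite off the kernel of
  \<open>nabla\<close>. Its orthonormal bases give the Casimir element. Two obstacles shape the
  analysis. The chart that identifies a tangent space with \<open>'e\<close> jumps from point to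
  point, so each invariant object is first rewritten in one fixed chart by derivatives of left
  translations. And vanishing sectional curvature has to be polarised to a vanishing curvature
  tensor before \<open>nabla\<close> is known to be a representation; the Bianchi identity needed
  for this is taken from the symmetry of the Christoffel map.\<close>

lemma Ck_on_cong:
  assumes "open S" "Ck_on k S f" "\<And>x. x \<in> S \<Longrightarrow> f x = g x"
  shows "Ck_on k S g"
  using assms(2,3)
proof (induction k arbitrary: f g)
  case 0
  then show ?case by (metis Ck_on.simps(1) continuous_on_cong)
next
  case (Suc k)
  have d: "f differentiable (at x)" if "x \<in> S" for x using Suc.prems that by simp
  have g: "(g has_derivative frechet_derivative f (at x)) (at x)" if "x \<in> S" for x
    using d[OF that] Suc.prems(2) assms(1) that
    by (metis frechet_derivative_works has_derivative_transform_within_open)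
  have e: "frechet_derivative f (at x) v = frechet_derivative g (at x) v" if "x \<in> S" for x v
    using g[OF that] frechet_derivative_at by metis
  have "Ck_on k S (\<lambda>x. frechet_derivative g (at x) v)" for v
    using Suc.IH[of "\<lambda>x. frechet_derivative f (at x) v"] Suc.prems(1) e by simp
  then show ?case using g by (auto simp: differentiable_def)
qed

lemma Ck_on_Suc_lower: "Ck_on (Suc k) S f \<Longrightarrow> Ck_on k S f"
proof (induction k arbitrary: f)
  case 0
  then show ?case by (auto intro!: continuous_at_imp_continuous_on differentiable_imp_continuous_within)
next
  case (Suc k)
  then show ?case by (metis Ck_on.simps(2))
qed

lemma Ck_on_local:
  assumes "\<And>x. x \<in> S \<Longrightarrow> \<exists>T. open T \<and> x \<in> T \<and> Ck_on k T f"
  shows "Ck_on k S f"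
  using assms
proof (induction k arbitrary: f)
  case 0
  then show ?case
    by (metis Ck_on.simps(1) continuous_at_imp_continuous_on continuous_on_eq_continuous_at)
next
  case (Suc k)
  have "Ck_on k S (\<lambda>x. frechet_derivative f (at x) v)" for v
    by (rule Suc.IH) (use Suc.prems in force)
  then show ?case using Suc.prems by force
qed

text \<open>The closure proofs give a derivative by a formula; this turns such a formula into the
  \<open>frechet_derivative\<close> that \<open>Ck_on\<close> is stated with.\<close>

lemma Ck_on_SucI:
  assumes "open S" "\<And>x. x \<in> S \<Longrightarrow> (f has_derivative f' x) (at x)"
    and "\<And>v. Ck_on k S (\<lambda>x. f' x v)"
  shows "Ck_on (Suc k) S f"
proof -
  have "f' x v = frechet_derivative f (at x) v" if "x \<in> S" for x v
    using assms(2)[OF that] frechet_derivative_at by metis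
  then have "Ck_on k S (\<lambda>x. frechet_derivative f (at x) v)" for v
    using Ck_on_cong[OF assms(1) assms(3)] by simp
  then show ?thesis using assms(2) by (auto simp: differentiable_def)
qed

lemma Ck_on_SucD:
  assumes "Ck_on (Suc k) S f" "x \<in> S"
  shows "(f has_derivative frechet_derivative f (at x)) (at x)"
  using assms by (simp add: frechet_derivative_works)

lemma Ck_on_const: "open S \<Longrightarrow> Ck_on k S (\<lambda>x. c)"
  by (induction k arbitrary: c) simp_all

lemma Ck_on_bounded_linear:
  assumes "open S" "bounded_linear L" "Ck_on k S f"
  shows "Ck_on k S (\<lambda>x. L (f x))"
  using assms(3)
proof (induction k arbitrary: f)
  case 0
  then show ?case using assms(2) by (auto intro: bounded_linear.continuous_on)
next
  case (Suc k)
  show ?case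
  proof (rule Ck_on_SucI[OF assms(1)])
    show "((\<lambda>x. L (f x)) has_derivative (\<lambda>v. L (frechet_derivative f (at x) v))) (at x)"
      if "x \<in> S" for x
      by (rule bounded_linear.has_derivative[OF assms(2) Ck_on_SucD[OF Suc.prems that]])
    show "Ck_on k S (\<lambda>x. L (frechet_derivative f (at x) v))" for v
      by (rule Suc.IH) (use Suc.prems in simp)
  qed
qed

lemma Ck_on_linear: "open S \<Longrightarrow> bounded_linear L \<Longrightarrow> Ck_on k S L"
proof (cases k)
  case 0
  assume "bounded_linear L" then show ?thesis using 0 by (auto intro: linear_continuous_on)
next
  case (Suc j)
  assume "bounded_linear L" "open S"
  then show ?thesis unfolding Suc
    by (intro Ck_on_SucI[where f' = "\<lambda>_. L"] Ck_on_const) (auto intro: bounded_linear_imp_has_derivative)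
qed

lemma Ck_on_add:
  assumes "open S" "Ck_on k S f" "Ck_on k S g"
  shows "Ck_on k S (\<lambda>x. f x + g x)"
  using assms(2,3)
proof (induction k arbitrary: f g)
  case 0
  then show ?case by (auto intro: continuous_on_add)
next
  case (Suc k)
  show ?case
  proof (rule Ck_on_SucI[OF assms(1)])
    show "((\<lambda>x. f x + g x) has_derivative
        (\<lambda>v. frechet_derivative f (at x) v + frechet_derivative g (at x) v)) (at x)" if "x \<in> S" for x
      using has_derivative_add[OF Ck_on_SucD[OF Suc.prems(1) that] Ck_on_SucD[OF Suc.prems(2) that]] .
    show "Ck_on k S (\<lambda>x. frechet_derivative f (at x) v + frechet_derivative g (at x) v)" for v
      by (rule Suc.IH) (use Suc.prems in simp_all)
  qed
qed

lemma Ck_on_sum: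
  assumes "open S" "\<And>i. i \<in> I \<Longrightarrow> Ck_on k S (f i)"
  shows "Ck_on k S (\<lambda>x. \<Sum>i\<in>I. f i x)"
  using assms(2)
proof (induction I rule: infinite_finite_induct)
  case (insert i I)
  have "Ck_on k S (\<lambda>x. f i x + (\<Sum>i\<in>I. f i x))"
    by (rule Ck_on_add[OF assms(1)]) (use insert in simp_all)
  then show ?case using insert.hyps by simp
qed (simp_all add: Ck_on_const assms(1))

lemma Ck_on_bounded_bilinear:
  assumes "open S" "bounded_bilinear B" "Ck_on k S f" "Ck_on k S g"
  shows "Ck_on k S (\<lambda>x. B (f x) (g x))"
  using assms(3,4)
proof (induction k arbitrary: f g)
  case 0
  then show ?case using assms(2) by (auto intro: bounded_bilinear.continuous_on)
next
  case (Suc k)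
  show ?case
  proof (rule Ck_on_SucI[OF assms(1)])
    show "((\<lambda>x. B (f x) (g x)) has_derivative
        (\<lambda>v. B (f x) (frechet_derivative g (at x) v) + B (frechet_derivative f (at x) v) (g x))) (at x)"
      if "x \<in> S" for x
      by (rule bounded_bilinear.FDERIV[OF assms(2) Ck_on_SucD[OF Suc.prems(1) that]
            Ck_on_SucD[OF Suc.prems(2) that]])
    show "Ck_on k S (\<lambda>x. B (f x) (frechet_derivative g (at x) v) + B (frechet_derivative f (at x) v) (g x))"
      for v
      using Suc.IH[of f "\<lambda>x. frechet_derivative g (at x) v"]
        Suc.IH[of "\<lambda>x. frechet_derivative f (at x) v" g] Suc.prems
        Ck_on_Suc_lower[OF Suc.prems(1)] Ck_on_Suc_lower[OF Suc.prems(2)]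
      by (intro Ck_on_add assms(1)) auto
  qed
qed

lemma Ck_on_Pair:
  assumes "open S" "Ck_on k S f" "Ck_on k S g"
  shows "Ck_on k S (\<lambda>x. (f x, g x))"
  using assms(2,3)
proof (induction k arbitrary: f g)
  case 0
  then show ?case by (auto intro: continuous_on_Pair)
next
  case (Suc k)
  show ?case
  proof (rule Ck_on_SucI[OF assms(1)])
    show "((\<lambda>x. (f x, g x)) has_derivative
        (\<lambda>v. (frechet_derivative f (at x) v, frechet_derivative g (at x) v))) (at x)" if "x \<in> S" for x
      using has_derivative_Pair[OF Ck_on_SucD[OF Suc.prems(1) that] Ck_on_SucD[OF Suc.prems(2) that]] .
    show "Ck_on k S (\<lambda>x. (frechet_derivative f (at x) v, frechet_derivative g (at x) v))" for v
      by (rule Suc.IH) (use Suc.prems in simp_all)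
  qed
qed

lemma linear_eq_sum_Basis:
  fixes L :: "'a::euclidean_space \<Rightarrow> 'b::real_vector"
  assumes "linear L"
  shows "L v = (\<Sum>b\<in>Basis. (v \<bullet> b) *\<^sub>R L b)"
proof -
  have "L v = L (\<Sum>b\<in>Basis. (v \<bullet> b) *\<^sub>R b)" by (simp add: euclidean_representation)
  then show ?thesis by (simp add: linear_sum[OF assms] linear_cmul[OF assms])
qed

text \<open>By the chain rule the derivative is \<open>?g' (f x) (?f' x v)\<close>, whose direction
  moves with \<open>x\<close>, while the induction hypothesis covers \<open>?g' (f x) b\<close> for
  fixed \<open>b\<close>. Expanding the direction in \<open>Basis\<close> reduces the one to the
  other.\<close>

lemma Ck_on_compose:
  fixes f :: "'a::real_normed_vector \<Rightarrow> 'b::euclidean_space"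
  assumes "open S" "open T" "\<And>x. x \<in> S \<Longrightarrow> f x \<in> T" "Ck_on k S f" "Ck_on k T g"
  shows "Ck_on k S (\<lambda>x. g (f x))"
  using assms(4,5)
proof (induction k arbitrary: g)
  case 0
  then show ?case using assms(3) by (auto intro: continuous_on_compose2)
next
  case (Suc k)
  let ?f' = "\<lambda>x. frechet_derivative f (at x)" and ?g' = "\<lambda>y. frechet_derivative g (at y)"
  have gd: "(g has_derivative ?g' (f x)) (at (f x))" if "x \<in> S" for x
    using Ck_on_SucD[OF Suc.prems(2)] assms(3) that by simp
  show ?case
  proof (rule Ck_on_SucI[OF assms(1)])
    show "((\<lambda>x. g (f x)) has_derivative (\<lambda>v. \<Sum>b\<in>Basis. (?f' x v \<bullet> b) *\<^sub>R ?g' (f x) b)) (at x)"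
      if "x \<in> S" for x
    proof -
      have "((\<lambda>x. g (f x)) has_derivative (\<lambda>v. ?g' (f x) (?f' x v))) (at x)"
        using has_derivative_compose[OF Ck_on_SucD[OF Suc.prems(1) that] gd[OF that]] .
      moreover have "(\<lambda>v. ?g' (f x) (?f' x v)) = (\<lambda>v. \<Sum>b\<in>Basis. (?f' x v \<bullet> b) *\<^sub>R ?g' (f x) b)"
        by (rule ext, rule linear_eq_sum_Basis[of "?g' (f x)"])
          (rule has_derivative_linear[OF gd[OF that]])
      ultimately show ?thesis by metis
    qed
    show "Ck_on k S (\<lambda>x. \<Sum>b\<in>Basis. (?f' x v \<bullet> b) *\<^sub>R ?g' (f x) b)" for v
    proof (intro Ck_on_sum[OF assms(1)] Ck_on_bounded_bilinear[OF assms(1) bounded_bilinear_scaleR])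
      fix b :: 'b
      show "Ck_on k S (\<lambda>x. ?f' x v \<bullet> b)"
        using Suc.prems(1) by (intro Ck_on_bounded_linear[OF assms(1) bounded_linear_inner_left]) simp
      show "Ck_on k S (\<lambda>x. ?g' (f x) b)"
        using Suc.prems by (intro Suc.IH Ck_on_Suc_lower[OF Suc.prems(1)]) simp
    qed
  qed
qed

lemma smooth_onD: "smooth_on S f \<Longrightarrow> Ck_on k S f"
  by (simp add: smooth_on_def)

lemma smooth_on_deriv: "smooth_on S f \<Longrightarrow> smooth_on S (\<lambda>x. frechet_derivative f (at x) v)"
  by (metis Ck_on.simps(2) smooth_on_def)

lemma smooth_on_has_derivative:
  assumes "smooth_on S f" "x \<in> S"
  shows "(f has_derivative frechet_derivative f (at x)) (at x)"
  using Ck_on_SucD[OF smooth_onD[OF assms(1)] assms(2)] .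

lemma smooth_on_cong:
  "open S \<Longrightarrow> smooth_on S f \<Longrightarrow> (\<And>x. x \<in> S \<Longrightarrow> f x = g x) \<Longrightarrow> smooth_on S g"
  unfolding smooth_on_def using Ck_on_cong by blast

lemma smooth_on_local:
  "(\<And>x. x \<in> S \<Longrightarrow> \<exists>T. open T \<and> x \<in> T \<and> smooth_on T f) \<Longrightarrow> smooth_on S f"
  unfolding smooth_on_def by (metis Ck_on_local)

lemma smooth_on_const: "open S \<Longrightarrow> smooth_on S (\<lambda>x. c)"
  by (simp add: smooth_on_def Ck_on_const)

lemma smooth_on_ident: "open S \<Longrightarrow> smooth_on S (\<lambda>x. x)"
  by (simp add: smooth_on_def Ck_on_linear bounded_linear_ident)

lemma smooth_on_bounded_linear:
  "open S \<Longrightarrow> bounded_linear L \<Longrightarrow> smooth_on S f \<Longrightarrow> smooth_on S (\<lambda>x. L (f x))"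
  by (simp add: smooth_on_def Ck_on_bounded_linear)

lemma smooth_on_bounded_bilinear:
  "open S \<Longrightarrow> bounded_bilinear B \<Longrightarrow> smooth_on S f \<Longrightarrow> smooth_on S g \<Longrightarrow>
    smooth_on S (\<lambda>x. B (f x) (g x))"
  by (simp add: smooth_on_def Ck_on_bounded_bilinear)

lemma smooth_on_Pair:
  "open S \<Longrightarrow> smooth_on S f \<Longrightarrow> smooth_on S g \<Longrightarrow> smooth_on S (\<lambda>x. (f x, g x))"
  by (simp add: smooth_on_def Ck_on_Pair)

lemma smooth_on_compose:
  fixes f :: "'a::real_normed_vector \<Rightarrow> 'b::euclidean_space"
  assumes "open S" "open T" "\<And>x. x \<in> S \<Longrightarrow> f x \<in> T" "smooth_on S f" "smooth_on T g"
  shows "smooth_on S (\<lambda>x. g (f x))"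
  using assms by (auto simp: smooth_on_def intro: Ck_on_compose)

section \<open>Symmetry of second derivatives\<close>

lemma mixed_difference:
  fixes g :: "'a::real_normed_vector \<Rightarrow> real"
  assumes "0 < h" and S: "\<And>s t. 0 \<le> s \<Longrightarrow> s \<le> h \<Longrightarrow> 0 \<le> t \<Longrightarrow> t \<le> h \<Longrightarrow> x + s *\<^sub>R a + t *\<^sub>R b \<in> S"
    and g: "\<And>y. y \<in> S \<Longrightarrow> g differentiable (at y)"
    and g': "\<And>y. y \<in> S \<Longrightarrow> (\<lambda>z. frechet_derivative g (at z) a) differentiable (at y)"
  obtains s t where "0 \<le> s" "s \<le> h" "0 \<le> t" "t \<le> h"
    "g (x + h *\<^sub>R a + h *\<^sub>R b) - g (x + h *\<^sub>R a) - g (x + h *\<^sub>R b) + g x =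
     h * h * frechet_derivative (\<lambda>z. frechet_derivative g (at z) a) (at (x + s *\<^sub>R a + t *\<^sub>R b)) b"
proof -
  let ?a = "\<lambda>z. frechet_derivative g (at z) a"
  let ?ba = "\<lambda>z. frechet_derivative ?a (at z) b"
  have line: "((\<lambda>r. F (p + r *\<^sub>R w)) has_real_derivative frechet_derivative F (at (p + r *\<^sub>R w)) w) (at r)"
    if "F differentiable (at (p + r *\<^sub>R w))" for F :: "'a \<Rightarrow> real" and p w r
  proof -
    have F: "(F has_derivative frechet_derivative F (at (p + r *\<^sub>R w))) (at (p + r *\<^sub>R w))"
      using that by (simp add: frechet_derivative_works)
    have "((\<lambda>r. p + r *\<^sub>R w) has_derivative (\<lambda>k. k *\<^sub>R w)) (at r)"
      by (auto intro!: derivative_eq_intros)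
    from has_derivative_compose[OF this F]
    have "((\<lambda>r. F (p + r *\<^sub>R w)) has_derivative (\<lambda>k. frechet_derivative F (at (p + r *\<^sub>R w)) (k *\<^sub>R w))) (at r)" .
    then show ?thesis
      by (rule has_derivative_imp_has_field_derivative)
        (simp add: linear_cmul[OF has_derivative_linear[OF F]])
  qed
  \<comment> \<open>The mixed difference is the increment of this function of \<open>s\<close> from
    0 to \<open>h\<close>. The mean value theorem in direction \<open>a\<close>, followed by one in
    direction \<open>b\<close>, evaluates it.\<close>
  have "((\<lambda>s. g ((x + h *\<^sub>R b) + s *\<^sub>R a) - g (x + s *\<^sub>R a)) has_real_derivative
      ?a ((x + h *\<^sub>R b) + s *\<^sub>R a) - ?a (x + s *\<^sub>R a)) (at s)" if "0 \<le> s" "s \<le> h" for s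
    using S[of s h] S[of s 0] that assms(1)
    by (intro DERIV_diff line g) (simp_all add: algebra_simps)
  then obtain s where s: "0 < s" "s < h" and
    s': "(g ((x + h *\<^sub>R b) + h *\<^sub>R a) - g (x + h *\<^sub>R a)) - (g ((x + h *\<^sub>R b) + 0 *\<^sub>R a) - g (x + 0 *\<^sub>R a))
      = (h - 0) * (?a ((x + h *\<^sub>R b) + s *\<^sub>R a) - ?a (x + s *\<^sub>R a))"
    using MVT2[of 0 h "\<lambda>s. g ((x + h *\<^sub>R b) + s *\<^sub>R a) - g (x + s *\<^sub>R a)"
        "\<lambda>s. ?a ((x + h *\<^sub>R b) + s *\<^sub>R a) - ?a (x + s *\<^sub>R a)"] assms(1) by blast
  have "((\<lambda>t. ?a ((x + s *\<^sub>R a) + t *\<^sub>R b)) has_real_derivative ?ba ((x + s *\<^sub>R a) + t *\<^sub>R b)) (at t)"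
    if "0 \<le> t" "t \<le> h" for t
    using S[of s t] that s by (intro line g') simp
  then obtain t where t: "0 < t" "t < h" and
    t': "?a ((x + s *\<^sub>R a) + h *\<^sub>R b) - ?a ((x + s *\<^sub>R a) + 0 *\<^sub>R b) = (h - 0) * ?ba ((x + s *\<^sub>R a) + t *\<^sub>R b)"
    using MVT2[of 0 h "\<lambda>t. ?a ((x + s *\<^sub>R a) + t *\<^sub>R b)" "\<lambda>t. ?ba ((x + s *\<^sub>R a) + t *\<^sub>R b)"] assms(1)
    by blast
  show ?thesis
    by (rule that[of s t]) (use s t s' t' in \<open>simp_all add: algebra_simps\<close>)
qed

text \<open>The mixed difference is symmetric in \<open>a\<close> and \<open>b\<close>, so the two
  orders of differentiation agree at two suitable points near \<open>x\<close>; continuity brings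
  both points to \<open>x\<close>.\<close>

lemma second_derivative_symmetric_real:
  fixes g :: "'a::real_normed_vector \<Rightarrow> real"
  assumes "open S" "x \<in> S" "Ck_on 2 S g"
  shows "frechet_derivative (\<lambda>z. frechet_derivative g (at z) a) (at x) b =
         frechet_derivative (\<lambda>z. frechet_derivative g (at z) b) (at x) a"
proof (rule ccontr)
  let ?H = "\<lambda>a b y. frechet_derivative (\<lambda>z. frechet_derivative g (at z) a) (at y) b"
  assume ne: "?H a b x \<noteq> ?H b a x"
  \<comment> \<open>Half the gap: no single number is within \<open>e\<close> of both
    values.\<close>
  define e where "e = \<bar>?H a b x - ?H b a x\<bar> / 2"
  have "e > 0" using ne by (simp add: e_def)
  have C: "g differentiable (at y)" "(\<lambda>z. frechet_derivative g (at z) v) differentiable (at y)"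
    "continuous_on S (?H v w)" if "y \<in> S" for y v w
    using assms(3) that by (auto simp: numeral_2_eq_2)
  have ev: "\<forall>\<^sub>F y in nhds x. dist (?H v w y) (?H v w x) < e" for v w
  proof (rule tendstoD[OF _ \<open>e > 0\<close>])
    have "isCont (?H v w) x"
      using C(3)[OF assms(2)] assms(1,2) by (simp add: continuous_on_eq_continuous_at)
    then show "(?H v w \<longlongrightarrow> ?H v w x) (nhds x)"
      by (metis isCont_def tendsto_at_iff_tendsto_nhds)
  qed
  have "\<forall>\<^sub>F y in nhds x. y \<in> S \<and> dist (?H a b y) (?H a b x) < e \<and> dist (?H b a y) (?H b a x) < e"
    using ev[of a b] ev[of b a] eventually_nhds_in_open[OF assms(1,2)]
    by eventually_elim auto
  then obtain d where d: "d > 0" and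
    ball: "\<And>y. dist y x < d \<Longrightarrow> y \<in> S \<and> dist (?H a b y) (?H a b x) < e \<and> dist (?H b a y) (?H b a x) < e"
    unfolding eventually_nhds_metric by metis
  \<comment> \<open>Keeps the whole parallelogram spanned by \<open>h *\<^sub>R a\<close> and
    \<open>h *\<^sub>R b\<close> within distance \<open>d / 2\<close> of \<open>x\<close>; the
    summand 1 avoids a zero denominator for \<open>a = b = 0\<close>.\<close>
  define h where "h = d / (2 * (norm a + norm b + 1))"
  have pos: "norm a + norm b + 1 > 0" using norm_ge_zero[of a] norm_ge_zero[of b] by linarith
  have h: "h > 0" using d pos by (simp add: h_def)
  have close: "dist (x + s *\<^sub>R a + t *\<^sub>R b) x < d" if "0 \<le> s" "s \<le> h" "0 \<le> t" "t \<le> h" for s t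
  proof -
    have "dist (x + s *\<^sub>R a + t *\<^sub>R b) x = norm (s *\<^sub>R a + t *\<^sub>R b)" by (simp add: dist_norm)
    also have "\<dots> \<le> s * norm a + t * norm b"
      using norm_triangle_ineq[of "s *\<^sub>R a" "t *\<^sub>R b"] that by simp
    also have "\<dots> \<le> h * norm a + h * norm b" using that by (intro add_mono mult_right_mono) auto
    also have "\<dots> \<le> h * (norm a + norm b + 1)" using h by (simp add: algebra_simps)
    also have "\<dots> = d / 2" using pos by (simp add: h_def field_simps)
    finally show ?thesis using d by simp
  qed
  obtain s t where st: "0 \<le> s" "s \<le> h" "0 \<le> t" "t \<le> h" and
    1: "g (x + h *\<^sub>R a + h *\<^sub>R b) - g (x + h *\<^sub>R a) - g (x + h *\<^sub>R b) + g x = h * h * ?H a b (x + s *\<^sub>R a + t *\<^sub>R b)"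
    using mixed_difference[OF h, where S = S and g = g and x = x and a = a and b = b] ball close C(1,2) by blast
  have close': "x + s *\<^sub>R b + t *\<^sub>R a \<in> S" if "0 \<le> s" "s \<le> h" "0 \<le> t" "t \<le> h" for s t
    using ball[OF close[OF that(3,4,1,2)]] by (simp add: algebra_simps)
  obtain s' t' where st': "0 \<le> s'" "s' \<le> h" "0 \<le> t'" "t' \<le> h" and
    2: "g (x + h *\<^sub>R b + h *\<^sub>R a) - g (x + h *\<^sub>R b) - g (x + h *\<^sub>R a) + g x = h * h * ?H b a (x + s' *\<^sub>R b + t' *\<^sub>R a)"
    using mixed_difference[OF h, where S = S and g = g and x = x and a = b and b = a] close' C(1,2) by blast
  have "h * h * ?H a b (x + s *\<^sub>R a + t *\<^sub>R b) = h * h * ?H b a (x + t' *\<^sub>R a + s' *\<^sub>R b)"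
    using 1 2 by (simp add: algebra_simps)
  then have "?H a b (x + s *\<^sub>R a + t *\<^sub>R b) = ?H b a (x + t' *\<^sub>R a + s' *\<^sub>R b)" using h by simp
  moreover have "dist (?H a b (x + s *\<^sub>R a + t *\<^sub>R b)) (?H a b x) < e"
    "dist (?H b a (x + t' *\<^sub>R a + s' *\<^sub>R b)) (?H b a x) < e"
    using ball close st st' by blast+
  moreover have False if "P = Q" "dist P A < \<bar>A - B\<bar> / 2" "dist Q B < \<bar>A - B\<bar> / 2" for P Q A B :: real
    using that by (auto simp: dist_real_def abs_if split: if_splits)
  ultimately show False unfolding e_def by blast
qed

lemma second_derivative_symmetric:
  fixes f :: "'a::real_normed_vector \<Rightarrow> 'b::euclidean_space"
  assumes "open S" "x \<in> S" "smooth_on S f"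
  shows "frechet_derivative (\<lambda>z. frechet_derivative f (at z) a) (at x) b =
         frechet_derivative (\<lambda>z. frechet_derivative f (at z) b) (at x) a"
proof (rule euclidean_eqI)
  fix i :: 'b
  have 1: "((\<lambda>z. f z \<bullet> i) has_derivative (\<lambda>v. frechet_derivative f (at y) v \<bullet> i)) (at y)"
    if "y \<in> S" for y
    using smooth_on_has_derivative[OF assms(3) that] by (rule has_derivative_inner_left)
  then have e: "frechet_derivative f (at y) v \<bullet> i = frechet_derivative (\<lambda>z. f z \<bullet> i) (at y) v"
    if "y \<in> S" for y v
    using that frechet_derivative_at by metis
  have 2: "((\<lambda>z. frechet_derivative (\<lambda>z. f z \<bullet> i) (at z) v) has_derivative
      (\<lambda>w. frechet_derivative (\<lambda>z. frechet_derivative f (at z) v) (at x) w \<bullet> i)) (at x)" for v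
    by (rule has_derivative_transform_within_open[OF has_derivative_inner_left
          [OF smooth_on_has_derivative[OF smooth_on_deriv[OF assms(3)] assms(2)]] assms(1,2)])
      (simp add: e)
  have "frechet_derivative (\<lambda>z. frechet_derivative f (at z) v) (at x) w \<bullet> i =
      frechet_derivative (\<lambda>z. frechet_derivative (\<lambda>z. f z \<bullet> i) (at z) v) (at x) w" for v w
    using 2 frechet_derivative_at by metis
  then show "frechet_derivative (\<lambda>z. frechet_derivative f (at z) a) (at x) b \<bullet> i =
         frechet_derivative (\<lambda>z. frechet_derivative f (at z) b) (at x) a \<bullet> i"
    using second_derivative_symmetric_real[OF assms(1,2)
        Ck_on_bounded_linear[OF assms(1) bounded_linear_inner_left smooth_onD[OF assms(3)]], of i a b]
    by simp
qed

section \<open>Charts and left translations\<close>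

definition chart_deriv ::
  "('a, 'e::euclidean_space) chart \<Rightarrow> ('b, 'f::euclidean_space) chart \<Rightarrow> ('a \<Rightarrow> 'b) \<Rightarrow> 'a \<Rightarrow> 'e \<Rightarrow> 'f" where
  "chart_deriv c d f p = frechet_derivative (\<lambda>x. snd d (f (chart_inv c x))) (at (snd c p))"

text \<open>The eventual condition keeps \<open>f\<close> inside the domain of \<open>d\<close> near
  \<open>p\<close>; it is what makes the middle chart cancel in the chain rule.\<close>

definition has_chart_derivative ::
  "('a, 'e::euclidean_space) chart \<Rightarrow> ('b, 'f::euclidean_space) chart \<Rightarrow> ('a \<Rightarrow> 'b) \<Rightarrow> 'a \<Rightarrow> ('e \<Rightarrow> 'f) \<Rightarrow> bool" where
  "has_chart_derivative c d f p L \<longleftrightarrow>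
     p \<in> fst c \<and> (\<forall>\<^sub>F x in nhds (snd c p). f (chart_inv c x) \<in> fst d) \<and>
     ((\<lambda>x. snd d (f (chart_inv c x))) has_derivative L) (at (snd c p))"

lemma chart_inv_snd: "inj_on (snd c) (fst c) \<Longrightarrow> p \<in> fst c \<Longrightarrow> chart_inv c (snd c p) = p"
  by (simp add: chart_inv_def)

lemma chart_inv_in: "x \<in> chart_range c \<Longrightarrow> chart_inv c x \<in> fst c"
  by (auto simp: chart_inv_def chart_range_def inv_into_into)

lemma snd_chart_inv: "x \<in> chart_range c \<Longrightarrow> snd c (chart_inv c x) = x"
  by (auto simp: chart_inv_def chart_range_def f_inv_into_f)

lemma snd_in_chart_range: "p \<in> fst c \<Longrightarrow> snd c p \<in> chart_range c"
  by (simp add: chart_range_def)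

lemma has_chart_derivative_imp:
  "has_chart_derivative c d f p L \<Longrightarrow> chart_deriv c d f p = L"
  using frechet_derivative_at by (fastforce simp: has_chart_derivative_def chart_deriv_def)

lemma has_chart_derivative_compose:
  assumes c: "inj_on (snd c) (fst c)" and d: "inj_on (snd d) (fst d)"
    and f: "has_chart_derivative c d f p L" and g: "has_chart_derivative d b g (f p) M"
  shows "has_chart_derivative c b (\<lambda>x. g (f x)) p (M \<circ> L)"
proof -
  let ?F = "\<lambda>x. snd d (f (chart_inv c x))" and ?H = "\<lambda>y. snd b (g (chart_inv d y))"
  have p: "p \<in> fst c" and dF: "(?F has_derivative L) (at (snd c p))"
    and ev: "\<forall>\<^sub>F x in nhds (snd c p). f (chart_inv c x) \<in> fst d"
    using f by (simp_all add: has_chart_derivative_def)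
  have Fp: "?F (snd c p) = snd d (f p)" using p c by (simp add: chart_inv_snd)
  have eg: "\<forall>\<^sub>F y in nhds (?F (snd c p)). g (chart_inv d y) \<in> fst b"
    and dH: "(?H has_derivative M) (at (?F (snd c p)))"
    using g Fp by (simp_all add: has_chart_derivative_def)
  have "isCont ?F (snd c p)" using dF by (rule has_derivative_continuous)
  then have "filterlim ?F (nhds (?F (snd c p))) (nhds (snd c p))"
    by (metis (no_types, lifting) isCont_def tendsto_at_iff_tendsto_nhds)
  from eventually_compose_filterlim[OF eg this]
  have ev2: "\<forall>\<^sub>F x in nhds (snd c p). g (chart_inv d (?F x)) \<in> fst b" .
  have 1: "\<forall>\<^sub>F x in nhds (snd c p). g (f (chart_inv c x)) \<in> fst b"
    using ev ev2 by eventually_elim (simp add: chart_inv_snd d)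
  have 2: "\<forall>\<^sub>F x in nhds (snd c p). ?H (?F x) = snd b (g (f (chart_inv c x)))"
    using ev by eventually_elim (simp add: chart_inv_snd d)
  have "((\<lambda>x. ?H (?F x)) has_derivative (\<lambda>v. M (L v))) (at (snd c p))"
    by (rule has_derivative_compose[OF dF dH])
  then have "((\<lambda>x. snd b (g (f (chart_inv c x)))) has_derivative (\<lambda>v. M (L v))) (at (snd c p))"
    by (rule has_derivative_transform_eventually)
      (use 2 eventually_nhds_x_imp_x[OF 2] in \<open>auto simp: eventually_at_filter elim: eventually_mono\<close>)
  then show ?thesis using p 1 by (simp add: has_chart_derivative_def o_def)
qed

lemma has_chart_derivative_cong:
  assumes "open (chart_range c)" and "has_chart_derivative c d f p L"
    and eq: "\<And>x. x \<in> fst c \<Longrightarrow> f x = g x"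
  shows "has_chart_derivative c d g p L"
proof -
  have p: "p \<in> fst c" and L: "((\<lambda>x. snd d (f (chart_inv c x))) has_derivative L) (at (snd c p))"
    and ev: "\<forall>\<^sub>F x in nhds (snd c p). f (chart_inv c x) \<in> fst d"
    using assms(2) by (simp_all add: has_chart_derivative_def)
  have "\<forall>\<^sub>F x in nhds (snd c p). g (chart_inv c x) \<in> fst d"
    using ev eventually_nhds_in_open[OF assms(1) snd_in_chart_range[OF p]]
    by eventually_elim (metis chart_inv_in eq)
  moreover have "((\<lambda>x. snd d (g (chart_inv c x))) has_derivative L) (at (snd c p))"
    by (rule has_derivative_transform_within_open[OF L assms(1) snd_in_chart_range[OF p]])
      (metis chart_inv_in eq)
  ultimately show ?thesis using p by (simp add: has_chart_derivative_def)
qed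

lemma has_chart_derivative_I:
  assumes "inj_on (snd c) (fst c)" "open S" "p \<in> fst c" "snd c p \<in> S" "\<And>x. x \<in> S \<Longrightarrow> f (chart_inv c x) \<in> fst d"
    and "smooth_on S (\<lambda>x. snd d (f (chart_inv c x)))"
  shows "has_chart_derivative c d f p (chart_deriv c d f p)"
  using smooth_on_has_derivative[OF assms(6,4)] assms eventually_nhds_in_open[OF assms(2,4)]
  by (auto simp: has_chart_derivative_def chart_deriv_def elim: eventually_mono)

text \<open>Both functions have the same derivatives at \<open>a\<close>, so the choice behind
  \<open>frechet_derivative\<close> is the same one, even where there is no derivative to
  choose.\<close>

lemma frechet_derivative_cong_open:
  assumes "open S" "a \<in> S" "\<And>x. x \<in> S \<Longrightarrow> f x = g x"
  shows "frechet_derivative f (at a) = frechet_derivative g (at a)"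
proof -
  have "(f has_derivative L) (at a) \<longleftrightarrow> (g has_derivative L) (at a)" for L
  proof
    show "(g has_derivative L) (at a)" if "(f has_derivative L) (at a)"
      using has_derivative_transform_within_open[OF that assms(1,2)] assms(3) by simp
    show "(f has_derivative L) (at a)" if "(g has_derivative L) (at a)"
      using has_derivative_transform_within_open[OF that assms(1,2)] assms(3) by simp
  qed
  then show ?thesis by (simp add: frechet_derivative_def)
qed

text \<open>Writes a partial derivative as a total one. The total derivative of the multiplication
  is smooth, so derivatives of left translations will depend smoothly on the translating
  element.\<close>

lemma frechet_derivative_snd:
  assumes "(F has_derivative F') (at (x, y))"
  shows "frechet_derivative (\<lambda>z. F (x, z)) (at y) = (\<lambda>v. F' (0, v))"
proof -
  have "((\<lambda>z. (x, z)) has_derivative (\<lambda>v. (0, v))) (at y)"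
    by (intro has_derivative_Pair has_derivative_const has_derivative_ident)
  from frechet_derivative_at[OF has_derivative_compose[OF this assms]] show ?thesis by simp
qed

section \<open>Left translations of a Lie group in charts\<close>

locale lie_grp =
  fixes G :: "('a, 'e::euclidean_space) lie_struct"
  assumes lie: "lie_group G"
begin

sublocale group G
  using lie by (simp add: lie_group_def)

lemma manifold: "smooth_manifold (gtop G) (atlas G)" and topspace_eq: "topspace (gtop G) = carrier G"
  using lie by (simp_all add: lie_group_def)

lemma
  assumes "c \<in> atlas G"
  shows chart_openin: "openin (gtop G) (fst c)" and open_chart_range: "open (chart_range c)"
    and chart_homeo: "homeomorphic_map (subtopology (gtop G) (fst c)) (top_of_set (chart_range c)) (snd c)"
  using manifold assms by (auto simp: smooth_manifold_def)

lemma chart_subset: "c \<in> atlas G \<Longrightarrow> fst c \<subseteq> carrier G"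
  using chart_openin openin_subset topspace_eq by metis

lemma chart_inj: "c \<in> atlas G \<Longrightarrow> inj_on (snd c) (fst c)"
  using homeomorphic_imp_injective_map[OF chart_homeo] chart_subset topspace_eq
  by (simp add: inf_absorb2)

lemma chart_inv_carrier: "c \<in> atlas G \<Longrightarrow> x \<in> chart_range c \<Longrightarrow> chart_inv c x \<in> carrier G"
  using chart_subset chart_inv_in by (rule subsetD)

lemma continuous_chart_inv:
  assumes "c \<in> atlas G"
  shows "continuous_map (top_of_set (chart_range c)) (gtop G) (chart_inv c)"
proof -
  obtain g where "homeomorphic_maps (subtopology (gtop G) (fst c)) (top_of_set (chart_range c)) (snd c) g"
    using chart_homeo[OF assms] homeomorphic_map_maps by blast
  then have g: "continuous_map (top_of_set (chart_range c)) (subtopology (gtop G) (fst c)) g"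
    and gi: "\<And>y. y \<in> chart_range c \<Longrightarrow> snd c (g y) = y"
    by (auto simp: homeomorphic_maps_def)
  have gin: "g y \<in> fst c" if "y \<in> chart_range c" for y
    using continuous_map_image_subset_topspace[OF g] that by auto
  have "g y = chart_inv c y" if "y \<in> chart_range c" for y
    using chart_inv_snd[OF chart_inj[OF assms] gin[OF that]] gi[OF that] by simp
  then have "continuous_map (top_of_set (chart_range c)) (subtopology (gtop G) (fst c)) (chart_inv c)"
    using g by (auto intro: continuous_map_eq)
  then show ?thesis by (simp add: continuous_map_in_subtopology)
qed

lemma open_chart_vimage:
  assumes "c \<in> atlas G" "continuous_map (gtop G) (gtop G) f" "openin (gtop G) V"
  shows "open {x \<in> chart_range c. f (chart_inv c x) \<in> V}"
proof -
  have "continuous_map (top_of_set (chart_range c)) (gtop G) (f \<circ> chart_inv c)"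
    using continuous_map_compose[OF continuous_chart_inv[OF assms(1)] assms(2)] .
  from openin_continuous_map_preimage[OF this assms(3)]
  show ?thesis using open_chart_range[OF assms(1)] by (simp add: openin_open_eq)
qed

text \<open>Smoothness is meant for open sets; openness here comes from the continuity of the
  multiplication and of the inverse charts in the group topology.\<close>

lemma open_mult_domain:
  assumes "c \<in> atlas G" "d \<in> atlas G" "b \<in> atlas G"
  shows "open {(x, y) \<in> chart_range c \<times> chart_range d. chart_inv c x \<otimes>\<^bsub>G\<^esub> chart_inv d y \<in> fst b}"
proof -
  let ?T = "prod_topology (top_of_set (chart_range c)) (top_of_set (chart_range d))"
  have "continuous_map ?T (prod_topology (gtop G) (gtop G)) (\<lambda>(x, y). (chart_inv c x, chart_inv d y))"
    using continuous_chart_inv[OF assms(1)] continuous_chart_inv[OF assms(2)]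
    by (simp add: continuous_map_prod_top del: prod_topology_subtopology_eu)
  moreover have "continuous_map (prod_topology (gtop G) (gtop G)) (gtop G) (\<lambda>(g, h). g \<otimes>\<^bsub>G\<^esub> h)"
    using lie by (simp add: lie_group_def)
  ultimately have "continuous_map ?T (gtop G) ((\<lambda>(g, h). g \<otimes>\<^bsub>G\<^esub> h) \<circ> (\<lambda>(x, y). (chart_inv c x, chart_inv d y)))"
    by (rule continuous_map_compose)
  from openin_continuous_map_preimage[OF this chart_openin[OF assms(3)]]
  have "openin (top_of_set (chart_range c \<times> chart_range d))
     {z \<in> chart_range c \<times> chart_range d. ((\<lambda>(g, h). g \<otimes>\<^bsub>G\<^esub> h) \<circ> (\<lambda>(x, y). (chart_inv c x, chart_inv d y))) z \<in> fst b}"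
    by (simp add: prod_topology_subtopology_eu)
  moreover have "open (chart_range c \<times> chart_range d)"
    using assms open_chart_range by (simp add: open_Times)
  ultimately have "open {z \<in> chart_range c \<times> chart_range d. ((\<lambda>(g, h). g \<otimes>\<^bsub>G\<^esub> h) \<circ> (\<lambda>(x, y). (chart_inv c x, chart_inv d y))) z \<in> fst b}"
    by (simp add: openin_open_eq)
  also have "{z \<in> chart_range c \<times> chart_range d. ((\<lambda>(g, h). g \<otimes>\<^bsub>G\<^esub> h) \<circ> (\<lambda>(x, y). (chart_inv c x, chart_inv d y))) z \<in> fst b}
     = {(x, y) \<in> chart_range c \<times> chart_range d. chart_inv c x \<otimes>\<^bsub>G\<^esub> chart_inv d y \<in> fst b}" by auto
  finally show ?thesis .
qed

lemma smooth_mult: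
  assumes "c \<in> atlas G" "d \<in> atlas G" "b \<in> atlas G"
  shows "smooth_on {(x, y) \<in> chart_range c \<times> chart_range d. chart_inv c x \<otimes>\<^bsub>G\<^esub> chart_inv d y \<in> fst b}
          (\<lambda>(x, y). snd b (chart_inv c x \<otimes>\<^bsub>G\<^esub> chart_inv d y))"
  using lie assms unfolding lie_group_def by blast

lemma smooth_inv:
  assumes "c \<in> atlas G" "b \<in> atlas G"
  shows "smooth_on {x \<in> chart_range c. inv\<^bsub>G\<^esub> (chart_inv c x) \<in> fst b}
          (\<lambda>x. snd b (inv\<^bsub>G\<^esub> (chart_inv c x)))"
  using lie assms unfolding lie_group_def by blast

lemma open_inv_domain:
  assumes "c \<in> atlas G" "b \<in> atlas G"
  shows "open {x \<in> chart_range c. inv\<^bsub>G\<^esub> (chart_inv c x) \<in> fst b}"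
  using lie assms by (intro open_chart_vimage chart_openin) (auto simp: lie_group_def)

lemma chart_at:
  assumes "p \<in> carrier G"
  shows chart_at_in_atlas: "chart_at G p \<in> atlas G" and in_chart_at: "p \<in> fst (chart_at G p)"
proof -
  have "\<exists>c. c \<in> atlas G \<and> p \<in> fst c"
    using manifold assms topspace_eq by (auto simp: smooth_manifold_def)
  from someI_ex[OF this] show "chart_at G p \<in> atlas G" "p \<in> fst (chart_at G p)"
    unfolding chart_at_def by auto
qed

text \<open>Left translation is the multiplication with its first argument frozen at the coordinates
  of \<open>g\<close> in a chart around \<open>g\<close>.\<close>

lemma smooth_translation:
  assumes g: "g \<in> carrier G" and c: "c \<in> atlas G" and d: "d \<in> atlas G"
  shows "open {y \<in> chart_range c. g \<otimes>\<^bsub>G\<^esub> chart_inv c y \<in> fst d}" (is "open ?S")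
    and "smooth_on {y \<in> chart_range c. g \<otimes>\<^bsub>G\<^esub> chart_inv c y \<in> fst d} (\<lambda>y. snd d (g \<otimes>\<^bsub>G\<^esub> chart_inv c y))"
proof -
  define a where "a = chart_at G g"
  have a: "a \<in> atlas G" "g \<in> fst a" using chart_at[OF g] by (auto simp: a_def)
  have ga: "chart_inv a (snd a g) = g" using chart_inv_snd chart_inj a by metis
  let ?O = "{(x, y) \<in> chart_range a \<times> chart_range c. chart_inv a x \<otimes>\<^bsub>G\<^esub> chart_inv c y \<in> fst d}"
  have cont: "continuous_on UNIV (\<lambda>y::'e. (snd a g, y))" by (intro continuous_intros)
  have "?S = (\<lambda>y. (snd a g, y)) -` ?O" using ga snd_in_chart_range[OF a(2)] by auto
  then show S: "open ?S"
    using open_vimage[OF open_mult_domain[OF a(1) c d] cont] by simp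
  have "smooth_on ?S (\<lambda>y. (\<lambda>(x, y). snd d (chart_inv a x \<otimes>\<^bsub>G\<^esub> chart_inv c y)) (snd a g, y))"
    by (rule smooth_on_compose[OF S open_mult_domain[OF a(1) c d] _ _ smooth_mult[OF a(1) c d]])
      (use ga snd_in_chart_range[OF a(2)] in
        \<open>auto intro!: smooth_on_Pair S smooth_on_const smooth_on_ident\<close>)
  then show "smooth_on ?S (\<lambda>y. snd d (g \<otimes>\<^bsub>G\<^esub> chart_inv c y))" using ga by simp
qed

text \<open>
  For \<open>g = \<one>\<close> these are the coordinate changes; so \<open>to_coords\<close>, \<open>from_coords\<close> and the tangent maps of
  left translations are all instances, and one multiplication rule governs their compositions.
\<close>

definition trans_deriv :: "('a, 'e) chart \<Rightarrow> ('a, 'e) chart \<Rightarrow> 'a \<Rightarrow> 'a \<Rightarrow> 'e \<Rightarrow> 'e" where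
  "trans_deriv c d g p = chart_deriv c d (\<lambda>h. g \<otimes>\<^bsub>G\<^esub> h) p"

lemma has_chart_derivative_trans:
  assumes "g \<in> carrier G" "c \<in> atlas G" "d \<in> atlas G" "p \<in> fst c" "g \<otimes>\<^bsub>G\<^esub> p \<in> fst d"
  shows "has_chart_derivative c d (\<lambda>h. g \<otimes>\<^bsub>G\<^esub> h) p (trans_deriv c d g p)"
  unfolding trans_deriv_def
  by (rule has_chart_derivative_I[OF chart_inj[OF assms(2)] smooth_translation(1)[OF assms(1-3)]
        assms(4) _ _ smooth_translation(2)[OF assms(1-3)]])
    (use assms in \<open>simp_all add: chart_inv_snd chart_inj snd_in_chart_range\<close>)

lemma linear_trans_deriv:
  assumes "g \<in> carrier G" "c \<in> atlas G" "d \<in> atlas G" "p \<in> fst c" "g \<otimes>\<^bsub>G\<^esub> p \<in> fst d"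
  shows "linear (trans_deriv c d g p)"
  using has_chart_derivative_trans[OF assms] unfolding has_chart_derivative_def
  by (blast intro: has_derivative_linear)

lemma trans_deriv_mult:
  assumes "g \<in> carrier G" "g' \<in> carrier G" "c \<in> atlas G" "d \<in> atlas G" "b \<in> atlas G"
    "p \<in> fst c" "g' \<otimes>\<^bsub>G\<^esub> p \<in> fst d" "g \<otimes>\<^bsub>G\<^esub> (g' \<otimes>\<^bsub>G\<^esub> p) \<in> fst b"
  shows "trans_deriv c b (g \<otimes>\<^bsub>G\<^esub> g') p = trans_deriv d b g (g' \<otimes>\<^bsub>G\<^esub> p) \<circ> trans_deriv c d g' p"
proof -
  have "has_chart_derivative c b (\<lambda>h. g \<otimes>\<^bsub>G\<^esub> (g' \<otimes>\<^bsub>G\<^esub> h)) p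
      (trans_deriv d b g (g' \<otimes>\<^bsub>G\<^esub> p) \<circ> trans_deriv c d g' p)"
    by (rule has_chart_derivative_compose[where d = d and f = "\<lambda>h. g' \<otimes>\<^bsub>G\<^esub> h" and g = "\<lambda>h. g \<otimes>\<^bsub>G\<^esub> h"])
      (use assms chart_inj has_chart_derivative_trans in auto)
  then have "has_chart_derivative c b (\<lambda>h. (g \<otimes>\<^bsub>G\<^esub> g') \<otimes>\<^bsub>G\<^esub> h) p
      (trans_deriv d b g (g' \<otimes>\<^bsub>G\<^esub> p) \<circ> trans_deriv c d g' p)"
    by (rule has_chart_derivative_cong[OF open_chart_range[OF assms(3)]])
      (use assms chart_subset in \<open>auto simp: m_assoc subset_iff\<close>)
  then show ?thesis unfolding trans_deriv_def by (rule has_chart_derivative_imp)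
qed

lemma trans_deriv_one:
  assumes "c \<in> atlas G" "p \<in> fst c"
  shows "trans_deriv c c \<one>\<^bsub>G\<^esub> p = id"
proof -
  have "((\<lambda>x. snd c (\<one>\<^bsub>G\<^esub> \<otimes>\<^bsub>G\<^esub> chart_inv c x)) has_derivative (\<lambda>v. v)) (at (snd c p))"
    by (rule has_derivative_transform_within_open[OF has_derivative_ident open_chart_range[OF assms(1)]
          snd_in_chart_range[OF assms(2)]])
      (use assms in \<open>simp add: chart_inv_carrier snd_chart_inv\<close>)
  from frechet_derivative_at[OF this, symmetric] show ?thesis
    by (simp add: trans_deriv_def chart_deriv_def id_def)
qed

lemma frechet_one_mult:
  assumes "c \<in> atlas G" "p \<in> fst c"
  shows "frechet_derivative (\<lambda>y. snd d (chart_inv c y)) (at (snd c p)) = trans_deriv c d \<one>\<^bsub>G\<^esub> p"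
  unfolding trans_deriv_def chart_deriv_def
  by (rule frechet_derivative_cong_open[OF open_chart_range[OF assms(1)] snd_in_chart_range[OF assms(2)]])
    (simp add: chart_inv_carrier[OF assms(1)])

lemma to_coords_eq:
  assumes "p \<in> carrier G"
  shows "to_coords G c p = trans_deriv (chart_at G p) c \<one>\<^bsub>G\<^esub> p"
  unfolding to_coords_def by (rule frechet_one_mult[OF chart_at[OF assms]])

lemma from_coords_eq:
  assumes "c \<in> atlas G" "x \<in> chart_range c"
  shows "from_coords G c x = trans_deriv c (chart_at G (chart_inv c x)) \<one>\<^bsub>G\<^esub> (chart_inv c x)"
  using frechet_one_mult[OF assms(1) chart_inv_in[OF assms(2)]]
  unfolding from_coords_def snd_chart_inv[OF assms(2)] .

lemma tangent_map_eq:
  "tangent_map G G (\<lambda>h. g \<otimes>\<^bsub>G\<^esub> h) p = trans_deriv (chart_at G p) (chart_at G (g \<otimes>\<^bsub>G\<^esub> p)) g p"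
  unfolding tangent_map_def trans_deriv_def chart_deriv_def ..

section \<open>The Maurer-Cartan form and the left invariant frame\<close>

definition "chart_one = chart_at G \<one>\<^bsub>G\<^esub>"
definition "coord_one = snd chart_one \<one>\<^bsub>G\<^esub>"

lemma chart_one: "chart_one \<in> atlas G" "\<one>\<^bsub>G\<^esub> \<in> fst chart_one"
  using chart_at[OF one_closed] by (auto simp: chart_one_def)

lemma coord_one_in: "coord_one \<in> chart_range chart_one" and chart_inv_coord_one: "chart_inv chart_one coord_one = \<one>\<^bsub>G\<^esub>"
  using snd_in_chart_range[OF chart_one(2)] chart_inv_snd[OF chart_inj[OF chart_one(1)] chart_one(2)]
  by (auto simp: coord_one_def)

text \<open>Translation by the inverse carries the tangent space at the point with coordinates
  \<open>x\<close> to the one at the identity. The target chart is \<open>chart_one\<close> because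
  the Lie algebra is identified with \<open>'e\<close> through it.\<close>

definition mc_form :: "('a, 'e) chart \<Rightarrow> 'e \<Rightarrow> 'e \<Rightarrow> 'e" where
  "mc_form c x = trans_deriv c chart_one (inv\<^bsub>G\<^esub> (chart_inv c x)) (chart_inv c x)"

text \<open>The coordinate expression of the left invariant field with a given value at the
  identity; pointwise the inverse of \<open>mc_form\<close>.\<close>

definition left_frame :: "('a, 'e) chart \<Rightarrow> 'e \<Rightarrow> 'e \<Rightarrow> 'e" where
  "left_frame c x = trans_deriv chart_one c (chart_inv c x) \<one>\<^bsub>G\<^esub>"

context
  fixes c x assumes c: "c \<in> atlas G" and x: "x \<in> chart_range c"
begin

lemma point: "chart_inv c x \<in> carrier G" "chart_inv c x \<in> fst c"
  using chart_inv_in[OF x] chart_inv_carrier[OF c x] by auto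

lemma linear_mc_form: "linear (mc_form c x)"
  unfolding mc_form_def by (rule linear_trans_deriv) (use c point chart_one in auto)

lemma linear_left_frame: "linear (left_frame c x)"
  unfolding left_frame_def by (rule linear_trans_deriv) (use c point chart_one in auto)

lemma mc_left_frame: "mc_form c x (left_frame c x u) = u"
proof -
  have "trans_deriv chart_one chart_one (inv\<^bsub>G\<^esub> (chart_inv c x) \<otimes>\<^bsub>G\<^esub> chart_inv c x) \<one>\<^bsub>G\<^esub> =
     trans_deriv c chart_one (inv\<^bsub>G\<^esub> (chart_inv c x)) (chart_inv c x \<otimes>\<^bsub>G\<^esub> \<one>\<^bsub>G\<^esub>) \<circ> trans_deriv chart_one c (chart_inv c x) \<one>\<^bsub>G\<^esub>"
    by (rule trans_deriv_mult) (use c point chart_one in auto)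
  then show ?thesis
    using point chart_one by (simp add: mc_form_def left_frame_def trans_deriv_one fun_eq_iff)
qed

lemma left_frame_mc: "left_frame c x (mc_form c x u) = u"
proof -
  have "trans_deriv c c (chart_inv c x \<otimes>\<^bsub>G\<^esub> inv\<^bsub>G\<^esub> (chart_inv c x)) (chart_inv c x) =
     trans_deriv chart_one c (chart_inv c x) (inv\<^bsub>G\<^esub> (chart_inv c x) \<otimes>\<^bsub>G\<^esub> chart_inv c x) \<circ>
     trans_deriv c chart_one (inv\<^bsub>G\<^esub> (chart_inv c x)) (chart_inv c x)"
    by (rule trans_deriv_mult) (use c point chart_one in auto)
  then show ?thesis
    using point c by (simp add: mc_form_def left_frame_def trans_deriv_one fun_eq_iff)
qed

text \<open>Translating to the identity and back is the change of charts. Hence a left invariant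
  tensor is, in any chart, its value at the identity applied to \<open>mc_form\<close>.\<close>

lemma from_coords_mc:
  "from_coords G c x u = tangent_map G G (\<lambda>h. chart_inv c x \<otimes>\<^bsub>G\<^esub> h) \<one>\<^bsub>G\<^esub> (mc_form c x u)"
proof -
  let ?p = "chart_inv c x"
  have "trans_deriv c (chart_at G ?p) (?p \<otimes>\<^bsub>G\<^esub> inv\<^bsub>G\<^esub> ?p) ?p =
     trans_deriv chart_one (chart_at G ?p) ?p (inv\<^bsub>G\<^esub> ?p \<otimes>\<^bsub>G\<^esub> ?p) \<circ> trans_deriv c chart_one (inv\<^bsub>G\<^esub> ?p) ?p"
    by (rule trans_deriv_mult) (use c point chart_one chart_at in auto)
  then show ?thesis
    using point c x by (simp add: from_coords_eq tangent_map_eq mc_form_def chart_one_def)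
qed

lemma left_invariant_field_in_chart:
  "field_in_chart G c (left_invariant_field G u) x = left_frame c x u"
proof -
  let ?p = "chart_inv c x"
  have "trans_deriv chart_one c (\<one>\<^bsub>G\<^esub> \<otimes>\<^bsub>G\<^esub> ?p) \<one>\<^bsub>G\<^esub> =
     trans_deriv (chart_at G ?p) c \<one>\<^bsub>G\<^esub> (?p \<otimes>\<^bsub>G\<^esub> \<one>\<^bsub>G\<^esub>) \<circ> trans_deriv chart_one (chart_at G ?p) ?p \<one>\<^bsub>G\<^esub>"
    by (rule trans_deriv_mult) (use c point chart_one chart_at in auto)
  then show ?thesis
    using point c x
    by (simp add: field_in_chart_def left_invariant_field_def to_coords_eq tangent_map_eq left_frame_def chart_one_def)
qed

end

text \<open>The frame at \<open>x\<close> is the partial derivative of the multiplication in its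
  second argument at \<open>(x, coord_one)\<close>, and the total derivative of the multiplication
  is smooth.\<close>

lemma smooth_left_frame:
  assumes c: "c \<in> atlas G"
  shows "smooth_on (chart_range c) (\<lambda>x. left_frame c x u)"
proof -
  let ?O = "{(x, y) \<in> chart_range c \<times> chart_range chart_one. chart_inv c x \<otimes>\<^bsub>G\<^esub> chart_inv chart_one y \<in> fst c}"
  let ?F = "\<lambda>(x, y). snd c (chart_inv c x \<otimes>\<^bsub>G\<^esub> chart_inv chart_one y)"
  note O = open_mult_domain[OF c chart_one(1) c] and F = smooth_mult[OF c chart_one(1) c]
  have in_O: "(x, coord_one) \<in> ?O" if "x \<in> chart_range c" for x
    using that coord_one_in chart_inv_coord_one chart_inv_carrier[OF c that] chart_inv_in[OF that] by simp
  have "smooth_on (chart_range c) (\<lambda>x. frechet_derivative ?F (at (x, coord_one)) (0, u))"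
    using smooth_on_compose[OF open_chart_range[OF c] O in_O
        smooth_on_Pair[OF open_chart_range[OF c] smooth_on_ident smooth_on_const] smooth_on_deriv[OF F]]
      open_chart_range[OF c] by blast
  moreover have "frechet_derivative ?F (at (x, coord_one)) (0, u) = left_frame c x u"
    if "x \<in> chart_range c" for x
    using frechet_derivative_snd[OF smooth_on_has_derivative[OF F in_O[OF that]]]
    by (simp add: left_frame_def trans_deriv_def chart_deriv_def coord_one_def[symmetric])
  ultimately show ?thesis by (rule smooth_on_cong[OF open_chart_range[OF c]])
qed

text \<open>The translating element and the base point both move with \<open>x\<close>, but only the
  second slot of the multiplication is differentiated, at \<open>(?i x, x)\<close>. The argument is
  local because the inverses of the points of \<open>c\<close> need not lie in one chart.\<close>

lemma smooth_mc_form: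
  assumes c: "c \<in> atlas G"
  shows "smooth_on (chart_range c) (\<lambda>x. mc_form c x u)"
proof (rule smooth_on_local)
  fix x0 assume x0: "x0 \<in> chart_range c"
  define d where "d = chart_at G (inv\<^bsub>G\<^esub> (chart_inv c x0))"
  have d: "d \<in> atlas G" "inv\<^bsub>G\<^esub> (chart_inv c x0) \<in> fst d"
    unfolding d_def using chart_at chart_inv_carrier[OF c x0] by auto
  define W where "W = {x \<in> chart_range c. inv\<^bsub>G\<^esub> (chart_inv c x) \<in> fst d}"
  let ?i = "\<lambda>x. snd d (inv\<^bsub>G\<^esub> (chart_inv c x))"
  let ?O = "{(z, y) \<in> chart_range d \<times> chart_range c. chart_inv d z \<otimes>\<^bsub>G\<^esub> chart_inv c y \<in> fst chart_one}"
  let ?F = "\<lambda>(z, y). snd chart_one (chart_inv d z \<otimes>\<^bsub>G\<^esub> chart_inv c y)"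
  note O = open_mult_domain[OF d(1) c chart_one(1)] and F = smooth_mult[OF d(1) c chart_one(1)]
  have W: "open W" "x0 \<in> W" using open_inv_domain[OF c d(1)] x0 d(2) by (auto simp: W_def)
  have inv_d: "chart_inv d (?i x) = inv\<^bsub>G\<^esub> (chart_inv c x)" if "x \<in> W" for x
    using that chart_inv_snd[OF chart_inj[OF d(1)]] by (auto simp: W_def)
  have in_O: "(?i x, x) \<in> ?O" if "x \<in> W" for x
    using that inv_d[OF that] chart_inv_carrier[OF c] chart_one
      snd_in_chart_range[of "inv\<^bsub>G\<^esub> (chart_inv c x)" d] by (simp add: W_def)
  have "smooth_on W ?i" using smooth_inv[OF c d(1)] by (simp add: W_def)
  then have "smooth_on W (\<lambda>x. frechet_derivative ?F (at (?i x, x)) (0, u))"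
    using smooth_on_compose[OF W(1) O in_O
        smooth_on_Pair[OF W(1) _ smooth_on_ident] smooth_on_deriv[OF F]] W(1) by blast
  moreover have "frechet_derivative ?F (at (?i x, x)) (0, u) = mc_form c x u" if "x \<in> W" for x
    using frechet_derivative_snd[OF smooth_on_has_derivative[OF F in_O[OF that]]] that inv_d[OF that]
    by (simp add: W_def mc_form_def trans_deriv_def chart_deriv_def snd_chart_inv)
  ultimately have "smooth_on W (\<lambda>x. mc_form c x u)" by (rule smooth_on_cong[OF W(1)])
  then show "\<exists>T. open T \<and> x0 \<in> T \<and> smooth_on T (\<lambda>x. mc_form c x u)" using W by blast
qed

end

section \<open>The Maurer--Cartan form\<close>

text \<open>The product rule for a moving linear map applied to a moving vector, when the derivative
  of the map is known on each fixed vector separately. Expansion in \<open>Basis\<close> also yields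
  that \<open>Y' h\<close> is linear.\<close>

lemma has_derivative_bundle:
  fixes Y :: "'b::real_normed_vector \<Rightarrow> 'c::euclidean_space \<Rightarrow> 'd::real_normed_vector"
  assumes "open S" "x \<in> S" and lin: "\<And>y. y \<in> S \<Longrightarrow> linear (Y y)"
    and Y': "\<And>b. ((\<lambda>y. Y y b) has_derivative (\<lambda>h. Y' h b)) (at x)"
    and V': "(V has_derivative V') (at x)"
  shows "((\<lambda>y. Y y (V y)) has_derivative (\<lambda>h. Y' h (V x) + Y x (V' h))) (at x)"
proof -
  have expand: "Y y b = (\<Sum>i\<in>Basis. (b \<bullet> i) *\<^sub>R Y y i)" if "y \<in> S" for y b
    by (rule linear_eq_sum_Basis[OF lin[OF that]])
  have Y'_sum: "Y' h b = (\<Sum>i\<in>Basis. (b \<bullet> i) *\<^sub>R Y' h i)" for h b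
  proof -
    have "((\<lambda>y. \<Sum>i\<in>Basis. (b \<bullet> i) *\<^sub>R Y y i) has_derivative (\<lambda>h. \<Sum>i\<in>Basis. (b \<bullet> i) *\<^sub>R Y' h i)) (at x)"
      by (intro has_derivative_sum has_derivative_scaleR_right Y')
    then have "((\<lambda>y. Y y b) has_derivative (\<lambda>h. \<Sum>i\<in>Basis. (b \<bullet> i) *\<^sub>R Y' h i)) (at x)"
      by (rule has_derivative_transform_within_open[OF _ assms(1,2)]) (rule expand[symmetric])
    from has_derivative_unique[OF Y' this] show ?thesis by (rule fun_cong)
  qed
  have "((\<lambda>y. V y \<bullet> i) has_derivative (\<lambda>h. V' h \<bullet> i)) (at x)" for i
    using V' by (rule has_derivative_inner_left)
  then have "((\<lambda>y. \<Sum>i\<in>Basis. (V y \<bullet> i) *\<^sub>R Y y i) has_derivative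
      (\<lambda>h. \<Sum>i\<in>Basis. (V x \<bullet> i) *\<^sub>R Y' h i + (V' h \<bullet> i) *\<^sub>R Y x i)) (at x)"
    by (intro has_derivative_sum has_derivative_scaleR Y')
  also have "(\<lambda>h. \<Sum>i\<in>Basis. (V x \<bullet> i) *\<^sub>R Y' h i + (V' h \<bullet> i) *\<^sub>R Y x i) =
      (\<lambda>h. Y' h (V x) + Y x (V' h))"
    unfolding sum.distrib Y'_sum[of _ "V x", symmetric] expand[OF assms(2), symmetric] ..
  finally show ?thesis
    by (rule has_derivative_transform_within_open[OF _ assms(1,2)]) (rule expand[symmetric])
qed

context lie_grp
begin

lemma mc_form_has_derivative:
  "c \<in> atlas G \<Longrightarrow> x \<in> chart_range c \<Longrightarrow>
    ((\<lambda>y. mc_form c y b) has_derivative (\<lambda>h. frechet_derivative (\<lambda>y. mc_form c y b) (at x) h)) (at x)"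
  by (rule smooth_on_has_derivative[OF smooth_mc_form])

lemma left_frame_has_derivative:
  "c \<in> atlas G \<Longrightarrow> x \<in> chart_range c \<Longrightarrow>
    ((\<lambda>y. left_frame c y b) has_derivative (\<lambda>h. frechet_derivative (\<lambda>y. left_frame c y b) (at x) h)) (at x)"
  by (rule smooth_on_has_derivative[OF smooth_left_frame])

lemma mc_form_one: "mc_form chart_one coord_one = id"
  and left_frame_one: "left_frame chart_one coord_one = id"
  using chart_one by (simp_all add: mc_form_def left_frame_def chart_inv_coord_one trans_deriv_one)

text \<open>Differentiate the constant \<open>mc_form chart_one y (left_frame chart_one y b)\<close>
  at the identity, where both factors are the identity map.\<close>

lemma deriv_mc_form_one:
  "frechet_derivative (\<lambda>y. mc_form chart_one y b) (at coord_one) a =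
    - frechet_derivative (\<lambda>y. left_frame chart_one y b) (at coord_one) a"
proof -
  note in_range = chart_one(1) coord_one_in
  have "((\<lambda>y. mc_form chart_one y (left_frame chart_one y b)) has_derivative
      (\<lambda>h. frechet_derivative (\<lambda>y. mc_form chart_one y (left_frame chart_one coord_one b)) (at coord_one) h +
        mc_form chart_one coord_one (frechet_derivative (\<lambda>y. left_frame chart_one y b) (at coord_one) h))) (at coord_one)"
    by (rule has_derivative_bundle[where Y = "mc_form chart_one", OF open_chart_range[OF chart_one(1)] coord_one_in
          linear_mc_form[OF chart_one(1)] mc_form_has_derivative[OF in_range] left_frame_has_derivative[OF in_range]])
  moreover have "((\<lambda>y. mc_form chart_one y (left_frame chart_one y b)) has_derivative (\<lambda>h. 0)) (at coord_one)"
    by (rule has_derivative_transform_within_open[OF has_derivative_const[of b] open_chart_range[OF chart_one(1)] coord_one_in])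
      (rule mc_left_frame[OF chart_one(1), symmetric])
  ultimately have "(\<lambda>h. frechet_derivative (\<lambda>y. mc_form chart_one y (left_frame chart_one coord_one b)) (at coord_one) h +
        mc_form chart_one coord_one (frechet_derivative (\<lambda>y. left_frame chart_one y b) (at coord_one) h)) = (\<lambda>h. 0)"
    by (rule has_derivative_unique)
  from fun_cong[OF this, of a] show ?thesis
    by (simp add: left_frame_one mc_form_one eq_neg_iff_add_eq_0)
qed

lemma lie_bracket_eq:
  "lie_bracket G u v = frechet_derivative (\<lambda>y. left_frame chart_one y v) (at coord_one) u
     - frechet_derivative (\<lambda>y. left_frame chart_one y u) (at coord_one) v"
proof -
  have "frechet_derivative (field_in_chart G chart_one (left_invariant_field G w)) (at coord_one) =
      frechet_derivative (\<lambda>y. left_frame chart_one y w) (at coord_one)" for w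
    by (rule frechet_derivative_cong_open[OF open_chart_range[OF chart_one(1)] coord_one_in])
      (rule left_invariant_field_in_chart[OF chart_one(1)])
  then show ?thesis
    unfolding lie_bracket_def field_bracket_def Let_def chart_one_def[symmetric] coord_one_def[symmetric]
      left_invariant_field_in_chart[OF chart_one(1) coord_one_in] left_frame_one id_apply
    by simp
qed

lemma lie_bracket_mc_one:
  "lie_bracket G u v = frechet_derivative (\<lambda>y. mc_form chart_one y u) (at coord_one) v
     - frechet_derivative (\<lambda>y. mc_form chart_one y v) (at coord_one) u"
  by (simp add: lie_bracket_eq deriv_mc_form_one)

lemma linear_frechet_mc_form:
  assumes c: "c \<in> atlas G" and x: "x \<in> chart_range c"
  shows "linear (\<lambda>b. frechet_derivative (\<lambda>y. mc_form c y b) (at x) h)"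
proof (rule linearI)
  note der = mc_form_has_derivative[OF c x]
  fix a b :: 'e and r :: real
  have "((\<lambda>y. mc_form c y (a + b)) has_derivative (\<lambda>h. frechet_derivative (\<lambda>y. mc_form c y a) (at x) h +
      frechet_derivative (\<lambda>y. mc_form c y b) (at x) h)) (at x)"
    by (rule has_derivative_transform_within_open[OF has_derivative_add[OF der der] open_chart_range[OF c] x])
      (simp add: linear_add[OF linear_mc_form[OF c]])
  from has_derivative_unique[OF der this]
  show "frechet_derivative (\<lambda>y. mc_form c y (a + b)) (at x) h =
      frechet_derivative (\<lambda>y. mc_form c y a) (at x) h + frechet_derivative (\<lambda>y. mc_form c y b) (at x) h"
    by (rule fun_cong)
  have "((\<lambda>y. mc_form c y (r *\<^sub>R a)) has_derivative (\<lambda>h. r *\<^sub>R frechet_derivative (\<lambda>y. mc_form c y a) (at x) h)) (at x)"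
    by (rule has_derivative_transform_within_open[OF has_derivative_scaleR_right[OF der] open_chart_range[OF c] x])
      (simp add: linear_cmul[OF linear_mc_form[OF c]])
  from has_derivative_unique[OF der this]
  show "frechet_derivative (\<lambda>y. mc_form c y (r *\<^sub>R a)) (at x) h = r *\<^sub>R frechet_derivative (\<lambda>y. mc_form c y a) (at x) h"
    by (rule fun_cong)
qed

lemma linear_frechet_mc_form_dir:
  assumes c: "c \<in> atlas G" and x: "x \<in> chart_range c"
  shows "linear (\<lambda>h. frechet_derivative (\<lambda>y. mc_form c y b) (at x) h)"
  using mc_form_has_derivative[OF assms] by (rule has_derivative_linear)

lemma bilinear_lie_bracket: "bilinear (lie_bracket G)"
  unfolding bilinear_def lie_bracket_mc_one
  using linear_frechet_mc_form[OF chart_one(1) coord_one_in]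
    linear_frechet_mc_form_dir[OF chart_one(1) coord_one_in]
  by (auto intro!: linear_compose_sub)

lemma lie_bracket_antisym: "lie_bracket G u v = - lie_bracket G v u"
  by (simp add: lie_bracket_eq)

text \<open>
  Translation by \<open>p\<^sup>-\<^sup>1\<close> carries a neighbourhood of \<open>p\<close> to a neighbourhood of the identity, and the
  Maurer--Cartan form is invariant under it; hence it suffices to know its derivative at the identity.
\<close>

lemma maurer_cartan:
  assumes c: "c \<in> atlas G" and x: "x \<in> chart_range c"
  shows "frechet_derivative (\<lambda>y. mc_form c y b) (at x) a - frechet_derivative (\<lambda>y. mc_form c y a) (at x) b =
    - lie_bracket G (mc_form c x a) (mc_form c x b)"
proof -
  define p where "p = chart_inv c x"
  have p: "p \<in> carrier G" "p \<in> fst c" using point[OF c x] by (auto simp: p_def)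
  have ip: "inv\<^bsub>G\<^esub> p \<in> carrier G" using p by simp
  define S where "S = {y \<in> chart_range c. inv\<^bsub>G\<^esub> p \<otimes>\<^bsub>G\<^esub> chart_inv c y \<in> fst chart_one}"
  define \<Psi> where "\<Psi> = (\<lambda>y. snd chart_one (inv\<^bsub>G\<^esub> p \<otimes>\<^bsub>G\<^esub> chart_inv c y))"
  have S: "open S" "x \<in> S" and smooth: "smooth_on S \<Psi>"
    using smooth_translation[OF ip c chart_one(1)] x p chart_one(2)
    by (auto simp: S_def \<Psi>_def p_def)
  have \<Psi>_in: "\<Psi> y \<in> chart_range chart_one" and \<Psi>_inv: "chart_inv chart_one (\<Psi> y) = inv\<^bsub>G\<^esub> p \<otimes>\<^bsub>G\<^esub> chart_inv c y"
    if "y \<in> S" for y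
    using that snd_in_chart_range[of _ chart_one] chart_inv_snd[OF chart_inj[OF chart_one(1)]] by (auto simp: S_def \<Psi>_def)
  let ?D\<Psi> = "\<lambda>y. frechet_derivative \<Psi> (at y)"
  \<comment> \<open>Translation by the inverse of \<open>q\<close> is translation by the inverse of
    \<open>p\<close>, followed by translation by the inverse of the point so reached. Thus the form
    in \<open>c\<close> is the pullback of the form in \<open>chart_one\<close> along
    \<open>\<Psi>\<close>.\<close>
  have mc: "mc_form c y w = mc_form chart_one (\<Psi> y) (?D\<Psi> y w)" if "y \<in> S" for y w
  proof -
    define q where "q = chart_inv c y"
    have y: "y \<in> chart_range c" using that by (simp add: S_def)
    have q: "q \<in> carrier G" "q \<in> fst c" using point[OF c y] by (auto simp: q_def)
    have r: "inv\<^bsub>G\<^esub> p \<otimes>\<^bsub>G\<^esub> q \<in> fst chart_one" using that by (simp add: S_def q_def)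
    have "inv\<^bsub>G\<^esub> (inv\<^bsub>G\<^esub> p \<otimes>\<^bsub>G\<^esub> q) \<otimes>\<^bsub>G\<^esub> inv\<^bsub>G\<^esub> p = inv\<^bsub>G\<^esub> q"
      using p q by (simp add: inv_mult_group m_assoc)
    moreover have "trans_deriv c chart_one (inv\<^bsub>G\<^esub> (inv\<^bsub>G\<^esub> p \<otimes>\<^bsub>G\<^esub> q) \<otimes>\<^bsub>G\<^esub> inv\<^bsub>G\<^esub> p) q =
       trans_deriv chart_one chart_one (inv\<^bsub>G\<^esub> (inv\<^bsub>G\<^esub> p \<otimes>\<^bsub>G\<^esub> q)) (inv\<^bsub>G\<^esub> p \<otimes>\<^bsub>G\<^esub> q) \<circ> trans_deriv c chart_one (inv\<^bsub>G\<^esub> p) q"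
      by (rule trans_deriv_mult) (use c p q r chart_one in auto)
    moreover have "trans_deriv c chart_one (inv\<^bsub>G\<^esub> p) q = ?D\<Psi> y"
      by (simp add: trans_deriv_def chart_deriv_def \<Psi>_def q_def snd_chart_inv[OF y])
    ultimately show ?thesis
      by (simp add: mc_form_def \<Psi>_inv[OF that] q_def[symmetric])
  qed
  have \<Psi>x: "\<Psi> x = coord_one" using p by (simp add: \<Psi>_def p_def[symmetric] coord_one_def)
  have D\<Psi>x: "?D\<Psi> x = mc_form c x" using mc[OF S(2)] by (simp add: fun_eq_iff \<Psi>x mc_form_one)
  \<comment> \<open>The derivative of the pullback has one term from the form at the identity and
    one from the second derivative of \<open>\<Psi>\<close>; the latter is symmetric and drops out
    of the difference.\<close>
  have second: "frechet_derivative (\<lambda>y. mc_form c y w) (at x) v =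
      frechet_derivative (\<lambda>y. mc_form chart_one y (mc_form c x w)) (at coord_one) (mc_form c x v) +
      frechet_derivative (\<lambda>y. ?D\<Psi> y w) (at x) v" for v w
  proof -
    have 1: "((\<lambda>y. mc_form chart_one (\<Psi> y) u) has_derivative
        (\<lambda>h. frechet_derivative (\<lambda>y. mc_form chart_one y u) (at coord_one) (mc_form c x h))) (at x)" for u
      using has_derivative_compose[OF smooth_on_has_derivative[OF smooth S(2)], of "\<lambda>y. mc_form chart_one y u"]
        mc_form_has_derivative[OF chart_one(1) coord_one_in, of u]
      by (simp add: \<Psi>x D\<Psi>x)
    have "((\<lambda>y. mc_form chart_one (\<Psi> y) (?D\<Psi> y w)) has_derivative
      (\<lambda>h. frechet_derivative (\<lambda>y. mc_form chart_one y (?D\<Psi> x w)) (at coord_one) (mc_form c x h) +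
        mc_form chart_one (\<Psi> x) (frechet_derivative (\<lambda>y. ?D\<Psi> y w) (at x) h))) (at x)"
      by (rule has_derivative_bundle[where Y = "\<lambda>y. mc_form chart_one (\<Psi> y)" and V = "\<lambda>y. ?D\<Psi> y w", OF S linear_mc_form[OF chart_one(1) \<Psi>_in] 1
            smooth_on_has_derivative[OF smooth_on_deriv[OF smooth] S(2)]])
    then have "((\<lambda>y. mc_form c y w) has_derivative
      (\<lambda>h. frechet_derivative (\<lambda>y. mc_form chart_one y (?D\<Psi> x w)) (at coord_one) (mc_form c x h) +
        mc_form chart_one (\<Psi> x) (frechet_derivative (\<lambda>y. ?D\<Psi> y w) (at x) h))) (at x)"
      by (rule has_derivative_transform_within_open[OF _ S]) (rule mc[symmetric])
    from frechet_derivative_at[OF this, THEN fun_cong, of v] show ?thesis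
      by (simp add: \<Psi>x D\<Psi>x mc_form_one)
  qed
  show ?thesis
    unfolding second lie_bracket_mc_one
    using second_derivative_symmetric[OF S smooth, of a b] by simp
qed

section \<open>Left invariant metrics and one-forms\<close>

lemma mc_form_chart_at:
  assumes "p \<in> carrier G"
  shows "mc_form (chart_at G p) (snd (chart_at G p) p) = trans_deriv (chart_at G p) chart_one (inv\<^bsub>G\<^esub> p) p"
  using chart_inv_snd[OF chart_inj[OF chart_at_in_atlas[OF assms]] in_chart_at[OF assms]]
  by (simp add: mc_form_def)

lemma left_invariant_tensor_in_chart:
  assumes m: "left_invariant_metric G m" and c: "c \<in> atlas G" and x: "x \<in> chart_range c"
  shows "tensor_in_chart G c m x a b = m \<one>\<^bsub>G\<^esub> (mc_form c x a) (mc_form c x b)"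
proof -
  let ?p = "chart_inv c x"
  have p: "?p \<in> carrier G" using point[OF c x] by simp
  have "m (?p \<otimes>\<^bsub>G\<^esub> \<one>\<^bsub>G\<^esub>) (tangent_map G G (\<lambda>h. ?p \<otimes>\<^bsub>G\<^esub> h) \<one>\<^bsub>G\<^esub> u) (tangent_map G G (\<lambda>h. ?p \<otimes>\<^bsub>G\<^esub> h) \<one>\<^bsub>G\<^esub> v) = m \<one>\<^bsub>G\<^esub> u v" for u v
    using m p unfolding left_invariant_metric_def by blast
  then show ?thesis using p by (simp add: tensor_in_chart_def from_coords_mc[OF c x])
qed

lemma left_invariant_one_form_in_chart:
  assumes m: "left_invariant_one_form G \<eta>" and c: "c \<in> atlas G" and x: "x \<in> chart_range c"
  shows "one_form_in_chart G c \<eta> x a = \<eta> \<one>\<^bsub>G\<^esub> (mc_form c x a)"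
proof -
  let ?p = "chart_inv c x"
  have p: "?p \<in> carrier G" using point[OF c x] by simp
  have "\<eta> (?p \<otimes>\<^bsub>G\<^esub> \<one>\<^bsub>G\<^esub>) (tangent_map G G (\<lambda>h. ?p \<otimes>\<^bsub>G\<^esub> h) \<one>\<^bsub>G\<^esub> u) = \<eta> \<one>\<^bsub>G\<^esub> u" for u
    using m p unfolding left_invariant_one_form_def by blast
  then show ?thesis using p by (simp add: one_form_in_chart_def from_coords_mc[OF c x])
qed

text \<open>In a chart the form is a constant functional applied to \<open>mc_form\<close>, so its
  exterior derivative is that functional applied to the exterior derivative of
  \<open>mc_form\<close>, which is minus the bracket.\<close>

lemma ext_deriv_one:
  assumes "left_invariant_one_form G \<eta>"
  shows "ext_deriv G \<eta> \<one>\<^bsub>G\<^esub> u v = - \<eta> \<one>\<^bsub>G\<^esub> (lie_bracket G u v)"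
proof -
  have lin: "linear (\<eta> \<one>\<^bsub>G\<^esub>)"
    using assms by (simp add: left_invariant_one_form_def differential_one_form_def)
  have "frechet_derivative (\<lambda>y. one_form_in_chart G chart_one \<eta> y b) (at coord_one) a =
      \<eta> \<one>\<^bsub>G\<^esub> (frechet_derivative (\<lambda>y. mc_form chart_one y b) (at coord_one) a)" for a b
  proof -
    have "((\<lambda>y. \<eta> \<one>\<^bsub>G\<^esub> (mc_form chart_one y b)) has_derivative
        (\<lambda>a. \<eta> \<one>\<^bsub>G\<^esub> (frechet_derivative (\<lambda>y. mc_form chart_one y b) (at coord_one) a))) (at coord_one)"
      by (rule bounded_linear.has_derivative[OF linear_conv_bounded_linear[THEN iffD1, OF lin]
            mc_form_has_derivative[OF chart_one(1) coord_one_in]])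
    then have "((\<lambda>y. one_form_in_chart G chart_one \<eta> y b) has_derivative
        (\<lambda>a. \<eta> \<one>\<^bsub>G\<^esub> (frechet_derivative (\<lambda>y. mc_form chart_one y b) (at coord_one) a))) (at coord_one)"
      by (rule has_derivative_transform_within_open[OF _ open_chart_range[OF chart_one(1)] coord_one_in])
        (rule left_invariant_one_form_in_chart[OF assms chart_one(1), symmetric])
    from frechet_derivative_at[OF this, THEN fun_cong, of a] show ?thesis by simp
  qed
  then show ?thesis
    unfolding ext_deriv_def Let_def chart_one_def[symmetric] coord_one_def[symmetric] lie_bracket_mc_one
    by (simp add: linear_diff[OF lin])
qed

text \<open>The left invariant metric with value \<open>q\<close> at the identity.\<close>

definition extend_metric :: "('e \<Rightarrow> 'e \<Rightarrow> real) \<Rightarrow> 'a \<Rightarrow> 'e \<Rightarrow> 'e \<Rightarrow> real" where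
  "extend_metric q p u v = q (trans_deriv (chart_at G p) chart_one (inv\<^bsub>G\<^esub> p) p u)
     (trans_deriv (chart_at G p) chart_one (inv\<^bsub>G\<^esub> p) p v)"

lemma extend_metric_in_chart:
  assumes c: "c \<in> atlas G" and x: "x \<in> chart_range c"
  shows "tensor_in_chart G c (extend_metric q) x a b = q (mc_form c x a) (mc_form c x b)"
proof -
  let ?p = "chart_inv c x"
  have p: "?p \<in> carrier G" "?p \<in> fst c" using point[OF c x] by auto
  have "trans_deriv c chart_one (inv\<^bsub>G\<^esub> ?p \<otimes>\<^bsub>G\<^esub> \<one>\<^bsub>G\<^esub>) ?p =
      trans_deriv (chart_at G ?p) chart_one (inv\<^bsub>G\<^esub> ?p) (\<one>\<^bsub>G\<^esub> \<otimes>\<^bsub>G\<^esub> ?p) \<circ> trans_deriv c (chart_at G ?p) \<one>\<^bsub>G\<^esub> ?p"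
    by (rule trans_deriv_mult) (use c p chart_one chart_at[OF p(1)] in auto)
  then show ?thesis using p
    by (simp add: tensor_in_chart_def extend_metric_def from_coords_eq[OF c x] mc_form_def)
qed

lemma left_invariant_extend_metric:
  assumes q: "bilinear q" and sym: "\<And>u v. q u v = q v u" and pos: "\<And>u. u \<noteq> 0 \<Longrightarrow> q u u > 0"
  shows "left_invariant_metric G (extend_metric q)"
  unfolding left_invariant_metric_def riemannian_metric_def
proof (intro conjI ballI allI impI)
  fix p assume p: "p \<in> carrier G"
  let ?c = "chart_at G p" and ?x = "snd (chart_at G p) p"
  note c = chart_at_in_atlas[OF p] and x = snd_in_chart_range[OF in_chart_at[OF p]]
  have eq: "extend_metric q p = (\<lambda>u v. q (mc_form ?c ?x u) (mc_form ?c ?x v))"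
    by (simp add: extend_metric_def mc_form_chart_at[OF p] fun_eq_iff)
  show "bilinear (extend_metric q p)"
    unfolding bilinear_def
  proof (intro conjI allI)
    have q1: "linear (q a)" and q2: "linear (\<lambda>a. q a b)" for a b
      using q by (simp_all add: bilinear_def)
    show "linear (extend_metric q p a)" for a
      using linear_compose[OF linear_mc_form[OF c x] q1] by (simp add: eq o_def)
    show "linear (\<lambda>a. extend_metric q p a b)" for b
      using linear_compose[OF linear_mc_form[OF c x] q2] by (simp add: eq o_def)
  qed
  show "extend_metric q p u v = extend_metric q p v u" for u v
    using sym by (simp add: extend_metric_def)
  show "extend_metric q p u u > 0" if "u \<noteq> 0" for u
  proof -
    have "mc_form ?c ?x u \<noteq> 0"
      using that left_frame_mc[OF c x, of u] linear_0[OF linear_left_frame[OF c x]] by auto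
    then show ?thesis using pos by (simp add: eq)
  qed
  fix g u v assume g: "g \<in> carrier G"
  have "trans_deriv (chart_at G p) chart_one (inv\<^bsub>G\<^esub> (g \<otimes>\<^bsub>G\<^esub> p) \<otimes>\<^bsub>G\<^esub> g) p =
     trans_deriv (chart_at G (g \<otimes>\<^bsub>G\<^esub> p)) chart_one (inv\<^bsub>G\<^esub> (g \<otimes>\<^bsub>G\<^esub> p)) (g \<otimes>\<^bsub>G\<^esub> p) \<circ>
     trans_deriv (chart_at G p) (chart_at G (g \<otimes>\<^bsub>G\<^esub> p)) g p"
    by (rule trans_deriv_mult) (use c g p chart_one chart_at[OF p] chart_at[of "g \<otimes>\<^bsub>G\<^esub> p"] in auto)
  moreover have "inv\<^bsub>G\<^esub> (g \<otimes>\<^bsub>G\<^esub> p) \<otimes>\<^bsub>G\<^esub> g = inv\<^bsub>G\<^esub> p"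
    using g p by (simp add: inv_mult_group m_assoc)
  ultimately show "extend_metric q (g \<otimes>\<^bsub>G\<^esub> p) (tangent_map G G (\<lambda>h. g \<otimes>\<^bsub>G\<^esub> h) p u)
     (tangent_map G G (\<lambda>h. g \<otimes>\<^bsub>G\<^esub> h) p v) = extend_metric q p u v"
    by (simp add: extend_metric_def tangent_map_eq)
next
  fix c u v assume c: "c \<in> atlas G"
  have "smooth_on (chart_range c) (\<lambda>x. q (mc_form c x u) (mc_form c x v))"
    by (rule smooth_on_bounded_bilinear[OF open_chart_range[OF c] q[unfolded bilinear_conv_bounded_bilinear]
          smooth_mc_form[OF c] smooth_mc_form[OF c]])
  then show "smooth_on (chart_range c) (\<lambda>x. tensor_in_chart G c (extend_metric q) x u v)"
    by (rule smooth_on_cong[OF open_chart_range[OF c]]) (simp add: extend_metric_in_chart[OF c])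
qed

end

section \<open>Curvature in a moving frame\<close>

text \<open>\<open>Y\<close> is an isometric coframe with values in a model Lie algebra,
  \<open>X\<close> the dual frame, and \<open>nabla\<close> the Levi-Civita connection of the model.
  The model has a type of its own: it is \<open>'e\<close> in one application and the algebra of
  E(2) in the other.\<close>

locale moving_frame =
  fixes R :: "'e::euclidean_space set" and Y :: "'e \<Rightarrow> 'e \<Rightarrow> 'g::euclidean_space" and X :: "'e \<Rightarrow> 'g \<Rightarrow> 'e"
    and br nabla :: "'g \<Rightarrow> 'g \<Rightarrow> 'g" and M :: "'e \<Rightarrow> 'e \<Rightarrow> 'e \<Rightarrow> real"
  assumes open_R: "open R"
    and linear_Y: "x \<in> R \<Longrightarrow> linear (Y x)" and linear_X: "x \<in> R \<Longrightarrow> linear (X x)"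
    and YX: "x \<in> R \<Longrightarrow> Y x (X x u) = u" and XY: "x \<in> R \<Longrightarrow> X x (Y x a) = a"
    and smooth_Y: "smooth_on R (\<lambda>x. Y x a)" and smooth_X: "smooth_on R (\<lambda>x. X x u)"
    and structure_equation: "x \<in> R \<Longrightarrow> frechet_derivative (\<lambda>y. Y y b) (at x) a - frechet_derivative (\<lambda>y. Y y a) (at x) b =
      - br (Y x a) (Y x b)"
    and bilinear_nabla: "bilinear nabla"
    and nabla_skew: "nabla u v \<bullet> w = - (v \<bullet> nabla u w)"
    and nabla_torsion_free: "nabla u v - nabla v u = br u v"
    and metric: "x \<in> R \<Longrightarrow> M x a b = Y x a \<bullet> Y x b"
begin

abbreviation "DY x a b \<equiv> frechet_derivative (\<lambda>y. Y y b) (at x) a"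

lemma Y_has_derivative: "x \<in> R \<Longrightarrow> ((\<lambda>y. Y y b) has_derivative (\<lambda>a. DY x a b)) (at x)"
  by (rule smooth_on_has_derivative[OF smooth_Y])

lemma DY_has_derivative:
  "x \<in> R \<Longrightarrow> ((\<lambda>y. DY y a b) has_derivative (\<lambda>h. frechet_derivative (\<lambda>y. DY y a b) (at x) h)) (at x)"
  by (rule smooth_on_has_derivative[OF smooth_on_deriv[OF smooth_Y]])

lemma frechet_metric:
  assumes "x \<in> R"
  shows "frechet_derivative (\<lambda>y. M y b z) (at x) a = DY x a b \<bullet> Y x z + Y x b \<bullet> DY x a z"
proof -
  have "((\<lambda>y. Y y b \<bullet> Y y z) has_derivative (\<lambda>a. Y x b \<bullet> DY x a z + DY x a b \<bullet> Y x z)) (at x)"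
    by (rule has_derivative_inner[OF Y_has_derivative[OF assms] Y_has_derivative[OF assms]])
  then have "((\<lambda>y. M y b z) has_derivative (\<lambda>a. Y x b \<bullet> DY x a z + DY x a b \<bullet> Y x z)) (at x)"
    by (rule has_derivative_transform_within_open[OF _ open_R assms]) (rule metric[symmetric])
  from frechet_derivative_at[OF this, THEN fun_cong, of a] show ?thesis by simp
qed

text \<open>In the frame the connection is the constant \<open>nabla\<close>: \<open>Y\<close> sends
  the covariant derivative of a field to the derivative of its components plus a
  \<open>nabla\<close> term, and for constant fields this is the formula. It satisfies the Koszul
  identity, which determines it as \<open>M\<close> is nondegenerate.\<close>

lemma christoffel_eq:
  assumes x: "x \<in> R"
  shows "christoffel M x a b = X x (nabla (Y x a) (Y x b) + DY x a b)" (is "_ = ?w")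
proof -
  have koszul: "2 * M x ?w z = frechet_derivative (\<lambda>y. M y b z) (at x) a + frechet_derivative (\<lambda>y. M y a z) (at x) b
        - frechet_derivative (\<lambda>y. M y a b) (at x) z" for z
  proof -
    \<comment> \<open>The structure equation brings matching derivatives of \<open>Y\<close> into
      the same order so that they cancel; skewness and vanishing torsion settle the rest.\<close>
    have s: "DY x a z = DY x z a - br (Y x a) (Y x z)" "DY x b z = DY x z b - br (Y x b) (Y x z)"
      "DY x b a = DY x a b + br (Y x a) (Y x b)"
      using structure_equation[OF x, of z a] structure_equation[OF x, of z b] structure_equation[OF x, of b a]
      by (simp_all add: algebra_simps)
    show ?thesis
      unfolding frechet_metric[OF x] metric[OF x] YX[OF x] s nabla_torsion_free[symmetric]
      using nabla_skew[of "Y x z" "Y x a" "Y x b"] nabla_skew[of "Y x a" "Y x b" "Y x z"]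
        nabla_skew[of "Y x b" "Y x a" "Y x z"]
      by (simp add: inner_simps inner_commute)
  qed
  show ?thesis
    unfolding christoffel_def
  proof (rule the_equality)
    show "\<forall>z. 2 * M x ?w z = frechet_derivative (\<lambda>y. M y b z) (at x) a + frechet_derivative (\<lambda>y. M y a z) (at x) b
        - frechet_derivative (\<lambda>y. M y a b) (at x) z" using koszul by blast
    fix w assume "\<forall>z. 2 * M x w z = frechet_derivative (\<lambda>y. M y b z) (at x) a + frechet_derivative (\<lambda>y. M y a z) (at x) b
        - frechet_derivative (\<lambda>y. M y a b) (at x) z"
    then have "2 * M x w z = 2 * M x ?w z" for z unfolding koszul by blast
    then have "Y x w \<bullet> Y x z = Y x ?w \<bullet> Y x z" for z by (simp add: metric[OF x])
    from this[of "w - ?w"] have "(Y x w - Y x ?w) \<bullet> (Y x w - Y x ?w) = 0"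
      by (simp add: linear_diff[OF linear_Y[OF x]] inner_diff_left)
    then have "Y x w = Y x ?w" by simp
    then show "w = ?w" using XY[OF x] by metis
  qed
qed

lemma christoffel_sym:
  assumes x: "x \<in> R"
  shows "christoffel M x a b = christoffel M x b a"
proof -
  have "nabla (Y x a) (Y x b) + DY x a b = nabla (Y x b) (Y x a) + DY x b a"
    using structure_equation[OF x, of b a] nabla_torsion_free[of "Y x a" "Y x b"] by (simp add: algebra_simps)
  then show ?thesis by (simp add: christoffel_eq[OF x])
qed

text \<open>All terms cancel in pairs because the Christoffel map is symmetric. Transported by
  \<open>Y\<close>, this becomes the Bianchi identity of the algebraic curvature.\<close>

lemma bianchi:
  assumes x: "x \<in> R"
  shows "curvature M x a b c + curvature M x b c a + curvature M x c a b = 0"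
proof -
  have 1: "frechet_derivative (\<lambda>y. christoffel M y u v) (at x) = frechet_derivative (\<lambda>y. christoffel M y v u) (at x)" for u v
    by (rule frechet_derivative_cong_open[OF open_R x christoffel_sym])
  show ?thesis unfolding curvature_def
    by (simp add: 1[of a b] 1[of b c] 1[of c a] christoffel_sym[OF x, of a b] christoffel_sym[OF x, of b c] christoffel_sym[OF x, of c a])
qed

lemma Y_frechet_christoffel:
  assumes x: "x \<in> R"
  shows "Y x (frechet_derivative (\<lambda>y. christoffel M y b w) (at x) a) =
     nabla (DY x a b) (Y x w) + nabla (Y x b) (DY x a w) + frechet_derivative (\<lambda>y. DY y b w) (at x) a
       - DY x a (christoffel M x b w)"
proof -
  let ?V = "\<lambda>y. nabla (Y y b) (Y y w) + DY y b w"
  let ?V' = "\<lambda>h. (nabla (Y x b) (DY x h w) + nabla (DY x h b) (Y x w)) + frechet_derivative (\<lambda>y. DY y b w) (at x) h"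
  let ?X' = "\<lambda>h u. frechet_derivative (\<lambda>y. X y u) (at x) h"
  have X': "((\<lambda>y. X y u) has_derivative (\<lambda>h. ?X' h u)) (at x)" for u
    by (rule smooth_on_has_derivative[OF smooth_X x])
  have V': "(?V has_derivative ?V') (at x)"
    by (rule has_derivative_add[OF bounded_bilinear.FDERIV[OF bilinear_nabla[unfolded bilinear_conv_bounded_bilinear]
          Y_has_derivative[OF x] Y_has_derivative[OF x]] DY_has_derivative[OF x]])
  have "((\<lambda>y. X y (?V y)) has_derivative (\<lambda>h. ?X' h (?V x) + X x (?V' h))) (at x)"
    by (rule has_derivative_bundle[where Y = X and V = ?V and V' = ?V', OF open_R x linear_X X' V'])
  then have "((\<lambda>y. christoffel M y b w) has_derivative (\<lambda>h. ?X' h (?V x) + X x (?V' h))) (at x)"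
    by (rule has_derivative_transform_within_open[OF _ open_R x]) (rule christoffel_eq[symmetric])
  from frechet_derivative_at[OF this, THEN fun_cong, of a]
  have 1: "frechet_derivative (\<lambda>y. christoffel M y b w) (at x) a = ?X' a (?V x) + X x (?V' a)" by simp
  \<comment> \<open>Differentiating \<open>Y y (X y u) = u\<close> eliminates the derivative of the
    frame \<open>X\<close>.\<close>
  have "Y x (?X' a u) = - DY x a (X x u)" for u
  proof -
    have "((\<lambda>y. Y y (X y u)) has_derivative (\<lambda>h. DY x h (X x u) + Y x (?X' h u))) (at x)"
      by (rule has_derivative_bundle[where Y = Y and V = "\<lambda>y. X y u", OF open_R x linear_Y Y_has_derivative[OF x] X'])
    moreover have "((\<lambda>y. Y y (X y u)) has_derivative (\<lambda>h. 0)) (at x)"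
      by (rule has_derivative_transform_within_open[OF has_derivative_const[of u] open_R x]) (rule YX[symmetric])
    ultimately have "(\<lambda>h. DY x h (X x u) + Y x (?X' h u)) = (\<lambda>h. 0)"
      by (rule has_derivative_unique)
    from fun_cong[OF this, of a] show ?thesis
      by (simp add: eq_neg_iff_add_eq_0 add.commute)
  qed
  then show ?thesis
    unfolding 1 linear_add[OF linear_Y[OF x]] YX[OF x] christoffel_eq[OF x, of b w]
    by simp
qed

text \<open>Second derivatives of \<open>Y\<close> cancel by symmetry, and most first derivatives
  cancel in pairs. What remains is the antisymmetrised first derivative in the first slot of
  \<open>nabla\<close>, which the structure equation turns into the bracket.\<close>

lemma Y_curvature:
  assumes x: "x \<in> R"
  shows "Y x (curvature M x a b w) =
    nabla (Y x a) (nabla (Y x b) (Y x w)) - nabla (Y x b) (nabla (Y x a) (Y x w)) - nabla (br (Y x a) (Y x b)) (Y x w)"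
proof -
  have Y\<Gamma>: "Y x (christoffel M x u v) = nabla (Y x u) (Y x v) + DY x u v" for u v
    by (simp add: christoffel_eq[OF x] YX[OF x])
  have br: "br (Y x a) (Y x b) = DY x b a - DY x a b"
    using structure_equation[OF x, of b a] by (simp add: algebra_simps)
  have sym: "frechet_derivative (\<lambda>y. DY y b w) (at x) a = frechet_derivative (\<lambda>y. DY y a w) (at x) b"
    by (rule second_derivative_symmetric[OF open_R x smooth_Y])
  have nabla: "nabla u (v + v') = nabla u v + nabla u v'" "nabla (v - v') u = nabla v u - nabla v' u" for u v v'
    using bilinear_nabla by (simp_all add: bilinear_radd bilinear_lsub)
  show ?thesis
    unfolding curvature_def linear_add[OF linear_Y[OF x]] linear_diff[OF linear_Y[OF x]]
      Y_frechet_christoffel[OF x] Y\<Gamma> br sym nabla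
    by simp
qed

end

section \<open>Inner products and connections\<close>

text \<open>Polarising the sectional curvatures makes \<open>r\<close> alternating in all four
  arguments; the three terms of the Bianchi identity are then equal, so it reads
  \<open>3 * r a b c d = 0\<close>.\<close>

lemma curvature_tensor_zero:
  fixes r :: "'a::ab_group_add \<Rightarrow> 'a \<Rightarrow> 'a \<Rightarrow> 'a \<Rightarrow> real"
  assumes as1: "\<And>a b c d. r a b c d = - r b a c d" and as2: "\<And>a b c d. r a b c d = - r a b d c"
    and bianchi: "\<And>a b c d. r a b c d + r b c a d + r c a b d = 0"
    and add2: "\<And>a b b' c d. r a (b + b') c d = r a b c d + r a b' c d"
    and add3: "\<And>a b c c' d. r a b (c + c') d = r a b c d + r a b c' d"
    and sec: "\<And>a b. r a b b a = 0"
  shows "r a b c d = 0"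
proof -
  \<comment> \<open>The four cyclic identities on \<open>a\<close>, \<open>b\<close>,
    \<open>c\<close>, \<open>d\<close> are combined so that all other terms cancel.\<close>
  have pair: "r a b c d = r c d a b" for a b c d
    using bianchi[of a b c d] bianchi[of b c d a] bianchi[of c d a b] bianchi[of d a b c]
      as1[of a b c d] as1[of b c a d] as1[of c a b d] as1[of b c d a] as1[of c d b a] as1[of d b c a]
      as1[of c d a b] as1[of d a c b] as1[of a c d b] as1[of d a b c] as1[of a b d c] as1[of b d a c]
      as2[of a b c d] as2[of b c a d] as2[of c a b d] as2[of b c d a] as2[of c d b a] as2[of d b c a]
      as2[of c d a b] as2[of d a c b] as2[of a c d b] as2[of d a b c] as2[of a b d c] as2[of b d a c]
    by linarith
  have add1: "r (a + a') b c d = r a b c d + r a' b c d" for a a' b c d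
    using as1[of "a + a'" b c d] add2[of b a a' c d] as1[of a b c d] as1[of a' b c d] by linarith
  have add4: "r a b c (d + d') = r a b c d + r a b c d'" for a b c d d'
    using as2[of a b c "d + d'"] add3[of a b d d' c] as2[of a b c d] as2[of a b c d'] by linarith
  \<comment> \<open>Polarisation of \<open>sec\<close> in the inner two arguments; pair symmetry
    identifies the two cross terms. The next step polarises in the outer two.\<close>
  have 1: "r u v w u = 0" for u v w
  proof -
    have "r u v w u + r u w v u = 0"
      using sec[of u "v + w"] sec[of u v] sec[of u w] by (simp add: add2 add3)
    moreover have "r u w v u = r u v w u"
      using pair[of u w v u] as1[of v u u w] as2[of u v u w] by linarith
    ultimately show ?thesis by linarith
  qed
  have 2: "r u v w x = - r x v w u" for u v w x
    using 1[of "u + x" v w] 1[of u v w] 1[of x v w] by (simp add: add1 add4)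
  show ?thesis
    using bianchi[of a b c d] 2[of a b c d] as1[of d b c a] 2[of b d c a] as1[of b c a d] as1[of c a b d]
      2[of b c a d] 2[of c a b d] as2[of a b c d] as2[of b c a d] as2[of c a b d]
      as1[of d c a b] as1[of d a b c] as2[of d b c a] as2[of d c a b] as2[of d a b c]
      pair[of a b c d] pair[of b c a d] pair[of c a b d] pair[of d b c a] pair[of d c a b] pair[of d a b c]
      2[of a b d c] 2[of b a c d] 2[of b a d c] 2[of b c d a] 2[of c b a d] 2[of c a d b] 2[of a c b d]
      as1[of a c b d] as1[of b a c d] as1[of c b a d]
    by linarith
qed

text \<open>Gram-Schmidt for a form that need be positive on \<open>S\<close> only: it serves for
  the metric at the identity on the whole space, and for the trace form on the complement of its
  kernel.\<close>

lemma orthonormal_basis_exists: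
  fixes T :: "'g::euclidean_space \<Rightarrow> 'g \<Rightarrow> real"
  assumes T: "bilinear T" and sym: "\<And>x y. T x y = T y x"
    and "subspace S" "\<And>x. x \<in> S \<Longrightarrow> x \<noteq> 0 \<Longrightarrow> T x x > 0"
  shows "\<exists>B. finite B \<and> B \<subseteq> S \<and> (\<forall>e\<in>B. \<forall>f\<in>B. T e f = (if e = f then 1 else 0)) \<and>
    (\<forall>x\<in>S. x = (\<Sum>e\<in>B. T x e *\<^sub>R e))"
  using assms(3,4)
proof (induction "dim S" arbitrary: S rule: less_induct)
  case less
  show ?case
  proof (cases "S = {0}")
    case True
    then show ?thesis by (intro exI[of _ "{}"]) auto
  next
    case False
    then obtain v where v: "v \<in> S" "v \<noteq> 0" using subspace_0[OF less.prems(1)] by blast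
    define e where "e = (1 / sqrt (T v v)) *\<^sub>R v"
    have Tv: "T v v > 0" using less.prems(2) v by blast
    have e: "e \<in> S" "T e e = 1"
      using v Tv by (simp_all add: e_def subspace_scale[OF less.prems(1)] bilinear_lmul[OF T] bilinear_rmul[OF T])
    define S' where "S' = {x \<in> S. T x e = 0}"
    have S': "subspace S'" "S' \<subseteq> S"
      using less.prems(1) unfolding S'_def subspace_def
      by (simp_all add: bilinear_ladd[OF T] bilinear_lmul[OF T] bilinear_lzero[OF T])
    have "e \<notin> S'" using e by (simp add: S'_def)
    then have "dim S' < dim S"
      using S' less.prems(1) e(1) subspace_dim_equal[of S' S] dim_subset[of S' S] by fastforce
    then have "\<exists>B. finite B \<and> B \<subseteq> S' \<and> (\<forall>e\<in>B. \<forall>f\<in>B. T e f = (if e = f then 1 else 0)) \<and>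
        (\<forall>x\<in>S'. x = (\<Sum>e\<in>B. T x e *\<^sub>R e))"
      by (rule less.hyps[OF _ S'(1)]) (use less.prems(2) S'(2) in blast)
    then obtain B where B: "finite B" "B \<subseteq> S'"
      "\<And>f g. f \<in> B \<Longrightarrow> g \<in> B \<Longrightarrow> T f g = (if f = g then 1 else 0)"
      "\<And>x. x \<in> S' \<Longrightarrow> x = (\<Sum>f\<in>B. T x f *\<^sub>R f)"
      by (elim exE conjE) (rule that, assumption+, simp_all)
    have fe: "T f e = 0" "T e f = 0" if "f \<in> B" for f using that B(2) sym[of e f] by (auto simp: S'_def)
    have "e \<notin> B" using \<open>e \<notin> S'\<close> B(2) by blast
    show ?thesis
    proof (intro exI[of _ "insert e B"] conjI ballI)
      show "T f g = (if f = g then 1 else 0)" if "f \<in> insert e B" "g \<in> insert e B" for f g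
        using that e(2) fe(1)[of f] fe(2)[of g] B(3)[of f g] \<open>e \<notin> B\<close>
        by (cases "f = e"; cases "g = e") simp_all
      fix x assume x: "x \<in> S"
      let ?x = "x - T x e *\<^sub>R e"
      have "?x \<in> S'"
        using x e less.prems(1) by (simp add: S'_def subspace_diff subspace_scale bilinear_lsub[OF T] bilinear_lmul[OF T])
      from B(4)[OF this] have "?x = (\<Sum>f\<in>B. T x f *\<^sub>R f)"
        by (simp add: bilinear_lsub[OF T] bilinear_lmul[OF T] fe cong: sum.cong)
      then show "x = (\<Sum>f\<in>insert e B. T x f *\<^sub>R f)"
        using B(1) \<open>e \<notin> B\<close> by (simp add: algebra_simps)
    qed (use B(1,2) S'(2) e(1) in auto)
  qed
qed

text \<open>Sends a \<open>q\<close>-orthonormal basis to \<open>Basis\<close>, so that the metric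
  at the identity can be traded for the inner product of the type.\<close>

lemma inner_product_isometry:
  fixes q :: "'e::euclidean_space \<Rightarrow> 'e \<Rightarrow> real"
  assumes q: "bilinear q" and sym: "\<And>x y. q x y = q y x" and pos: "\<And>x. x \<noteq> 0 \<Longrightarrow> q x x > 0"
  obtains P :: "'e \<Rightarrow> 'e" where "linear P" "bij P" "\<And>u v. q u v = P u \<bullet> P v"
proof -
  obtain B where B: "finite B" "\<And>e f. e \<in> B \<Longrightarrow> f \<in> B \<Longrightarrow> q e f = (if e = f then 1 else 0)"
    and expand: "\<And>x. x = (\<Sum>e\<in>B. q x e *\<^sub>R e)"
    using orthonormal_basis_exists[OF q sym subspace_UNIV] pos by auto
  have lin: "linear (\<lambda>x. q x e)" for e using q by (simp add: bilinear_def)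
  have "independent B"
  proof (rule independent_if_scalars_zero[OF B(1)])
    fix f x assume 0: "(\<Sum>e\<in>B. f e *\<^sub>R e) = 0" and x: "x \<in> B"
    have "0 = q (\<Sum>e\<in>B. f e *\<^sub>R e) x" using 0 linear_0[OF lin] by simp
    also have "\<dots> = (\<Sum>e\<in>B. f e * q e x)" by (simp add: linear_sum[OF lin] linear_cmul[OF lin])
    also have "\<dots> = (\<Sum>e\<in>B. if e = x then f e else 0)" using B(2) x by (intro sum.cong) auto
    also have "\<dots> = f x" using B(1) x by simp
    finally show "f x = 0" by simp
  qed
  moreover have "span B = UNIV"
  proof -
    have "x \<in> span B" for x
      by (subst expand[of x]) (intro span_sum span_scale span_base)
    then show ?thesis by auto
  qed
  ultimately have "card B = card (Basis :: 'e set)"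
    by (metis dim_UNIV dim_eq_card_independent dim_span)
  then obtain \<phi> where \<phi>: "bij_betw \<phi> (Basis :: 'e set) B"
    using finite_same_card_bij[OF finite_Basis B(1)] by metis
  define P where "P x = (\<Sum>i\<in>Basis. q x (\<phi> i) *\<^sub>R i)" for x :: 'e
  have P: "linear P"
    by (rule linearI) (simp_all add: P_def linear_add[OF lin] linear_cmul[OF lin] scaleR_left.add
        scaleR_sum_right sum.distrib algebra_simps)
  have iso: "q u v = P u \<bullet> P v" for u v
  proof -
    have "P u \<bullet> P v = (\<Sum>i\<in>Basis. q u (\<phi> i) * q v (\<phi> i))"
      by (simp add: P_def inner_sum_left inner_sum_right inner_Basis if_distrib[of "\<lambda>x. _ * x"] sum.delta mult.commute cong: if_cong)
    also have "\<dots> = (\<Sum>e\<in>B. q u e * q v e)"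
      by (rule sum.reindex_bij_betw[OF \<phi>])
    also have "\<dots> = q (\<Sum>e\<in>B. q u e *\<^sub>R e) v"
      by (simp add: linear_sum[OF lin[of v]] linear_cmul[OF lin[of v]] sym[of v])
    also have "\<dots> = q u v" using expand[of u] by simp
    finally show ?thesis by simp
  qed
  have "inj P"
    unfolding linear_injective_0[OF P] using iso pos by (metis inner_zero_left less_irrefl)
  then have "bij P" using linear_injective_imp_surjective[OF P] by (simp add: bij_def)
  then show ?thesis using that P iso by blast
qed

lemma levi_civita_exists:
  fixes br :: "'g::euclidean_space \<Rightarrow> 'g \<Rightarrow> 'g"
  assumes br: "bilinear br" and antisym: "\<And>u v. br u v = - br v u"
  obtains nabla where "bilinear nabla" "\<And>u v w. nabla u v \<bullet> w = - (v \<bullet> nabla u w)"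
    "\<And>u v. nabla u v - nabla v u = br u v"
proof -
  \<comment> \<open>The Koszul formula for left invariant fields, whose inner products are
    constant.\<close>
  define K where "K u v w = (1/2) * (br u v \<bullet> w - br v w \<bullet> u + br w u \<bullet> v)" for u v w :: 'g
  define nabla where "nabla u v = (\<Sum>w\<in>Basis. K u v w *\<^sub>R w)" for u v
  note br_simps = bilinear_ladd[OF br] bilinear_lmul[OF br] bilinear_radd[OF br] bilinear_rmul[OF br]
  have nabla: "nabla u v \<bullet> w = K u v w" for u v w
  proof -
    have "linear (K u v)"
      by (rule linearI) (simp_all add: K_def br_simps inner_simps algebra_simps)
    from linear_eq_sum_Basis[OF this, of w] show ?thesis
      by (simp add: nabla_def inner_sum_left inner_commute[of w] mult.commute)
  qed
  have eqI: "x = y" if "\<And>w. x \<bullet> w = y \<bullet> w" for x y :: 'g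
    using that vector_eq_rdot[of x y] by blast
  show ?thesis
  proof (rule that[of nabla])
    show "bilinear nabla"
      unfolding bilinear_def
      by (intro conjI allI linearI; rule eqI)
        (simp_all add: nabla inner_simps K_def br_simps algebra_simps)
    show "nabla u v \<bullet> w = - (v \<bullet> nabla u w)" for u v w
      using antisym[of u v] antisym[of v w] antisym[of w u]
      by (simp add: nabla K_def inner_commute[of v] algebra_simps)
    show "nabla u v - nabla v u = br u v" for u v
    proof (rule eqI)
      fix w
      show "(nabla u v - nabla v u) \<bullet> w = br u v \<bullet> w"
        using antisym[of u v] antisym[of v w] antisym[of w u]
        by (simp add: nabla K_def inner_diff_left algebra_simps)
    qed
  qed
qed

lemma trace_commute:
  fixes A B :: "'g::euclidean_space \<Rightarrow> 'g"
  assumes A: "linear A" and B: "linear B"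
  shows "(\<Sum>i\<in>Basis. A (B i) \<bullet> i) = (\<Sum>i\<in>Basis. B (A i) \<bullet> i)"
proof -
  have "A (B i) \<bullet> i = (\<Sum>j\<in>Basis. (B i \<bullet> j) * (A j \<bullet> i))" for i
    by (subst linear_eq_sum_Basis[OF A]) (simp add: inner_sum_left)
  moreover have "B (A j) \<bullet> j = (\<Sum>i\<in>Basis. (A j \<bullet> i) * (B i \<bullet> j))" for j
    by (subst linear_eq_sum_Basis[OF B]) (simp add: inner_sum_left)
  ultimately show ?thesis
    by (simp add: mult.commute) (rule sum.swap)
qed

section \<open>Flat metric Lie algebras with a contact form\<close>

text \<open>The derivative of \<open>rot\<close> at angle 0, which generates the rotations.\<close>

definition quarter_turn :: "real^2 \<Rightarrow> real^2" where
  "quarter_turn w = vector [- (w $ 2), w $ 1]"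

text \<open>The semidirect product of the plane with a line acting by \<open>quarter_turn\<close>;
  it turns out to be the bracket of \<open>E2\<close> on the nose.\<close>

definition e2_bracket :: "(real^2) \<times> real \<Rightarrow> (real^2) \<times> real \<Rightarrow> (real^2) \<times> real" where
  "e2_bracket u v = (snd u *\<^sub>R quarter_turn (fst v) - snd v *\<^sub>R quarter_turn (fst u), 0)"

locale flat_lie_algebra =
  fixes br nabla :: "'g::euclidean_space \<Rightarrow> 'g \<Rightarrow> 'g"
  assumes bilinear_nabla: "bilinear nabla"
    and skew: "nabla u v \<bullet> w = - (v \<bullet> nabla u w)"
    and torsion_free: "nabla u v - nabla v u = br u v"
    and flat: "nabla u (nabla v w) - nabla v (nabla u w) = nabla (br u v) w"
begin

lemma linear_nabla: "linear (nabla u)" and linear_nabla_left: "linear (\<lambda>u. nabla u v)"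
  using bilinear_nabla by (simp_all add: bilinear_def)

lemmas nabla_simps = bilinear_ladd[OF bilinear_nabla] bilinear_radd[OF bilinear_nabla]
  bilinear_lmul[OF bilinear_nabla] bilinear_rmul[OF bilinear_nabla] bilinear_lsub[OF bilinear_nabla]
  bilinear_rsub[OF bilinear_nabla] bilinear_lzero[OF bilinear_nabla] bilinear_rzero[OF bilinear_nabla]
  bilinear_lneg[OF bilinear_nabla] bilinear_rneg[OF bilinear_nabla]

lemma skew_self: "nabla u v \<bullet> v = 0"
  using skew[of u v v] by (simp add: inner_commute)

section \<open>The kernel of the connection and its orthogonal complement\<close>

definition "ker = {x. \<forall>y. nabla x y = 0}"
definition "perp = {x. \<forall>u\<in>ker. x \<bullet> u = 0}"

lemma subspace_ker: "subspace ker" and subspace_perp: "subspace perp"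
  by (auto simp: subspace_def ker_def perp_def nabla_simps inner_simps)

lemma ker_perp_trivial: "x \<in> ker \<Longrightarrow> x \<in> perp \<Longrightarrow> x = 0"
  by (auto simp: perp_def)

lemma ker_perp_decomp: obtains y z where "y \<in> ker" "z \<in> perp" "x = y + z"
proof -
  obtain y z where "y \<in> span ker" "\<And>w. w \<in> span ker \<Longrightarrow> orthogonal z w" "x = y + z"
    using orthogonal_subspace_decomp_exists[of ker x] by blast
  moreover have "span ker = ker" using subspace_ker by (rule span_eq_iff[THEN iffD2])
  ultimately show ?thesis using that by (auto simp: perp_def orthogonal_def)
qed

lemma nabla_ker: "x \<in> ker \<Longrightarrow> nabla x y = 0"
  by (simp add: ker_def)

lemma bracket_ker: "x \<in> ker \<Longrightarrow> br y x = nabla y x"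
  using torsion_free[of y x] by (simp add: nabla_ker)

text \<open>For \<open>x\<close> in the kernel, \<open>nabla y x\<close> is the bracket of
  \<open>y\<close> and \<open>x\<close>, and flatness makes \<open>nabla\<close> of this bracket a
  commutator with the zero operator.\<close>

lemma ker_ideal: "x \<in> ker \<Longrightarrow> nabla y x \<in> ker"
  using flat[of y x] by (simp add: ker_def bracket_ker nabla_simps)

lemma perp_invariant: "x \<in> perp \<Longrightarrow> nabla y x \<in> perp"
  by (simp add: perp_def skew ker_ideal)

text \<open>By skewness this is minus the trace of \<open>nabla x\<close> composed with
  \<open>nabla y\<close>; in this form its positivity is visible.\<close>

definition trace_form :: "'g \<Rightarrow> 'g \<Rightarrow> real" where
  "trace_form x y = (\<Sum>i\<in>Basis. nabla x i \<bullet> nabla y i)"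

lemma bilinear_trace_form: "bilinear trace_form"
  unfolding bilinear_def trace_form_def
  by (intro conjI allI linearI) (simp_all add: nabla_simps inner_simps sum.distrib sum_distrib_left)

lemma trace_form_sym: "trace_form x y = trace_form y x"
  by (simp add: trace_form_def inner_commute)

lemma trace_form_pos:
  assumes "x \<in> perp" "x \<noteq> 0"
  shows "trace_form x x > 0"
proof (rule ccontr)
  assume "\<not> trace_form x x > 0"
  moreover have "trace_form x x \<ge> 0" unfolding trace_form_def by (intro sum_nonneg) simp
  ultimately have "trace_form x x = 0" by simp
  then have "nabla x i = 0" if "i \<in> Basis" for i
    using that unfolding trace_form_def by (subst (asm) sum_nonneg_eq_0_iff) auto
  then have "nabla x y = 0" for y
    by (subst linear_eq_sum_Basis[OF linear_nabla]) simp
  then have "x \<in> ker" by (simp add: ker_def)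
  then show False using ker_perp_trivial assms by blast
qed

text \<open>Flatness turns brackets into commutators, and the trace of a triple product is
  cyclic.\<close>

lemma trace_form_invariant: "trace_form (br x y) z = - trace_form y (br x z)"
proof -
  have t: "trace_form x y = - (\<Sum>i\<in>Basis. nabla y (nabla x i) \<bullet> i)" for x y
    by (simp add: trace_form_def skew[of y "nabla x _"] sum_negf)
  have c: "(\<Sum>i\<in>Basis. nabla u (nabla v (nabla w i)) \<bullet> i) = (\<Sum>i\<in>Basis. nabla v (nabla w (nabla u i)) \<bullet> i)" for u v w
    using trace_commute[OF linear_nabla[of u] linear_compose[OF linear_nabla[of w] linear_nabla[of v]]]
    by (simp add: o_def)
  show ?thesis
    unfolding t flat[symmetric]
    by (simp add: nabla_simps inner_diff_left sum_subtractf c[of z] c[of x])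
qed

text \<open>
  The Casimir element \<open>\<Sum> \<nabla>\<^sub>e \<nabla>\<^sub>e\<close> of the trace form agrees on the orthogonal complement of the kernel with \<open>x \<mapsto> \<nabla>\<^sub>x v\<close>, where
  \<open>v = \<Sum> \<nabla>\<^sub>e e\<close>; skewness forces first \<open>\<nabla>\<^sub>e v = 0\<close> and then \<open>\<nabla>\<^sub>e x = 0\<close>.
\<close>

lemma nabla_perp_zero:
  assumes x: "x \<in> perp" and y: "y \<in> perp"
  shows "nabla x y = 0"
proof -
  obtain B where B: "finite B" "B \<subseteq> perp"
    and expand: "\<And>x. x \<in> perp \<Longrightarrow> x = (\<Sum>e\<in>B. trace_form x e *\<^sub>R e)"
    using orthonormal_basis_exists[OF bilinear_trace_form trace_form_sym subspace_perp trace_form_pos] by blast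
  define v where "v = (\<Sum>e\<in>B. nabla e e)"
  have v: "v \<in> perp" unfolding v_def
    by (rule subspace_sum[OF subspace_perp]) (use B(2) perp_invariant in blast)
  have casimir: "nabla z v = (\<Sum>e\<in>B. nabla e (nabla e z))" if z: "z \<in> perp" for z
  proof -
    define a where "a e f = trace_form (br z e) f" for e f
    \<comment> \<open>Invariance of the trace form: bracketing with \<open>z\<close> has a skew
      matrix in a basis orthonormal for it.\<close>
    have a: "a e f = - a f e" for e f
      using trace_form_invariant[of z e f] trace_form_sym[of e "br z f"] by (simp add: a_def)
    have br: "br z e = (\<Sum>f\<in>B. a e f *\<^sub>R f)" if "e \<in> B" for e
    proof -
      have "br z e \<in> perp" unfolding torsion_free[symmetric]
        using z that B(2) by (intro subspace_diff[OF subspace_perp] perp_invariant) auto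
      then show ?thesis unfolding a_def by (rule expand)
    qed
    \<comment> \<open>Skew coefficients summed against a symmetric expression give zero, the
      mechanism by which Casimir elements are invariant.\<close>
    let ?S = "\<Sum>e\<in>B. \<Sum>f\<in>B. a e f *\<^sub>R (nabla e f + nabla f e)"
    have "?S = (\<Sum>e\<in>B. \<Sum>f\<in>B. a f e *\<^sub>R (nabla f e + nabla e f))" by (rule sum.swap)
    also have "\<dots> = - ?S"
      unfolding sum_negf[symmetric]
      by (intro sum.cong refl) (subst a, simp add: add.commute)
    finally have "?S + ?S = 0" using eq_neg_iff_add_eq_0 by blast
    then have "?S = 0" by (simp only: scaleR_2[symmetric] scaleR_eq_0_iff) simp
    moreover have "?S = (\<Sum>e\<in>B. nabla e (br z e) + nabla (br z e) e)"
      by (intro sum.cong refl)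
        (simp add: br linear_sum[OF linear_nabla] linear_sum[OF linear_nabla_left] nabla_simps scaleR_add_right sum.distrib)
    ultimately have 0: "(\<Sum>e\<in>B. nabla e (br z e) + nabla (br z e) e) = 0" by simp
    \<comment> \<open>Flatness moves \<open>nabla z\<close> past \<open>nabla e\<close>, and
      vanishing torsion trades \<open>nabla z e\<close> for \<open>nabla e z\<close>; the
      corrections are the terms that sum to zero.\<close>
    have "nabla z (nabla e e) = nabla e (nabla e z) + (nabla e (br z e) + nabla (br z e) e)" for e
      using flat[of z e e] by (simp add: torsion_free[symmetric] nabla_simps algebra_simps)
    then show ?thesis
      unfolding v_def linear_sum[OF linear_nabla] using 0 by (simp add: sum.distrib)
  qed
  have nabla_vanish: "nabla z w = 0" if "\<And>e. e \<in> B \<Longrightarrow> nabla e w = 0" "z \<in> perp" for z w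
    by (subst expand[OF that(2)]) (simp add: linear_sum[OF linear_nabla_left] nabla_simps that(1))
  have vanish: "nabla z w = 0" if "z \<in> perp" "w \<in> perp" "nabla w v \<bullet> w = 0" for w z
  proof (rule nabla_vanish[OF _ that(1)])
    \<comment> \<open>Pairing the Casimir identity for \<open>w\<close> with \<open>w\<close> itself
      gives minus a sum of squares.\<close>
    have "(\<Sum>e\<in>B. nabla e w \<bullet> nabla e w) = - (nabla w v \<bullet> w)"
      unfolding casimir[OF that(2)] by (simp add: inner_sum_left skew[of _ "nabla _ w"] sum_negf)
    then have "(\<Sum>e\<in>B. nabla e w \<bullet> nabla e w) = 0" using that(3) by simp
    then show "nabla e w = 0" if "e \<in> B" for e
      using that B(1) by (subst (asm) sum_nonneg_eq_0_iff) auto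
  qed
  have "nabla z v = 0" if "z \<in> perp" for z
    by (rule vanish[OF that v]) (rule skew_self)
  then show ?thesis using vanish[OF x y] y by simp
qed

lemma nabla_commute:
  assumes "x \<in> perp" "y \<in> perp"
  shows "nabla x (nabla y w) = nabla y (nabla x w)"
  using flat[of x y w] torsion_free[of x y] nabla_perp_zero[OF assms] nabla_perp_zero[OF assms(2,1)]
  by (simp add: nabla_simps)

end

text \<open>As \<open>\<eta>\<close> of the bracket is minus the differential of the contact form,
  \<open>nondegenerate\<close> says that the form and its differential have no common kernel. A line
  with zero bracket satisfies the other conditions, hence \<open>dim_not_one\<close>.\<close>

locale flat_contact_algebra = flat_lie_algebra br nabla
  for br nabla :: "'g::euclidean_space \<Rightarrow> 'g \<Rightarrow> 'g" +
  fixes \<eta> :: "'g \<Rightarrow> real"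
  assumes linear_\<eta>: "linear \<eta>"
    and nondegenerate: "\<eta> x = 0 \<Longrightarrow> (\<And>y. \<eta> (br x y) = 0) \<Longrightarrow> x = 0"
    and dim_not_one: "DIM('g) \<noteq> 1"
begin

lemma e2_iso: "\<exists>H :: (real^2) \<times> real \<Rightarrow> 'g. linear H \<and> bij H \<and> (\<forall>u v. H (e2_bracket u v) = br (H u) (H v))"
proof -
  define h where "h = (\<Sum>i\<in>Basis. \<eta> i *\<^sub>R i)"
  have h: "\<eta> x = h \<bullet> x" for x
    using linear_eq_sum_Basis[OF linear_\<eta>, of x] by (simp add: h_def inner_sum_left inner_commute[of x] mult.commute)
  obtain \<xi> \<beta> where \<xi>: "\<xi> \<in> ker" and \<beta>: "\<beta> \<in> perp" "h = \<xi> + \<beta>" by (rule ker_perp_decomp)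
  have \<eta>_ker: "\<eta> u = \<xi> \<bullet> u" if "u \<in> ker" for u
    using that \<beta> by (simp add: h inner_simps perp_def)
  have br_anti: "br u v = - br v u" for u v
    by (metis torsion_free minus_diff_eq)
  \<comment> \<open>For \<open>u\<close> in \<open>ker\<close> the bracket of \<open>u\<close> and
    \<open>y\<close> is \<open>- nabla y u\<close>, and skewness moves \<open>nabla y\<close> over
    to \<open>\<xi>\<close>. So \<open>\<xi>\<close> and the vectors \<open>nabla x \<xi>\<close>
    span \<open>ker\<close>, and identities in \<open>ker\<close> can be tested against
    them.\<close>
  have ker_zero: "u = 0" if u: "u \<in> ker" "\<xi> \<bullet> u = 0" "\<And>x. x \<in> perp \<Longrightarrow> nabla x \<xi> \<bullet> u = 0" for u
  proof (rule nondegenerate)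
    show "\<eta> u = 0" using u \<eta>_ker by simp
    show "\<eta> (br u y) = 0" for y
    proof -
      obtain y1 y2 where y: "y1 \<in> ker" "y2 \<in> perp" "y = y1 + y2" by (rule ker_perp_decomp)
      have "\<eta> (br u y) = - (\<xi> \<bullet> nabla y u)"
        using u(1) by (simp add: br_anti[of u y] bracket_ker linear_neg[OF linear_\<eta>] \<eta>_ker ker_ideal)
      also have "\<dots> = nabla y \<xi> \<bullet> u" by (simp add: skew)
      also have "\<dots> = 0" using y u(3) by (simp add: nabla_simps nabla_ker)
      finally show ?thesis .
    qed
  qed
  have n\<xi>: "nabla x \<xi> \<in> ker" "\<xi> \<bullet> nabla x \<xi> = 0" for x
    using ker_ideal[OF \<xi>] skew_self by (auto simp: inner_commute)
  \<comment> \<open>If \<open>nabla x\<close> kills \<open>\<xi>\<close>, commutativity makes it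
    kill every \<open>nabla y \<xi>\<close>; by skewness its values on \<open>ker\<close> are
    orthogonal to all of these, hence zero. It vanishes on \<open>perp\<close> too, so
    \<open>x\<close> lies in \<open>ker\<close>.\<close>
  have inj: "x = 0" if x: "x \<in> perp" "nabla x \<xi> = 0" for x
  proof -
    have u0: "nabla x u = 0" if u: "u \<in> ker" for u
    proof (rule ker_zero[OF ker_ideal[OF u]])
      show "\<xi> \<bullet> nabla x u = 0" using skew[of x \<xi> u] x by simp
      show "nabla y \<xi> \<bullet> nabla x u = 0" if "y \<in> perp" for y
        using skew[of x "nabla y \<xi>" u] nabla_commute[OF x(1) that] x(2) by (simp add: nabla_simps)
    qed
    have "nabla x y = 0" for y
    proof -
      obtain y1 y2 where y: "y1 \<in> ker" "y2 \<in> perp" "y = y1 + y2" by (rule ker_perp_decomp)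
      then show ?thesis using u0 nabla_perp_zero[OF x(1)] by (simp add: nabla_simps)
    qed
    then have "x \<in> ker" by (simp add: ker_def)
    then show ?thesis using ker_perp_trivial x(1) by blast
  qed
  \<comment> \<open>symmetric in the first two arguments and antisymmetric in the last two\<close>
  have tri: "nabla x (nabla y \<xi>) \<bullet> nabla z \<xi> = 0" if "x \<in> perp" "y \<in> perp" "z \<in> perp" for x y z
  proof -
    have s: "nabla a (nabla b \<xi>) \<bullet> c = nabla b (nabla a \<xi>) \<bullet> c" if "a \<in> perp" "b \<in> perp" for a b c
      using nabla_commute[OF that] by simp
    have a: "nabla a (nabla b \<xi>) \<bullet> nabla c \<xi> = - (nabla a (nabla c \<xi>) \<bullet> nabla b \<xi>)" for a b c
      using skew[of a "nabla b \<xi>" "nabla c \<xi>"] inner_commute[of "nabla b \<xi>" "nabla a (nabla c \<xi>)"] by simp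
    show ?thesis
      using s[OF that(1,2), of "nabla z \<xi>"] s[OF that(2,3), of "nabla x \<xi>"] s[OF that(3,1), of "nabla y \<xi>"]
        a[of x y z] a[of y z x] a[of z x y]
      by linarith
  qed
  \<comment> \<open>The vector is orthogonal to every \<open>nabla z \<xi>\<close> by
    \<open>tri\<close>, and to \<open>\<xi>\<close> by skewness and the assumed
    orthogonality.\<close>
  have orth: "nabla x (nabla y \<xi>) = 0" if "x \<in> perp" "y \<in> perp" "nabla x \<xi> \<bullet> nabla y \<xi> = 0" for x y
  proof (rule ker_zero[OF ker_ideal[OF n\<xi>(1)]])
    show "\<xi> \<bullet> nabla x (nabla y \<xi>) = 0" using skew[of x \<xi> "nabla y \<xi>"] that(3) by simp
    show "nabla z \<xi> \<bullet> nabla x (nabla y \<xi>) = 0" if "z \<in> perp" for z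
      using tri \<open>x \<in> perp\<close> \<open>y \<in> perp\<close> that by (simp add: inner_commute)
  qed
  \<comment> \<open>If \<open>perp\<close> were zero, only the zero vector would be orthogonal to
    \<open>\<xi>\<close>; but two distinct basis vectors have a nonzero combination orthogonal to
    it.\<close>
  have "\<exists>b\<in>perp. b \<noteq> 0"
  proof (rule ccontr)
    assume "\<not> (\<exists>b\<in>perp. b \<noteq> 0)"
    then have perp0: "x = 0" if "x \<in> perp" for x using that by blast
    have all_ker: "u \<in> ker" for u
      using ker_perp_decomp[of u] perp0 by (metis add.right_neutral)
    have all0: "u = 0" if "\<xi> \<bullet> u = 0" for u
      by (rule ker_zero[OF all_ker that]) (simp add: nabla_ker[OF all_ker])
    obtain i :: 'g where i: "i \<in> Basis" using nonempty_Basis by blast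
    have "(Basis :: 'g set) \<noteq> {i}" using dim_not_one by (metis card_1_singleton_iff One_nat_def)
    then obtain j where ij: "i \<in> Basis" "j \<in> Basis" "i \<noteq> j" using i by blast
    have 0: "(\<xi> \<bullet> j) *\<^sub>R i - (\<xi> \<bullet> i) *\<^sub>R j = 0" by (rule all0) (simp add: inner_simps)
    have "((\<xi> \<bullet> j) *\<^sub>R i - (\<xi> \<bullet> i) *\<^sub>R j) \<bullet> i = \<xi> \<bullet> j" using ij by (simp add: inner_simps inner_Basis)
    with 0 have "\<xi> \<bullet> j = 0" by simp
    then have "j = 0" by (rule all0)
    then show False using ij(2) by simp
  qed
  then obtain b where b: "b \<in> perp" "b \<noteq> 0" by blast
  define \<zeta> where "\<zeta> = nabla b \<xi>"
  have \<zeta>: "\<zeta> \<in> ker" "\<xi> \<bullet> \<zeta> = 0" "\<zeta> \<noteq> 0" using n\<xi> inj[OF b(1)] b(2) by (auto simp: \<zeta>_def)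
  have \<xi>0: "\<xi> \<noteq> 0" using \<zeta>(3) by (auto simp: \<zeta>_def nabla_simps)
  have pos: "\<xi> \<bullet> \<xi> > 0" "\<zeta> \<bullet> \<zeta> > 0" using \<xi>0 \<zeta>(3) by simp_all
  \<comment> \<open>Makes \<open>nabla b \<zeta> + c *\<^sub>R \<xi>\<close> orthogonal to
    \<open>\<xi>\<close>, since by skewness \<open>\<xi> \<bullet> nabla b \<zeta>\<close> equals
    \<open>- (\<zeta> \<bullet> \<zeta>)\<close>.\<close>
  define c where "c = (\<zeta> \<bullet> \<zeta>) / (\<xi> \<bullet> \<xi>)"
  have c: "c > 0" using pos by (simp add: c_def)
  have nb\<zeta>: "nabla b \<zeta> = - c *\<^sub>R \<xi>"
  proof -
    have "nabla b \<zeta> + c *\<^sub>R \<xi> = 0"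
    proof (rule ker_zero)
      show "nabla b \<zeta> + c *\<^sub>R \<xi> \<in> ker"
        using \<xi> \<zeta>(1) by (intro subspace_add[OF subspace_ker] subspace_scale[OF subspace_ker] ker_ideal)
      show "\<xi> \<bullet> (nabla b \<zeta> + c *\<^sub>R \<xi>) = 0"
        using skew[of b \<xi> \<zeta>] pos by (simp add: inner_simps c_def \<zeta>_def[symmetric])
      show "nabla x \<xi> \<bullet> (nabla b \<zeta> + c *\<^sub>R \<xi>) = 0" if "x \<in> perp" for x
        using tri[OF b(1) b(1) that] n\<xi>(2)[of x] by (simp add: inner_simps \<zeta>_def inner_commute)
    qed
    then show ?thesis by (simp add: eq_neg_iff_add_eq_0)
  qed
  have perp_span: "\<exists>s. y = s *\<^sub>R b" if y: "y \<in> perp" for y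
  proof -
    \<comment> \<open>Subtracting \<open>s *\<^sub>R b\<close> makes \<open>nabla y' \<xi>\<close>
      orthogonal to \<open>\<zeta>\<close>, so that \<open>orth\<close> applies. One more
      \<open>nabla b\<close>, commuted to the inside, yields \<open>- c\<close> times
      \<open>nabla y' \<xi>\<close>, and \<open>inj\<close> finishes.\<close>
    define s where "s = (nabla y \<xi> \<bullet> \<zeta>) / (\<zeta> \<bullet> \<zeta>)"
    define y' where "y' = y - s *\<^sub>R b"
    have y': "y' \<in> perp" unfolding y'_def using y b(1) subspace_perp by (intro subspace_diff subspace_scale)
    have o: "nabla b \<xi> \<bullet> nabla y' \<xi> = 0"
      using pos by (simp add: y'_def nabla_simps inner_simps \<zeta>_def[symmetric] s_def inner_commute)
    have "nabla b (nabla b (nabla y' \<xi>)) = 0" using orth[OF b(1) y' o] by (simp add: nabla_simps)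
    moreover have "nabla b (nabla b (nabla y' \<xi>)) = nabla y' (nabla b \<zeta>)"
      by (simp add: \<zeta>_def nabla_commute[OF b(1) y'])
    ultimately have "nabla y' \<xi> = 0" using c by (simp add: nb\<zeta> nabla_simps)
    then have "y' = 0" by (rule inj[OF y'])
    then show ?thesis by (auto simp: y'_def)
  qed
  have ker_span: "u = ((u \<bullet> \<xi>) / (\<xi> \<bullet> \<xi>)) *\<^sub>R \<xi> + ((u \<bullet> \<zeta>) / (\<zeta> \<bullet> \<zeta>)) *\<^sub>R \<zeta>" (is "u = ?v") if u: "u \<in> ker" for u
  proof -
    have "u - ?v = 0"
    proof (rule ker_zero)
      show "u - ?v \<in> ker" using u \<xi> \<zeta>(1) subspace_ker by (intro subspace_diff subspace_add subspace_scale)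
      show "\<xi> \<bullet> (u - ?v) = 0" using pos \<zeta>(2) by (simp add: inner_simps inner_commute)
      have "\<zeta> \<bullet> (u - ?v) = 0" using pos \<zeta>(2) by (simp add: inner_simps inner_commute)
      then show "nabla x \<xi> \<bullet> (u - ?v) = 0" if "x \<in> perp" for x
        using perp_span[OF that] by (auto simp: nabla_simps \<zeta>_def)
    qed
    then show ?thesis by simp
  qed
  \<comment> \<open>On the plane of \<open>\<xi>\<close> and \<open>\<zeta>\<close> the square of
    \<open>nabla b\<close> is \<open>- c\<close>. Dividing \<open>b\<close> and
    \<open>\<zeta>\<close> by \<open>k\<close> normalises it to a
    \<open>quarter_turn\<close>.\<close>
  define k where "k = sqrt c"
  have k: "k > 0" "k * k = c" using c by (simp_all add: k_def)
  define H :: "(real^2) \<times> real \<Rightarrow> 'g" where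
    "H u = fst u $ 1 *\<^sub>R \<xi> + (fst u $ 2 / k) *\<^sub>R \<zeta> + (snd u / k) *\<^sub>R b" for u
  have H: "linear H"
    by (rule linearI) (simp_all add: H_def algebra_simps add_divide_distrib)
  have nabla_b: "nabla b b = 0" using nabla_perp_zero[OF b(1) b(1)] .
  have brH: "H (e2_bracket u v) = br (H u) (H v)" for u v
  proof -
    have n: "nabla (H u) (H v) = (snd u * fst v $ 1 / k) *\<^sub>R \<zeta> - (snd u * fst v $ 2) *\<^sub>R \<xi>" for u v
      using c by (simp add: H_def nabla_simps nabla_ker[OF \<xi>] nabla_ker[OF \<zeta>(1)] nabla_b nb\<zeta> \<zeta>_def[symmetric]
          k(2) mult.commute)
    show ?thesis
      unfolding torsion_free[symmetric] n
      by (simp add: H_def e2_bracket_def quarter_turn_def vector_2 algebra_simps diff_divide_distrib add_divide_distrib)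
  qed
  have ob: "b \<bullet> \<xi> = 0" "b \<bullet> \<zeta> = 0" using b(1) \<xi> \<zeta>(1) by (auto simp: perp_def)
  have "inj H"
    unfolding linear_injective_0[OF H]
  proof (intro allI impI)
    fix u assume 0: "H u = 0"
    have "H u \<bullet> \<xi> = fst u $ 1 * (\<xi> \<bullet> \<xi>)" "H u \<bullet> \<zeta> = fst u $ 2 / k * (\<zeta> \<bullet> \<zeta>)" "H u \<bullet> b = snd u / k * (b \<bullet> b)"
      using ob \<zeta>(2) by (simp_all add: H_def inner_simps inner_commute)
    then have "fst u $ 1 = 0" "fst u $ 2 = 0" "snd u = 0" using 0 pos k b(2) by auto
    then show "u = 0" by (simp add: prod_eq_iff vec_eq_iff forall_2)
  qed
  moreover have "surj H"
  proof -
    have "\<exists>u. H u = y" for y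
    proof -
    obtain y1 y2 where y: "y1 \<in> ker" "y2 \<in> perp" "y = y1 + y2" by (rule ker_perp_decomp)
    obtain s where s: "y2 = s *\<^sub>R b" using perp_span[OF y(2)] by blast
    obtain p q where pq: "y1 = p *\<^sub>R \<xi> + q *\<^sub>R \<zeta>" using ker_span[OF y(1)] by blast
    show "\<exists>u. H u = y"
      by (rule exI[of _ "(vector [p, k * q], k * s)"]) (use k in \<open>simp add: H_def y s pq vector_2\<close>)
    qed
    then show ?thesis by (metis surjI)
  qed
  ultimately have "bij H" by (simp add: bij_def)
  then show ?thesis using H brH by blast
qed

end

section \<open>Multilinear and contact forms\<close>

definition multilinear_form :: "nat \<Rightarrow> 'e::real_vector form \<Rightarrow> bool" where
  "multilinear_form k \<alpha> \<longleftrightarrow> (\<forall>v w. (\<forall>i<k. v i = w i) \<longrightarrow> \<alpha> v = \<alpha> w) \<and>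
     (\<forall>j<k. \<forall>v. linear (\<lambda>a. \<alpha> (v(j := a))))"

lemma multilinear_formD:
  assumes "multilinear_form k \<alpha>"
  shows "(\<And>i. i < k \<Longrightarrow> v i = w i) \<Longrightarrow> \<alpha> v = \<alpha> w" and "j < k \<Longrightarrow> linear (\<lambda>a. \<alpha> (v(j := a)))"
  using assms by (auto simp: multilinear_form_def)

lemma linear_real_scale:
  fixes f :: "'e::real_vector \<Rightarrow> real"
  assumes "linear f"
  shows "linear (\<lambda>a. c * f a * d)" "linear (\<lambda>a. c * d * f a)"
  by (auto intro!: linearI simp: linear_add[OF assms] linear_cmul[OF assms] algebra_simps)

text \<open>Each summand reads slot \<open>j\<close> exactly once, through \<open>\<alpha>\<close>
  or through \<open>\<beta>\<close> according to the block in which the preimage of \<open>j\<close>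
  under \<open>\<sigma>\<close> lies.\<close>

lemma multilinear_wedge:
  assumes \<alpha>: "multilinear_form k \<alpha>" and \<beta>: "multilinear_form l \<beta>"
  shows "multilinear_form (k + l) (wedge k l \<alpha> \<beta>)"
  unfolding multilinear_form_def
proof (intro conjI allI impI)
  fix v w :: "nat \<Rightarrow> 'a" assume vw: "\<forall>i<k + l. v i = w i"
  have "\<alpha> (\<lambda>i. v (\<sigma> i)) = \<alpha> (\<lambda>i. w (\<sigma> i))" "\<beta> (\<lambda>i. v (\<sigma> (k + i))) = \<beta> (\<lambda>i. w (\<sigma> (k + i)))"
    if "\<sigma> permutes {..<k + l}" for \<sigma>
  proof -
    have "\<sigma> i < k + l" if "i < k + l" for i
      using permutes_in_image[OF \<open>\<sigma> permutes {..<k + l}\<close>, of i] that by simp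
    then show "\<alpha> (\<lambda>i. v (\<sigma> i)) = \<alpha> (\<lambda>i. w (\<sigma> i))" "\<beta> (\<lambda>i. v (\<sigma> (k + i))) = \<beta> (\<lambda>i. w (\<sigma> (k + i)))"
      using vw by (auto intro!: multilinear_formD(1)[OF \<alpha>] multilinear_formD(1)[OF \<beta>])
  qed
  then show "wedge k l \<alpha> \<beta> v = wedge k l \<alpha> \<beta> w"
    unfolding wedge_def by (intro arg_cong2[where f = "(/)"] sum.cong refl) simp
next
  fix j v assume j: "j < k + l"
  have lin: "linear (\<lambda>a. of_int (sign \<sigma>) * \<alpha> (\<lambda>i. (v(j := a)) (\<sigma> i)) * \<beta> (\<lambda>i. (v(j := a)) (\<sigma> (k + i))))"
    if \<sigma>: "\<sigma> permutes {..<k + l}" for \<sigma>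
  proof -
    obtain p where p: "\<sigma> p = j" "p < k + l"
      using permutes_image[OF \<sigma>] j by (metis (no_types, lifting) imageE lessThan_iff)
    have \<sigma>_eq: "\<sigma> i = j \<longleftrightarrow> i = p" for i using permutes_inj[OF \<sigma>] p(1) by (auto dest: injD)
    show ?thesis
    proof (cases "p < k")
      case True
      have 1: "(\<lambda>i. (v(j := a)) (\<sigma> i)) = (\<lambda>i. v (\<sigma> i))(p := a)" for a
        using p(1) by (auto simp: fun_eq_iff \<sigma>_eq)
      have 2: "(\<lambda>i. (v(j := a)) (\<sigma> (k + i))) = (\<lambda>i. v (\<sigma> (k + i)))" for a
        using True by (auto simp: fun_eq_iff \<sigma>_eq)
      show ?thesis unfolding 1 2
        by (rule linear_real_scale(1)[OF multilinear_formD(2)[OF \<alpha> True]])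
    next
      case False
      then obtain p' where p': "p = k + p'" "p' < l" using p(2) by (metis add_less_cancel_left le_Suc_ex linorder_not_less)
      have 1: "\<alpha> (\<lambda>i. (v(j := a)) (\<sigma> i)) = \<alpha> (\<lambda>i. v (\<sigma> i))" for a
        by (rule multilinear_formD(1)[OF \<alpha>]) (use False in \<open>auto simp: \<sigma>_eq\<close>)
      have 2: "(\<lambda>i. (v(j := a)) (\<sigma> (k + i))) = (\<lambda>i. v (\<sigma> (k + i)))(p' := a)" for a
        using p(1) p'(1) by (auto simp: fun_eq_iff \<sigma>_eq)
      show ?thesis unfolding 1 2
        by (rule linear_real_scale(2)[OF multilinear_formD(2)[OF \<beta> p'(2)]])
    qed
  qed
  have "linear (\<lambda>a. \<Sum>\<sigma> | \<sigma> permutes {..<k + l}. of_int (sign \<sigma>) * \<alpha> (\<lambda>i. (v(j := a)) (\<sigma> i)) * \<beta> (\<lambda>i. (v(j := a)) (\<sigma> (k + i))))"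
    by (rule linear_compose_sum) (use lin in blast)
  then have "linear (\<lambda>a. (1 / (fact k * fact l)) *\<^sub>R (\<Sum>\<sigma> | \<sigma> permutes {..<k + l}.
      of_int (sign \<sigma>) * \<alpha> (\<lambda>i. (v(j := a)) (\<sigma> i)) * \<beta> (\<lambda>i. (v(j := a)) (\<sigma> (k + i)))))"
    by (rule linear_compose_scale_right)
  then show "linear (\<lambda>a. wedge k l \<alpha> \<beta> (v(j := a)))" by (simp add: wedge_def)
qed

text \<open>Composing \<open>\<sigma>\<close> with the transposition of \<open>i\<close> and
  \<open>j\<close> flips the sign of a summand but not its arguments, because \<open>v\<close>
  agrees at the two places.\<close>

lemma wedge_alternating:
  assumes ij: "i \<noteq> j" "i < k + l" "j < k + l" and v: "v i = v j"
  shows "wedge k l \<alpha> \<beta> v = 0"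
proof -
  let ?\<tau> = "Transposition.transpose i j"
  let ?f = "\<lambda>\<sigma>. of_int (sign \<sigma>) * \<alpha> (\<lambda>i. v (\<sigma> i)) * \<beta> (\<lambda>i. v (\<sigma> (k + i)))"
  have \<tau>: "?\<tau> permutes {..<k + l}" using ij by (intro permutes_swap_id) auto
  have v\<tau>: "v (?\<tau> a) = v a" for a using v by (simp add: Transposition.transpose_def)
  have "?f (?\<tau> \<circ> \<sigma>) = - ?f \<sigma>" if "\<sigma> permutes {..<k + l}" for \<sigma>
  proof -
    have "sign (?\<tau> \<circ> \<sigma>) = - sign \<sigma>"
      using that \<tau> ij(1) permutation_permutes[of \<sigma>] permutation_permutes[of ?\<tau>]
      by (subst sign_compose) (auto simp: sign_swap_id)
    then show ?thesis by (simp add: v\<tau>)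
  qed
  then have "(\<Sum>\<sigma> | \<sigma> permutes {..<k + l}. ?f (?\<tau> \<circ> \<sigma>)) = - (\<Sum>\<sigma> | \<sigma> permutes {..<k + l}. ?f \<sigma>)"
    unfolding sum_negf[symmetric] by (intro sum.cong refl) blast
  moreover have "(\<Sum>\<sigma> | \<sigma> permutes {..<k + l}. ?f \<sigma>) = (\<Sum>\<sigma> | \<sigma> permutes {..<k + l}. ?f (?\<tau> \<circ> \<sigma>))"
    by (rule sum.reindex_bij_witness[where i = "\<lambda>\<sigma>. ?\<tau> \<circ> \<sigma>" and j = "\<lambda>\<sigma>. ?\<tau> \<circ> \<sigma>"])
      (use permutes_compose[OF _ \<tau>] in \<open>simp_all add: o_assoc\<close>)
  ultimately have "(\<Sum>\<sigma> | \<sigma> permutes {..<k + l}. ?f \<sigma>) = 0" by linarith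
  then show ?thesis by (simp add: wedge_def)
qed

lemma permutes_preimage_less:
  fixes i N :: nat
  assumes "\<sigma> permutes {..<N}" "i < N"
  obtains p where "\<sigma> p = i" "p < N"
  using permutes_image[OF assms(1)] assms(2) by (metis (no_types, lifting) imageE lessThan_iff)

text \<open>In every summand \<open>x\<close> is fed either to the last factor
  \<open>\<omega>\<close> or to the lower power, where induction applies.\<close>

lemma wedge_power_vanish:
  assumes "\<And>y. \<omega> x y = 0" "\<And>y. \<omega> y x = 0"
  shows "i < 2 * n \<Longrightarrow> v i = x \<Longrightarrow> wedge_power n (\<lambda>v. \<omega> (v 0) (v 1)) v = 0"
proof (induction n arbitrary: v i)
  case 0
  then show ?case by simp
next
  case (Suc n)
  have "wedge_power n (\<lambda>v. \<omega> (v 0) (v 1)) (\<lambda>i. v (\<sigma> i)) * \<omega> (v (\<sigma> (2 * n + 0))) (v (\<sigma> (2 * n + 1))) = 0"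
    if \<sigma>: "\<sigma> permutes {..<2 * n + 2}" for \<sigma>
  proof -
    obtain p where p: "\<sigma> p = i" "p < 2 * n + 2"
      by (rule permutes_preimage_less[OF \<sigma>, of i]) (use Suc.prems(1) in auto)
    then consider "p < 2 * n" | "p = 2 * n" | "p = 2 * n + 1" by linarith
    then show ?thesis
      by cases (use Suc.IH[of p "\<lambda>i. v (\<sigma> i)"] Suc.prems p assms in simp_all)
  qed
  then show ?case by (auto simp: wedge_def mult.assoc intro!: sum.neutral)
qed

text \<open>The volume form vanishes as soon as \<open>x\<close> stands in a slot. Vectors on which
  it is nonzero form a basis, and putting \<open>x\<close> into slot \<open>j\<close> returns a
  nonzero multiple of its \<open>j\<close>-th coefficient.\<close>

lemma contact_form_nondegenerate:
  fixes x :: "'e::euclidean_space"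
  assumes dim: "DIM('e) = 2 * n + 1" and \<omega>: "bilinear \<omega>" and anti: "\<And>u v. \<omega> u v = - \<omega> v u" and \<eta>: "linear \<eta>"
    and vol: "wedge (2 * n) 1 (wedge_power n (\<lambda>v. \<omega> (v 0) (v 1))) (\<lambda>v. \<eta> (v 0)) \<noteq> (\<lambda>_. 0)"
    and x: "\<eta> x = 0" "\<And>y. \<omega> x y = 0"
  shows "x = 0"
proof -
  let ?N = "2 * n + 1"
  define \<Omega> where "\<Omega> = wedge (2 * n) 1 (wedge_power n (\<lambda>v. \<omega> (v 0) (v 1))) (\<lambda>v. \<eta> (v 0))"
  have lin: "linear (\<omega> a)" "linear (\<lambda>a. \<omega> a b)" for a b using \<omega> by (simp_all add: bilinear_def)
  have "linear (\<lambda>a. \<omega> ((v(j := a)) 0) ((v(j := a)) 1))" if "j < 2" for j and v :: "nat \<Rightarrow> 'e"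
  proof -
    consider "j = 0" | "j = 1" using \<open>j < 2\<close> by linarith
    then show ?thesis by cases (use lin in simp_all)
  qed
  then have 2: "multilinear_form 2 (\<lambda>v. \<omega> (v 0) (v 1))" by (simp add: multilinear_form_def)
  have 1: "multilinear_form 1 (\<lambda>v. \<eta> (v 0))" using \<eta> by (simp add: multilinear_form_def)
  have power: "multilinear_form (2 * n) (wedge_power n (\<lambda>v. \<omega> (v 0) (v 1)))" for n
  proof (induction n)
    case 0
    then show ?case by (simp add: multilinear_form_def)
  next
    case (Suc n)
    then show ?case using multilinear_wedge[OF Suc 2] by simp
  qed
  have \<Omega>: "multilinear_form ?N \<Omega>" unfolding \<Omega>_def by (rule multilinear_wedge[OF power 1])
  have alt: "\<Omega> v = 0" if "i \<noteq> j" "i < ?N" "j < ?N" "v i = v j" for v i j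
    unfolding \<Omega>_def by (rule wedge_alternating[OF that])
  have vanish: "\<Omega> v = 0" if i: "i < ?N" "v i = x" for v i
  proof -
    have "wedge_power n (\<lambda>v. \<omega> (v 0) (v 1)) (\<lambda>i. v (\<sigma> i)) * \<eta> (v (\<sigma> (2 * n + 0))) = 0"
      if \<sigma>: "\<sigma> permutes {..<?N}" for \<sigma>
    proof -
      obtain p where p: "\<sigma> p = i" "p < ?N" by (rule permutes_preimage_less[OF \<sigma> i(1)])
      then consider "p < 2 * n" | "p = 2 * n" by linarith
      then show ?thesis
      proof cases
        case 1
        have "\<omega> y x = 0" for y using anti[of y x] x(2) by simp
        from wedge_power_vanish[of \<omega> x p n "\<lambda>i. v (\<sigma> i)", OF x(2) this 1] show ?thesis using i p by simp
      qed (use i p x in simp)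
    qed
    then show ?thesis by (auto simp: \<Omega>_def wedge_def mult.assoc intro!: sum.neutral)
  qed
  obtain v where v: "\<Omega> v \<noteq> 0" using vol unfolding \<Omega>_def by blast
  have slot: "linear (\<lambda>a. \<Omega> (v(j := a)))" if "j < ?N" for j using multilinear_formD(2)[OF \<Omega> that] .
  have other: "\<Omega> (v(j := v i)) = 0" if "i \<noteq> j" "i < ?N" "j < ?N" for i j
    by (rule alt[OF that]) (use that in simp)
  have notin: "v j \<notin> span (v ` ({..<?N} - {j}))" if j: "j < ?N" for j
  proof
    assume "v j \<in> span (v ` ({..<?N} - {j}))"
    then have "\<Omega> (v(j := v j)) = 0"
      by (rule linear_eq_0_on_span[OF slot[OF j], rotated]) (use other j in auto)
    then show False using v by simp
  qed
  have inj: "inj_on v {..<?N}"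
  proof (rule inj_onI)
    fix i j assume ij: "i \<in> {..<?N}" "j \<in> {..<?N}" "v i = v j"
    show "i = j"
    proof (rule ccontr)
      assume "i \<noteq> j"
      then have "v j \<in> span (v ` ({..<?N} - {j}))" using ij by (metis Diff_iff imageI singletonD span_base)
      then show False using notin ij by blast
    qed
  qed
  have "independent (v ` {..<?N})"
    unfolding dependent_def
  proof
    assume "\<exists>a\<in>v ` {..<?N}. a \<in> span (v ` {..<?N} - {a})"
    then obtain j where j: "j < ?N" "v j \<in> span (v ` {..<?N} - {v j})" by auto
    have "v ` {..<?N} - {v j} \<subseteq> v ` ({..<?N} - {j})" by auto
    then show False using notin[OF j(1)] j(2) span_mono by blast
  qed
  moreover have "card (v ` {..<?N}) = DIM('e)" using card_image[OF inj] dim by simp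
  ultimately have "UNIV \<subseteq> span (v ` {..<?N})"
    by (intro card_ge_dim_independent) simp_all
  then have "x \<in> span (v ` {..<?N})" by blast
  then obtain u where u: "x = (\<Sum>a\<in>v ` {..<?N}. u a *\<^sub>R a)" by (auto simp: span_finite)
  have u': "x = (\<Sum>i<?N. u (v i) *\<^sub>R v i)" unfolding u sum.reindex[OF inj] by (simp add: o_def del: sum.lessThan_Suc)
  have "u (v j) = 0" if j: "j < ?N" for j
  proof -
    have "0 = \<Omega> (v(j := x))" by (rule vanish[symmetric, OF j]) simp
    also have "\<dots> = (\<Sum>i<?N. u (v i) * \<Omega> (v(j := v i)))"
      using linear_sum[OF slot[OF j], of "\<lambda>i. u (v i) *\<^sub>R v i" "{..<?N}"]
      unfolding u'[symmetric] linear_cmul[OF slot[OF j]] by simp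
    also have "\<dots> = (\<Sum>i<?N. if i = j then u (v j) * \<Omega> v else 0)"
      by (intro sum.cong refl) (use other j in auto)
    also have "\<dots> = u (v j) * \<Omega> v" using j by simp
    finally show ?thesis using v by simp
  qed
  then show "x = 0" unfolding u' by simp
qed

section \<open>The Lie algebra of the group of rigid motions\<close>

lemma rot_mult_vec: "rot t *v w = cos t *\<^sub>R w + sin t *\<^sub>R quarter_turn w"
  by (simp add: rot_def quarter_turn_def vec_eq_iff forall_2 matrix_vector_mult_def sum_2 vector_2)

lemma rot_add: "rot s ** rot t = rot (s + t)"
  by (simp add: rot_def vec_eq_iff forall_2 matrix_matrix_mult_def sum_2 vector_2 cos_add sin_add algebra_simps)

lemma rot_zero: "rot 0 = mat 1"
  by (simp add: rot_def vec_eq_iff forall_2 mat_def vector_2)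

lemma orthogonal_rot: "orthogonal_matrix (rot t)"
proof -
  have "transpose (rot t) = rot (- t)"
    by (simp add: rot_def vec_eq_iff forall_2 Finite_Cartesian_Product.transpose_def vector_2)
  then show ?thesis by (simp add: orthogonal_matrix_def rot_add rot_zero)
qed

lemma rot_inj:
  assumes "rot s = rot t" "s \<in> {-pi<..<pi}" "t \<in> {-pi<..<pi}"
  shows "s = t"
proof -
  have "sin s = sin t" "cos s = cos t"
    using assms(1) by (auto simp: rot_def vec_eq_iff forall_2 vector_2)
  then obtain n :: int where n: "s = t + 2 * pi * n"
    by (metis sin_cos_eq_iff)
  have "\<bar>2 * pi * n\<bar> < 2 * pi" using assms(2,3) n by auto
  then have "\<bar>real_of_int n\<bar> < 1" using pi_gt_zero by (simp add: abs_mult)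
  then have "n = 0" by linarith
  then show ?thesis using n by simp
qed

abbreviation "E2_dom \<equiv> (UNIV :: (real^2) set) \<times> {-pi<..<pi}"

lemma inj_on_E2_param:
  assumes A: "orthogonal_matrix A"
  shows "inj_on (E2_param A) E2_dom"
proof (rule inj_onI)
  fix x y assume xy: "x \<in> E2_dom" "y \<in> E2_dom" "E2_param A x = E2_param A y"
  obtain b s where x: "x = (b, s)" by (cases x)
  obtain c t where y: "y = (c, t)" by (cases y)
  have "rot s ** A ** transpose A = rot t ** A ** transpose A" "b = c"
    using xy(3) by (simp_all add: x y E2_param_def)
  then have "rot s = rot t" "b = c" using A by (simp_all add: orthogonal_matrix_def matrix_mul_assoc[symmetric])
  then show "x = y" using rot_inj xy(1,2) by (auto simp: x y)
qed

context
  fixes A :: "real^2^2" assumes A: "orthogonal_matrix A"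
begin

lemma fst_E2_chart: "fst (E2_chart A) = E2_param A ` E2_dom"
  by (simp add: E2_chart_def)

lemma snd_E2_chart: "z \<in> E2_dom \<Longrightarrow> snd (E2_chart A) (E2_param A z) = z"
  by (simp only: E2_chart_def snd_conv inv_into_f_f[OF inj_on_E2_param[OF A]])

lemma E2_chart_inj: "inj_on (snd (E2_chart A)) (fst (E2_chart A))"
  by (simp add: E2_chart_def inj_on_inv_into)

lemma E2_chart_inv: "z \<in> E2_dom \<Longrightarrow> chart_inv (E2_chart A) z = E2_param A z"
  using chart_inv_snd[OF E2_chart_inj, of "E2_param A z"] snd_E2_chart[of z]
  by (simp add: fst_E2_chart)

end

lemma open_E2_dom: "open E2_dom"
  by (intro open_Times) auto

text \<open>Translation by a motion without reflection is affine in these charts near the base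
  point. The angles are measured from different matrices \<open>A\<close> and \<open>B\<close>, so
  the shift \<open>t' - t\<close> is read off at the base point.\<close>

lemma E2_chart_derivative:
  assumes A: "orthogonal_matrix A" and B: "orthogonal_matrix B" and bt: "(b, t) \<in> E2_dom"
    and q: "(a, rot s) \<otimes>\<^bsub>E2\<^esub> E2_param A (b, t) = E2_param B (b', t')" and bt': "(b', t') \<in> E2_dom"
  shows "has_chart_derivative (E2_chart A) (E2_chart B) (\<lambda>h. (a, rot s) \<otimes>\<^bsub>E2\<^esub> h) (E2_param A (b, t))
    (\<lambda>(w, r). (rot s *v w, r))"
proof -
  let ?f = "\<lambda>(w, r). (a + rot s *v w, r - t + t')"
  have rotq: "rot (s + t) ** A = rot t' ** B"
    using q by (simp add: E2_def E2_param_def matrix_mul_assoc rot_add)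
  have param: "(a, rot s) \<otimes>\<^bsub>E2\<^esub> E2_param A (w, r) = E2_param B (?f (w, r))" for w r
  proof -
    have "rot (s + r) ** A = rot (r - t) ** (rot (s + t) ** A)"
      by (simp add: matrix_mul_assoc rot_add add.commute)
    also have "\<dots> = rot (r - t + t') ** B" unfolding rotq by (simp add: matrix_mul_assoc rot_add)
    finally show ?thesis by (simp add: E2_def E2_param_def matrix_mul_assoc rot_add)
  qed
  \<comment> \<open>The part of the chart where the shifted angle stays in the range of the target
    chart.\<close>
  define W where "W = E2_dom \<inter> (\<lambda>z. snd z - t + t') -` {-pi<..<pi}"
  have W: "open W" "(b, t) \<in> W"
    unfolding W_def using bt bt' by (auto intro!: open_Int open_E2_dom open_vimage continuous_intros)
  have inW: "?f z \<in> E2_dom" "z \<in> E2_dom" if "z \<in> W" for z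
    using that by (auto simp: W_def)
  have eq: "(a, rot s) \<otimes>\<^bsub>E2\<^esub> chart_inv (E2_chart A) z = E2_param B (?f z)" if "z \<in> W" for z
    using E2_chart_inv[OF A inW(2)[OF that]] param[of "fst z" "snd z"] by simp
  have coord: "snd (E2_chart A) (E2_param A (b, t)) = (b, t)" using snd_E2_chart[OF A bt] .
  show ?thesis
    unfolding has_chart_derivative_def coord
  proof (intro conjI)
    show "E2_param A (b, t) \<in> fst (E2_chart A)" using bt by (simp add: fst_E2_chart[OF A] del: mem_Times_iff)
    have "(a, rot s) \<otimes>\<^bsub>E2\<^esub> chart_inv (E2_chart A) z \<in> fst (E2_chart B)" if "z \<in> W" for z
      unfolding eq[OF that] fst_E2_chart[OF B] using inW(1)[OF that] by (rule imageI)
    then show "\<forall>\<^sub>F z in nhds (b, t). (a, rot s) \<otimes>\<^bsub>E2\<^esub> chart_inv (E2_chart A) z \<in> fst (E2_chart B)"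
      using eventually_nhds_in_open[OF W] by (rule eventually_mono[rotated])
    have "((\<lambda>z. (a + rot s *v fst z, snd z - t + t')) has_derivative (\<lambda>z. (rot s *v fst z, snd z))) (at (b, t))"
      by (auto intro!: derivative_eq_intros bounded_linear.has_derivative[OF matrix_vector_mul_bounded_linear])
    then show "((\<lambda>z. snd (E2_chart B) ((a, rot s) \<otimes>\<^bsub>E2\<^esub> chart_inv (E2_chart A) z)) has_derivative
        (\<lambda>(w, r). (rot s *v w, r))) (at (b, t))"
      unfolding case_prod_beta
      by (rule has_derivative_transform_within_open[OF _ W])
        (use inW(1) in \<open>simp add: eq snd_E2_chart[OF B] case_prod_beta\<close>)
  qed
qed

lemma E2_one_mult: "\<one>\<^bsub>E2\<^esub> = (0, rot 0)" "(0, rot 0) \<otimes>\<^bsub>E2\<^esub> h = h"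
  by (simp_all add: E2_def rot_zero split: prod.split)

text \<open>The choice made by \<open>chart_at\<close> cannot be computed, so the reference matrix
  \<open>B\<close> remains unknown and the later calculation has to work for any.\<close>

lemma chart_at_E2:
  assumes C: "orthogonal_matrix C"
  obtains B z where "orthogonal_matrix B" "chart_at E2 (b, C) = E2_chart B" "z \<in> E2_dom" "(b, C) = E2_param B z"
proof -
  have "(b, C) = E2_param C (b, 0)" by (simp add: E2_param_def rot_zero)
  then have "(b, C) \<in> fst (E2_chart C)" using pi_gt_zero by (auto simp: E2_chart_def)
  moreover have atlas: "atlas E2 = {E2_chart A | A. orthogonal_matrix A}" by (simp add: E2_def)
  ultimately have "\<exists>c. c \<in> atlas E2 \<and> (b, C) \<in> fst c" using C by blast
  then have "chart_at E2 (b, C) \<in> atlas E2 \<and> (b, C) \<in> fst (chart_at E2 (b, C))"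
    unfolding chart_at_def by (rule someI_ex)
  then obtain B where B: "orthogonal_matrix B" "chart_at E2 (b, C) = E2_chart B" "(b, C) \<in> fst (E2_chart B)"
    unfolding atlas by force
  then obtain z where "z \<in> E2_dom" "(b, C) = E2_param B z" unfolding fst_E2_chart[OF B(1)] by blast
  then show ?thesis using that B(1,2) by blast
qed

lemma lie_bracket_E2: "lie_bracket E2 u v = e2_bracket u v"
proof -
  obtain A x0 where A: "orthogonal_matrix A" and c0: "chart_at E2 \<one>\<^bsub>E2\<^esub> = E2_chart A" and x0: "x0 \<in> E2_dom"
    and one: "\<one>\<^bsub>E2\<^esub> = E2_param A x0"
    unfolding E2_one_mult by (rule chart_at_E2[OF orthogonal_rot])
  obtain t0 where t0: "x0 = (0, t0)" and A_rot: "rot t0 ** A = mat 1"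
    using one by (cases x0) (simp add: E2_one_mult E2_param_def rot_zero)
  \<comment> \<open>A chart whose domain contains the identity is centred at a rotation, whichever
    one was chosen.\<close>
  have A_eq: "A = rot (- t0)"
  proof -
    have "rot (- t0) ** (rot t0 ** A) = A" by (simp add: matrix_mul_assoc rot_add rot_zero)
    then show ?thesis by (simp add: A_rot)
  qed
  \<comment> \<open>Translation turns the plane component by the current rotation and keeps the
    angular one. The unknown chart at the point cancels, as \<open>tangent_map\<close> enters it and
    \<open>to_coords\<close> leaves it.\<close>
  have field: "field_in_chart E2 (E2_chart A) (left_invariant_field E2 w) (b, t) = (rot (t - t0) *v fst w, snd w)"
    if bt: "(b, t) \<in> E2_dom" for b t w
  proof -
    let ?p = "E2_param A (b, t)"
    have p: "?p = (b, rot (t - t0))" by (simp add: E2_param_def A_eq rot_add)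
    obtain B z where B: "orthogonal_matrix B" and cp: "chart_at E2 ?p = E2_chart B" and z: "z \<in> E2_dom"
      and pz: "?p = E2_param B z"
      unfolding p by (rule chart_at_E2[OF orthogonal_rot])
    obtain b' t' where z': "z = (b', t')" by (cases z)
    have mult_one: "?p \<otimes>\<^bsub>E2\<^esub> \<one>\<^bsub>E2\<^esub> = ?p" by (simp add: E2_def p)
    have 1: "has_chart_derivative (E2_chart A) (E2_chart B) (\<lambda>h. ?p \<otimes>\<^bsub>E2\<^esub> h) \<one>\<^bsub>E2\<^esub> (\<lambda>(w, r). (rot (t - t0) *v w, r))"
      unfolding one t0 p
      by (rule E2_chart_derivative[OF A B, where b' = b' and t' = t'])
        (use x0 t0 mult_one one pz z z' p in simp_all)
    have 2: "has_chart_derivative (E2_chart B) (E2_chart A) (\<lambda>h. (0, rot 0) \<otimes>\<^bsub>E2\<^esub> h) ?p (\<lambda>(w, r). (rot 0 *v w, r))"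
      unfolding pz z'
      by (rule E2_chart_derivative[OF B A, where b' = b and t' = t])
        (use bt pz z z' in \<open>simp_all add: E2_one_mult\<close>)
    have "tangent_map E2 E2 (\<lambda>h. ?p \<otimes>\<^bsub>E2\<^esub> h) \<one>\<^bsub>E2\<^esub> = (\<lambda>(w, r). (rot (t - t0) *v w, r))"
      using has_chart_derivative_imp[OF 1] by (simp add: tangent_map_def chart_deriv_def c0 mult_one cp)
    moreover have "to_coords E2 (E2_chart A) ?p = (\<lambda>(w, r). (w, r))"
      using has_chart_derivative_imp[OF 2] unfolding E2_one_mult(2)
      by (simp add: to_coords_def chart_deriv_def cp rot_zero)
    ultimately show ?thesis
      by (simp add: field_in_chart_def E2_chart_inv[OF A bt] left_invariant_field_def case_prod_beta)
  qed
  have der: "frechet_derivative (field_in_chart E2 (E2_chart A) (left_invariant_field E2 w)) (at x0) d =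
      (snd d *\<^sub>R quarter_turn (fst w), 0)" for w d
  proof -
    have "((\<lambda>z. (rot (snd z - t0) *v fst w, snd w)) has_derivative (\<lambda>d. (snd d *\<^sub>R quarter_turn (fst w), 0))) (at x0)"
      unfolding rot_mult_vec
      by (auto intro!: derivative_eq_intros simp: t0)
    then have "(field_in_chart E2 (E2_chart A) (left_invariant_field E2 w) has_derivative
        (\<lambda>d. (snd d *\<^sub>R quarter_turn (fst w), 0))) (at x0)"
      by (rule has_derivative_transform_within_open[OF _ open_E2_dom x0])
        (metis field prod.collapse)
    from frechet_derivative_at[OF this, THEN fun_cong, of d] show ?thesis by simp
  qed
  have at_one: "field_in_chart E2 (E2_chart A) (left_invariant_field E2 w) x0 = w" for w
    using field[of 0 t0 w] x0 by (simp add: t0 rot_zero)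
  have "snd (E2_chart A) \<one>\<^bsub>E2\<^esub> = x0" using snd_E2_chart[OF A x0] one by simp
  then show ?thesis
    by (simp add: lie_bracket_def field_bracket_def Let_def c0 der at_one e2_bracket_def)
qed

section \<open>Contact Lie groups with a flat metric\<close>

lemma linear_inv_bij:
  assumes "linear F" "bij F"
  shows "linear (inv_into UNIV F)"
proof -
  have F: "F (inv_into UNIV F w) = w" for w
    using assms(2) by (simp add: bij_is_surj surj_f_inv_f)
  have "inv_into UNIV F (F u) = u" for u using assms(2) by (simp add: bij_is_inj)
  then have *: "inv_into UNIV F w = u" if "F u = w" for u w using that by blast
  show ?thesis
    by (rule linearI; rule *) (simp_all add: linear_add[OF assms(1)] linear_cmul[OF assms(1)] F)
qed

context lie_grp
begin

text \<open>\<open>F\<close> carries the Lie algebra to a model. It is an isometry onto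
  \<open>'e\<close> with its inner product when flatness is given, and an isomorphism with
  \<open>e2_bracket\<close> when flatness is to be shown.\<close>

lemma moving_frame_chart:
  assumes c: "c \<in> atlas G" and F: "linear F" "bij F"
    and br: "\<And>u v. F (lie_bracket G u v) = br (F u) (F v)"
    and nabla: "bilinear nabla" "\<And>u v w. nabla u v \<bullet> w = - (v \<bullet> nabla u w)" "\<And>u v. nabla u v - nabla v u = br u v"
    and M: "\<And>x a b. x \<in> chart_range c \<Longrightarrow> M x a b = F (mc_form c x a) \<bullet> F (mc_form c x b)"
  shows "moving_frame (chart_range c) (\<lambda>x a. F (mc_form c x a)) (\<lambda>x u. left_frame c x (inv_into UNIV F u)) br nabla M"
proof (rule moving_frame.intro)
  have inv_F: "inv_into UNIV F (F u) = u" "F (inv_into UNIV F w) = w" for u w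
    using F(2) by (simp_all add: bij_is_inj bij_is_surj surj_f_inv_f)
  have lin_inv: "linear (inv_into UNIV F)"
    by (rule linear_inv_bij[OF F])
  note bounded = linear_conv_bounded_linear[THEN iffD1, OF F(1)]
  fix x u a b assume x: "x \<in> chart_range c"
  show "linear (\<lambda>a. F (mc_form c x a))"
    using linear_compose[OF linear_mc_form[OF c x] F(1)] by (simp add: o_def)
  show "linear (\<lambda>u. left_frame c x (inv_into UNIV F u))"
    using linear_compose[OF lin_inv linear_left_frame[OF c x]] by (simp add: o_def)
  show "F (mc_form c x (left_frame c x (inv_into UNIV F u))) = u"
    by (simp add: mc_left_frame[OF c x] inv_F)
  show "left_frame c x (inv_into UNIV F (F (mc_form c x a))) = a"
    by (simp add: left_frame_mc[OF c x] inv_F)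
  have "frechet_derivative (\<lambda>y. F (mc_form c y w)) (at x) v = F (frechet_derivative (\<lambda>y. mc_form c y w) (at x) v)" for v w
    using frechet_derivative_at[OF bounded_linear.has_derivative[OF bounded mc_form_has_derivative[OF c x, of w]], THEN fun_cong, of v]
    by simp
  then show "frechet_derivative (\<lambda>y. F (mc_form c y b)) (at x) a - frechet_derivative (\<lambda>y. F (mc_form c y a)) (at x) b =
      - br (F (mc_form c x a)) (F (mc_form c x b))"
    by (simp add: linear_diff[OF F(1), symmetric] maurer_cartan[OF c x] linear_neg[OF F(1)] br)
next
  note bounded = linear_conv_bounded_linear[THEN iffD1, OF F(1)]
  show "smooth_on (chart_range c) (\<lambda>x. F (mc_form c x a))" for a
    by (rule smooth_on_bounded_linear[OF open_chart_range[OF c] bounded smooth_mc_form[OF c]])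
  show "smooth_on (chart_range c) (\<lambda>x. left_frame c x (inv_into UNIV F u))" for u
    by (rule smooth_left_frame[OF c])
qed (use open_chart_range[OF c] nabla M in auto)

lemma flat_metric_if_E2:
  assumes "locally_isomorphic G E2"
  shows "admits_flat_left_invariant_metric G"
proof -
  obtain F :: "'e \<Rightarrow> (real^2) \<times> real" where F: "linear F" "bij F"
    and br: "\<And>u v. F (lie_bracket G u v) = e2_bracket (F u) (F v)"
    using assms by (auto simp: locally_isomorphic_def lie_bracket_E2)
  \<comment> \<open>The Levi-Civita connection of the model: the angular component alone acts, by
    \<open>quarter_turn\<close>. These operators commute, and brackets have no angular component, so
    the curvature vanishes.\<close>
  define nabla :: "(real^2) \<times> real \<Rightarrow> (real^2) \<times> real \<Rightarrow> (real^2) \<times> real" where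
    "nabla u v = (snd u *\<^sub>R quarter_turn (fst v), 0)" for u v
  have J: "linear quarter_turn"
    by (rule linearI) (simp_all add: quarter_turn_def vec_eq_iff forall_2 vector_2)
  have nabla1: "bilinear nabla"
    unfolding bilinear_def
    by (intro conjI allI linearI)
      (simp_all add: nabla_def linear_add[OF J] linear_cmul[OF J] algebra_simps)
  have nabla2: "nabla u v \<bullet> w = - (v \<bullet> nabla u w)" for u v w
    by (simp add: nabla_def inner_prod_def quarter_turn_def inner_vec_def sum_2 vector_2 algebra_simps)
  have nabla3: "nabla u v - nabla v u = e2_bracket u v" for u v
    by (simp add: nabla_def e2_bracket_def)
  define q where "q u v = F u \<bullet> F v" for u v
  have q: "bilinear q"
    unfolding bilinear_def q_def
    by (intro conjI allI linearI) (simp_all add: linear_add[OF F(1)] linear_cmul[OF F(1)] inner_simps)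
  have F0: "F u \<noteq> 0" if "u \<noteq> 0" for u
    using that linear_0[OF F(1)] bij_is_inj[OF F(2)] by (metis injD)
  have inv: "left_invariant_metric G (extend_metric q)"
    by (rule left_invariant_extend_metric[OF q]) (use F0 in \<open>simp_all add: q_def inner_commute\<close>)
  have "flat G (extend_metric q)"
    unfolding flat_def
  proof (intro ballI allI impI)
    fix p u v assume p: "p \<in> carrier G"
    let ?c = "chart_at G p" and ?x = "snd (chart_at G p) p"
    note c = chart_at_in_atlas[OF p] and x = snd_in_chart_range[OF in_chart_at[OF p]]
    interpret moving_frame "chart_range ?c" "\<lambda>x a. F (mc_form ?c x a)" "\<lambda>x u. left_frame ?c x (inv_into UNIV F u)"
      e2_bracket nabla "tensor_in_chart G ?c (extend_metric q)"
      by (rule moving_frame_chart[OF c F br nabla1 nabla2 nabla3]) (simp add: extend_metric_in_chart[OF c] q_def)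
    let ?R = "curvature (tensor_in_chart G ?c (extend_metric q)) ?x u v v"
    have "F (mc_form ?c ?x ?R) = 0"
      unfolding Y_curvature[OF x]
      by (simp add: nabla_def e2_bracket_def linear_cmul[OF J] linear_0[OF J] mult.commute zero_prod_def)
    then have "left_frame ?c ?x (inv_into UNIV F 0) = ?R" using XY[OF x, of ?R] by simp
    then have "?R = 0" using linear_0[OF linear_X[OF x]] by simp
    moreover have "bilinear (extend_metric q p)"
      using inv p by (simp add: left_invariant_metric_def riemannian_metric_def)
    ultimately show "sectional_curvature G (extend_metric q) p u v = 0"
      by (simp add: sectional_curvature_def Let_def bilinear_lzero)
  qed
  then show ?thesis using inv by (auto simp: admits_flat_left_invariant_metric_def)
qed

lemma E2_if_flat_metric:
  assumes contact: "left_invariant_contact G \<eta>" and dim: "DIM('e) \<noteq> 1"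
    and m: "left_invariant_metric G m" and flat: "flat G m"
  shows "locally_isomorphic G E2"
proof -
  let ?e = "\<one>\<^bsub>G\<^esub>"
  have "bilinear (m ?e)" "\<And>u v. m ?e u v = m ?e v u" "\<And>u. u \<noteq> 0 \<Longrightarrow> m ?e u u > 0"
    using m one_closed unfolding left_invariant_metric_def riemannian_metric_def by blast+
  then obtain P :: "'e \<Rightarrow> 'e" where P: "linear P" "bij P" and mP: "\<And>u v. m ?e u v = P u \<bullet> P v"
    using inner_product_isometry[of "m ?e"] by metis
  have inv_P: "inv_into UNIV P (P u) = u" "P (inv_into UNIV P u) = u" for u
    using P(2) by (simp_all add: bij_is_inj bij_is_surj surj_f_inv_f)
  have lin_inv: "linear (inv_into UNIV P)"
    by (rule linear_inv_bij[OF P])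
  define br where "br u v = P (lie_bracket G (inv_into UNIV P u) (inv_into UNIV P v))" for u v
  note bb = bilinear_lie_bracket
  have br_bilinear: "bilinear br"
    unfolding bilinear_def br_def
    by (intro conjI allI linearI)
      (simp_all add: linear_add[OF P(1)] linear_cmul[OF P(1)] linear_add[OF lin_inv] linear_cmul[OF lin_inv]
        bilinear_ladd[OF bb] bilinear_radd[OF bb] bilinear_lmul[OF bb] bilinear_rmul[OF bb])
  have br_anti: "br u v = - br v u" for u v
    by (simp add: br_def lie_bracket_antisym[of "inv_into UNIV P u"] linear_neg[OF P(1)])
  obtain nabla where nabla: "bilinear nabla" "\<And>u v w. nabla u v \<bullet> w = - (v \<bullet> nabla u w)"
    "\<And>u v. nabla u v - nabla v u = br u v"
    using levi_civita_exists[OF br_bilinear br_anti] by blast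
  let ?M = "tensor_in_chart G chart_one m"
  interpret moving_frame "chart_range chart_one" "\<lambda>x a. P (mc_form chart_one x a)"
    "\<lambda>x u. left_frame chart_one x (inv_into UNIV P u)" br nabla ?M
    by (rule moving_frame_chart[OF chart_one(1) P _ nabla])
      (simp_all add: br_def inv_P left_invariant_tensor_in_chart[OF m chart_one(1)] mP)
  note x = coord_one_in
  have Y: "P (mc_form chart_one coord_one a) = P a" for a by (simp add: mc_form_one)
  define Rm where "Rm a b c = nabla a (nabla b c) - nabla b (nabla a c) - nabla (br a b) c" for a b c
  have curv: "P (curvature ?M coord_one (inv_into UNIV P a) (inv_into UNIV P b) (inv_into UNIV P c)) = Rm a b c" for a b c
    using Y_curvature[OF x, of "inv_into UNIV P a" "inv_into UNIV P b" "inv_into UNIV P c"] by (simp add: Y inv_P Rm_def)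
  note bn = bilinear_ladd[OF nabla(1)] bilinear_radd[OF nabla(1)] bilinear_lmul[OF nabla(1)]
    bilinear_rmul[OF nabla(1)] bilinear_lneg[OF nabla(1)] bilinear_lzero[OF nabla(1)] bilinear_rzero[OF nabla(1)]
    bilinear_radd[OF br_bilinear] bilinear_rmul[OF br_bilinear] bilinear_lmul[OF br_bilinear]
    bilinear_rzero[OF br_bilinear]
  have Rm_anti: "Rm a b c = - Rm b a c" for a b c
    by (simp add: Rm_def br_anti[of a b] bn)
  \<comment> \<open>Flatness speaks of independent pairs only; dependent ones are settled by
    antisymmetry in the first two arguments.\<close>
  have sec: "Rm a b b \<bullet> a = 0" for a b
  proof (cases "b = 0 \<or> (\<exists>k. a = k *\<^sub>R b)")
    case True
    have "Rm b b b + Rm b b b = 0" using Rm_anti[of b b b] eq_neg_iff_add_eq_0 by blast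
    then have "Rm b b b = 0" by (simp only: scaleR_2[symmetric] scaleR_eq_0_iff) simp
    moreover have "Rm (k *\<^sub>R b) b b = k *\<^sub>R Rm b b b" for k
      by (simp add: Rm_def bn scaleR_diff_right)
    ultimately have multiple: "Rm (k *\<^sub>R b) b b = 0" for k by simp
    have "Rm a 0 0 = 0" by (simp add: Rm_def bn)
    then show ?thesis using True multiple by auto
  next
    case False
    let ?u = "inv_into UNIV P a" and ?v = "inv_into UNIV P b"
    have "?u \<notin> span {?v}"
    proof
      assume "?u \<in> span {?v}"
      then obtain k where "?u = k *\<^sub>R ?v" by (auto simp: span_singleton)
      then have "P ?u = P (k *\<^sub>R ?v)" by simp
      then have "a = k *\<^sub>R b" by (simp add: linear_cmul[OF P(1)] inv_P)
      then show False using False by blast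
    qed
    moreover have "?v \<noteq> 0" using False inv_P(2)[of b] linear_0[OF P(1)] by auto
    ultimately have "?u \<noteq> ?v" "independent {?u, ?v}"
      by (auto simp: independent_insert span_base)
    then have "sectional_curvature G m ?e ?u ?v = 0"
      using flat one_closed unfolding flat_def by blast
    then have 0: "m ?e (curvature ?M coord_one ?u ?v ?v) ?u = 0 \<or> m ?e ?u ?u * m ?e ?v ?v - (m ?e ?u ?v)\<^sup>2 = 0"
      by (simp add: sectional_curvature_def Let_def chart_one_def[symmetric] coord_one_def[symmetric])
    \<comment> \<open>Strict Cauchy-Schwarz. Since a quotient by zero is zero, a vanishing
      denominator must be excluded before the numerator can be concluded to vanish.\<close>
    have "(a \<bullet> a) * (b \<bullet> b) - (a \<bullet> b)\<^sup>2 \<noteq> 0"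
    proof
      assume eq: "(a \<bullet> a) * (b \<bullet> b) - (a \<bullet> b)\<^sup>2 = 0"
      let ?w = "(b \<bullet> b) *\<^sub>R a - (a \<bullet> b) *\<^sub>R b"
      have "?w \<bullet> ?w = (b \<bullet> b) * ((a \<bullet> a) * (b \<bullet> b) - (a \<bullet> b)\<^sup>2)"
        by (simp add: inner_simps inner_commute power2_eq_square algebra_simps)
      then have "?w = 0" using eq by simp
      then have "(b \<bullet> b) *\<^sub>R a = (a \<bullet> b) *\<^sub>R b" by simp
      then have "(1 / (b \<bullet> b)) *\<^sub>R ((b \<bullet> b) *\<^sub>R a) = (1 / (b \<bullet> b)) *\<^sub>R ((a \<bullet> b) *\<^sub>R b)" by simp
      then have "a = ((a \<bullet> b) / (b \<bullet> b)) *\<^sub>R b" using False by simp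
      then show False using False by blast
    qed
    then have "m ?e (curvature ?M coord_one ?u ?v ?v) ?u = 0" using 0 by (simp add: mP inv_P)
    then show ?thesis by (simp add: mP curv inv_P)
  qed
  have skew_swap: "nabla a c \<bullet> d = - (nabla a d \<bullet> c)" for a c d
    using nabla(2)[of a c d] by (simp add: inner_commute)
  have "Rm a b c \<bullet> d = 0" for a b c d
  proof (rule curvature_tensor_zero[of "\<lambda>a b c d. Rm a b c \<bullet> d"])
    show "Rm a b c \<bullet> d = - (Rm b a c \<bullet> d)" for a b c d by (simp add: Rm_anti[of a b])
    show "Rm a b c \<bullet> d = - (Rm a b d \<bullet> c)" for a b c d
    proof -
      have "nabla a (nabla b c) \<bullet> d = nabla b (nabla a d) \<bullet> c" for a b
        using nabla(2)[of a "nabla b c" d] nabla(2)[of b c "nabla a d"] by (simp add: inner_commute)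
      then show ?thesis using skew_swap[of "br a b" c d] by (simp add: Rm_def inner_diff_left)
    qed
    show "Rm a b c \<bullet> d + Rm b c a \<bullet> d + Rm c a b \<bullet> d = 0" for a b c d
    proof -
      \<comment> \<open>Carried over from the Christoffel map of the metric, evaluated at the
        identity.\<close>
      have "Rm a b c + Rm b c a + Rm c a b = 0"
        unfolding curv[symmetric] linear_add[OF P(1), symmetric] bianchi[OF x] by (rule linear_0[OF P(1)])
      then show ?thesis by (simp add: inner_add_left[symmetric])
    qed
    show "Rm a (b + b') c \<bullet> d = Rm a b c \<bullet> d + Rm a b' c \<bullet> d" for a b b' c d
      by (simp add: Rm_def bn inner_simps)
    show "Rm a b (c + c') \<bullet> d = Rm a b c \<bullet> d + Rm a b c' \<bullet> d" for a b c c' d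
      by (simp add: Rm_def bn inner_simps)
    show "Rm a b b \<bullet> a = 0" for a b by (rule sec)
  qed
  then have "Rm a b c \<bullet> Rm a b c = 0" for a b c by blast
  then have Rm0: "Rm a b c = 0" for a b c by simp
  have form: "left_invariant_one_form G \<eta>" using contact by (simp add: left_invariant_contact_def)
  then have lin_\<eta>: "linear (\<eta> ?e)" by (simp add: left_invariant_one_form_def differential_one_form_def)
  obtain n where n: "DIM('e) = 2 * n + 1"
    "wedge (2 * n) 1 (wedge_power n (\<lambda>v. ext_deriv G \<eta> ?e (v 0) (v 1))) (\<lambda>v. \<eta> ?e (v 0)) \<noteq> (\<lambda>_. 0)"
    using contact one_closed unfolding left_invariant_contact_def by blast
  have d_bilinear: "bilinear (ext_deriv G \<eta> ?e)"
    unfolding bilinear_def ext_deriv_one[OF form]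
    by (intro conjI allI linearI)
      (simp_all add: linear_add[OF lin_\<eta>] linear_cmul[OF lin_\<eta>]
        bilinear_ladd[OF bb] bilinear_radd[OF bb] bilinear_lmul[OF bb] bilinear_rmul[OF bb])
  have d_anti: "ext_deriv G \<eta> ?e u v = - ext_deriv G \<eta> ?e v u" for u v
    by (simp add: ext_deriv_one[OF form] lie_bracket_antisym[of u v] linear_neg[OF lin_\<eta>])
  interpret flat_contact_algebra br nabla "\<lambda>x. \<eta> ?e (inv_into UNIV P x)"
  proof (intro flat_contact_algebra.intro flat_lie_algebra.intro flat_contact_algebra_axioms.intro)
    show "nabla u (nabla v w) - nabla v (nabla u w) = nabla (br u v) w" for u v w
      using Rm0[of u v w] by (simp add: Rm_def)
    show "linear (\<lambda>x. \<eta> ?e (inv_into UNIV P x))"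
      using linear_compose[OF lin_inv lin_\<eta>] by (simp add: o_def)
    fix x assume x: "\<eta> ?e (inv_into UNIV P x) = 0" "\<And>y. \<eta> ?e (inv_into UNIV P (br x y)) = 0"
    have "inv_into UNIV P x = 0"
    proof (rule contact_form_nondegenerate[OF n(1) d_bilinear d_anti lin_\<eta> n(2) x(1)])
      show "ext_deriv G \<eta> ?e (inv_into UNIV P x) y = 0" for y
        using x(2)[of "P y"] by (simp add: ext_deriv_one[OF form] br_def inv_P)
    qed
    then show "x = 0" using inv_P(2)[of x] linear_0[OF P(1)] by simp
  qed (use nabla dim in auto)
  obtain H :: "(real^2) \<times> real \<Rightarrow> 'e" where H: "linear H" "bij H"
    and brH: "\<And>u v. H (e2_bracket u v) = br (H u) (H v)"
    using e2_iso by blast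
  have inv_H: "inv_into UNIV H (H u) = u" "H (inv_into UNIV H w) = w" for u w
    using H(2) by (simp_all add: bij_is_inj bij_is_surj surj_f_inv_f)
  have "linear (inv_into UNIV H)" by (rule linear_inv_bij[OF H])
  then have "linear (inv_into UNIV H \<circ> P)" using P(1) by (intro linear_compose)
  moreover have "bij (inv_into UNIV H \<circ> P)" using H(2) P(2) by (intro bij_comp bij_imp_bij_inv)
  moreover have "(inv_into UNIV H \<circ> P) (lie_bracket G u v) = lie_bracket E2 ((inv_into UNIV H \<circ> P) u) ((inv_into UNIV H \<circ> P) v)" for u v
  proof -
    have "H (e2_bracket (inv_into UNIV H (P u)) (inv_into UNIV H (P v))) = P (lie_bracket G u v)"
      by (simp add: brH inv_H br_def inv_P)
    then have "inv_into UNIV H (P (lie_bracket G u v)) = e2_bracket (inv_into UNIV H (P u)) (inv_into UNIV H (P v))"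
      by (metis inv_H(1))
    then show ?thesis by (simp add: lie_bracket_E2)
  qed
  ultimately show ?thesis unfolding locally_isomorphic_def by blast
qed

lemma dim_if_E2:
  assumes "locally_isomorphic G E2"
  shows "DIM('e) = 3"
proof -
  obtain F :: "'e \<Rightarrow> (real^2) \<times> real" where F: "linear F" "bij F"
    using assms by (auto simp: locally_isomorphic_def)
  have "dim (range F) = dim (UNIV :: 'e set)"
    by (rule dim_image_eq[OF F(1)]) (use bij_is_inj[OF F(2)] in \<open>simp add: inj_on_subset\<close>)
  then show ?thesis using bij_is_surj[OF F(2)] by simp
qed

end

theorem theorem3:
  fixes G :: "('a, 'e::euclidean_space) lie_struct"
  assumes "contact_lie_group G"
  shows "(DIM('e) \<ge> 5 \<longrightarrow> \<not> admits_flat_left_invariant_metric G) \<and>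
         (DIM('e) \<noteq> 1 \<longrightarrow>
            (admits_flat_left_invariant_metric G \<longleftrightarrow> locally_isomorphic G E2))"
proof -
  interpret lie_grp G
    using assms by (simp add: lie_grp_def contact_lie_group_def)
  obtain \<eta> where "left_invariant_contact G \<eta>"
    using assms by (auto simp: contact_lie_group_def)
  note contact = this
  have iso: "locally_isomorphic G E2" if dim: "DIM('e) \<noteq> 1" and flat: "admits_flat_left_invariant_metric G"
  proof -
    obtain m where "left_invariant_metric G m" "flat G m"
      using flat unfolding admits_flat_left_invariant_metric_def by blast
    then show ?thesis by (rule E2_if_flat_metric[OF contact dim])
  qed
  show ?thesis
  proof (intro conjI impI notI)
    assume "DIM('e) \<ge> 5" "admits_flat_left_invariant_metric G"
    then show False using iso dim_if_E2 by simp
  next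
    assume "DIM('e) \<noteq> 1"
    then show "admits_flat_left_invariant_metric G \<longleftrightarrow> locally_isomorphic G E2"
      using iso flat_metric_if_E2 by blast
  qed
qed

end
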